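(* Let $a,b$ be two second order free random variables in a second order non-commutative probability space $(\mathcal A,\varphi,\varphi^2)$. Then for any $n,m\ge 1$, $$\kappa_{n,m}^{ab}=\sum_{\pi\in S_{NC}(n,m)}\kappa^a_\pi\,\kappa^b_{Kr_{n,m}(\pi)}+\sum_{\pi=\pi_1\times\pi_2}\ \sum_{\substack{U\in\pi_1\\ V\in\pi_2}}\kappa^a_{|U|,|V|}\,\kappa^a_{\pi\setminus\{U,V\}}\,\kappa^b_{Kr(\pi)}+\sum_{\pi=\pi_1\times\pi_2}\ \sum_{\substack{U\in Kr_n(\pi_1)\\ V\in Kr_m(\pi_2)}}\kappa^b_{|U|,|V|}\,\kappa^a_{\pi}\,\kappa^b_{Kr(\pi)\setminus\{U,V\}},$$ where the second and third sums are over $\pi=\pi_1\times\pi_2\in NC(n)\times NC(m)$ and $Kr(\pi)=Kr_n(\pi_1)\cup Kr_m(\pi_2)$ is the union of the Kreweras complements of $\pi_1$ and $\pi_2$.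
   Context: Permutations are composed right to left; $\#(\pi)$ is the number of cycles of $\pi$; a permutation is also regarded as a partition whose blocks are its cycles; $\vee$ is the join in the lattice of all set partitions. Second order non-commutative probability space: a triple $(\mathcal A,\varphi,\varphi^2)$ with $\mathcal A$ a unital algebra over $\mathbb C$, $\varphi:\mathcal A\to\mathbb C$ a linear functional with $\varphi(1)=1$, and $\varphi^2:\mathcal A\times\mathcal A\to\mathbb C$ bilinear, tracial in each argument, with $\varphi^2(x,1)=0=\varphi^2(1,x)$ for all $x\in\mathcal A$. $NC(p)$: non-crossing partitions of $\{1,\dots,p\}$, each identified with the permutation whose cycles are the blocks in increasing order (similarly for other linearly ordered sets). Put $\gamma_p=(1,\dots,p)$ and $\gamma_{p,q}=(1,\dots,p)(p+1,\dots,p+q)\in S_{p+q}$. $S_{NC}(p,q)$ (non-crossing annular permutations): all $\pi\in S_{p+q}$ such that $\pi\vee\gamma_{p,q}$ is the one-block partition and $\#(\pi)+\#(\pi^{-1}\gamma_{p,q})=p+q$. $S'_{NC}(p,q)$: all pairs $(\mathcal U,\pi)$ with $\pi=\pi_1\times\pi_2$, $\pi_1\in NC(\{1,\dots,p\})$, $\pi_2\in NC(\{p+1,\dots,p+q\})$, and $\mathcal U$ the partition whose blocks are the cycles of $\pi$ except that exactly one cycle $A$ of $\pi_1$ and one cycle $B$ of $\pi_2$ are merged into one block. Kreweras complements: $Kr_n(\pi)=\pi^{-1}\gamma_n$ for $\pi\in NC(n)$ and $Kr_{n,m}(\pi)=\pi^{-1}\gamma_{n,m}$ for $\pi\in S_{NC}(n,m)$.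 Cumulants: the free cumulants $\kappa_n$ are the multilinear functionals defined recursively by $\varphi(a_1\cdots a_n)=\sum_{\pi\in NC(n)}\prod_{V\in\pi}\kappa_{|V|}(a_V)$, and the second order free cumulants $\kappa_{p,q}$ are defined recursively by $$\varphi^2(a_1\cdots a_p,a_{p+1}\cdots a_{p+q})=\sum_{\pi\in S_{NC}(p,q)}\prod_{V\in\pi}\kappa_{|V|}(a_V)+\sum_{(\mathcal U,\pi)\in S'_{NC}(p,q)}\kappa_{|A|,|B|}(a_A,a_B)\prod_{V\in\pi\setminus\{A,B\}}\kappa_{|V|}(a_V),$$ where $a_V$ lists the $a_i$, $i\in V$, in the order of the cycle $V$ (increasing order for blocks of non-crossing partitions). Write $\kappa_n^x=\kappa_n(x,\dots,x)$, $\kappa_{n,m}^x=\kappa_{n,m}(x,\dots,x)$, and for a collection $\sigma$ of cycles $\kappa^x_\sigma=\prod_{V\in\sigma}\kappa^x_{|V|}$ (empty product $=1$). Elements $a,b$ are second order free iff all mixed cumulants vanish: $\kappa_n(a_1,\dots,a_n)=0$ ($n\ge2$) and $\kappa_{n,m}(a_1,\dots,a_{n+m})=0$ ($n,m\ge1$) whenever the $a_i\in\{a,b\}$ are not all equal. *)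

theory Defs
  imports Complex_Main "HOL-Library.Disjoint_Sets" "HOL-Combinatorics.Combinatorics"
begin

text \<open>
  The distribution has no class of complex algebras, so the scalar multiplication of the
  unital algebra is a parameter.
\<close>

locale second_order_prob_space = vector_space scale
  for scale :: "complex \<Rightarrow> 'a::ring_1 \<Rightarrow> 'a" +
  fixes \<phi> :: "'a \<Rightarrow> complex" and \<phi>2 :: "'a \<Rightarrow> 'a \<Rightarrow> complex"
  assumes scale_mult_left: "scale c x * y = scale c (x * y)"
    and scale_mult_right: "x * scale c y = scale c (x * y)"
    and linear_phi: "Vector_Spaces.linear scale (*) \<phi>"
    and phi_one: "\<phi> 1 = 1"
    and linear_phi2_left: "Vector_Spaces.linear scale (*) (\<lambda>x. \<phi>2 x y)"
    and linear_phi2_right: "Vector_Spaces.linear scale (*) (\<lambda>y. \<phi>2 x y)"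
    and phi2_tracial_left: "\<phi>2 (x * y) z = \<phi>2 (y * x) z"
    and phi2_tracial_right: "\<phi>2 z (x * y) = \<phi>2 z (y * x)"
    and phi2_one_right: "\<phi>2 x 1 = 0"
    and phi2_one_left: "\<phi>2 1 x = 0"


section \<open>Partitions and permutations\<close>

text \<open>The cycles of a permutation of \<open>A\<close>, fixed points included, as a partition of \<open>A\<close>.\<close>

definition perm_cycles :: "'b set \<Rightarrow> ('b \<Rightarrow> 'b) \<Rightarrow> 'b set set" where
  "perm_cycles A \<pi> = orbit \<pi> ` A"

text \<open>The join is the infimum of all common upper bounds; \<open>partition_join_least\<close> below
  confirms that it is the least upper bound with respect to \<open>refines\<close>.\<close>

definition partition_join :: "'b set \<Rightarrow> 'b set set \<Rightarrow> 'b set set \<Rightarrow> 'b set set" where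
  "partition_join A P Q = common_refinement {R. refines A P R \<and> refines A Q R}"

definition noncrossing :: "nat set set \<Rightarrow> bool" where
  "noncrossing P \<longleftrightarrow>
     \<not> (\<exists>U\<in>P. \<exists>V\<in>P. U \<noteq> V \<and>
          (\<exists>i\<in>U. \<exists>j\<in>V. \<exists>k\<in>U. \<exists>l\<in>V. i < j \<and> j < k \<and> k < l))"

definition NC :: "nat set \<Rightarrow> nat set set set" where
  "NC A = {P. partition_on A P \<and> noncrossing P}"

text \<open>The permutation whose cycles are the blocks of \<open>P\<close> in increasing order:
  the inner union is the block containing \<open>x\<close>, and it is empty if there is none.\<close>

definition perm_of :: "nat set set \<Rightarrow> nat \<Rightarrow> nat" where
  "perm_of P x = cycle_of_list (sorted_list_of_set (\<Union>{V \<in> P. x \<in> V})) x"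

definition gamma :: "nat set \<Rightarrow> nat \<Rightarrow> nat" where
  "gamma A = cycle_of_list (sorted_list_of_set A)"

definition annular_gamma :: "nat \<Rightarrow> nat \<Rightarrow> nat \<Rightarrow> nat" where
  "annular_gamma p q = gamma {1..p} \<circ> gamma {p+1..p+q}"

definition S_NC :: "nat \<Rightarrow> nat \<Rightarrow> (nat \<Rightarrow> nat) set" where
  "S_NC p q =
     {\<pi>. \<pi> permutes {1..p+q} \<and>
          partition_join {1..p+q} (perm_cycles {1..p+q} \<pi>)
              (perm_cycles {1..p+q} (annular_gamma p q)) = {{1..p+q}} \<and>
          card (perm_cycles {1..p+q} \<pi>)
            + card (perm_cycles {1..p+q} (inv \<pi> \<circ> annular_gamma p q)) = p + q}"

text \<open>The permutation component of a pair is represented by its partition into cycles.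
  For a pair \<open>(\<U>, P)\<close>, the two merged blocks are the two elements of \<open>P - \<U>\<close>.\<close>

definition S_NC' :: "nat \<Rightarrow> nat \<Rightarrow> (nat set set \<times> nat set set) set" where
  "S_NC' p q =
     {(\<U>, P). \<exists>P1 \<in> NC {1..p}. \<exists>P2 \<in> NC {p+1..p+q}. \<exists>A\<in>P1. \<exists>B\<in>P2.
        P = P1 \<union> P2 \<and> \<U> = insert (A \<union> B) (P - {A, B})}"

definition kreweras :: "nat set \<Rightarrow> nat set set \<Rightarrow> nat set set" where
  "kreweras A P = perm_cycles A (inv (perm_of P) \<circ> gamma A)"

definition annular_kreweras :: "nat \<Rightarrow> nat \<Rightarrow> (nat \<Rightarrow> nat) \<Rightarrow> nat set set" where
  "annular_kreweras p q \<pi> = perm_cycles {1..p+q} (inv \<pi> \<circ> annular_gamma p q)"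


subsection \<open>Consistency of the definitions\<close>

lemma partition_join_least:
  assumes "partition_on A P" "partition_on A Q" "A \<noteq> {}"
  shows "refines A P (partition_join A P Q)"
    and "refines A Q (partition_join A P Q)"
    and "refines A P R \<Longrightarrow> refines A Q R \<Longrightarrow> refines A (partition_join A P Q) R"
proof -
  let ?S = "{R. refines A P R \<and> refines A Q R}"
  have part: "\<And>R. R \<in> ?S \<Longrightarrow> partition_on A R"
    by (simp add: refines_def)
  have "partition_on A {A}"
    using assms(3) by (simp add: partition_on_space)
  then have "{A} \<in> ?S"
    using assms by (auto simp: refines_def partition_on_def)
  then have ne: "?S \<noteq> {}" by blast
  show "refines A P (partition_join A P Q)" "refines A Q (partition_join A P Q)"
    unfolding partition_join_def
    using common_refinement_coarsest[of ?S A] part ne assms by blast+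
  show "refines A P R \<Longrightarrow> refines A Q R \<Longrightarrow> refines A (partition_join A P Q) R"
    unfolding partition_join_def
    by (rule refines_common_refinement) (use part in auto)
qed

lemma NC_block_card_less:
  assumes "P \<in> NC A" "P \<noteq> {A}" "V \<in> P" "finite A"
  shows "card V < card A"
proof -
  have P: "\<Union>P = A" "disjoint P" "{} \<notin> P"
    using assms(1) by (auto simp: NC_def partition_on_def)
  have "V \<noteq> A"
  proof
    assume "V = A"
    then have "W = A" if "W \<in> P" for W
      using that P assms(3) by (metis Int_absorb1 Sup_upper disjointD)
    then show False using assms(2,3) \<open>V = A\<close> by blast
  qed
  then show ?thesis
    using P assms by (metis Sup_upper psubsetI psubset_card_mono)
qed

lemma S_NC'_merged:
  assumes "(\<U>, P) \<in> S_NC' p q"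
  obtains P1 P2 A B where "P1 \<in> NC {1..p}" "P2 \<in> NC {p+1..p+q}" "A \<in> P1" "B \<in> P2"
    "P = P1 \<union> P2" "\<U> = insert (A \<union> B) (P - {A, B})" "P - \<U> = {A, B}"
    "\<Union>(P - \<U>) \<inter> {1..p} = A" "\<Union>(P - \<U>) \<inter> {p+1..p+q} = B"
proof -
  from assms obtain P1 P2 A B where *: "P1 \<in> NC {1..p}" "P2 \<in> NC {p+1..p+q}" "A \<in> P1" "B \<in> P2"
    "P = P1 \<union> P2" "\<U> = insert (A \<union> B) (P - {A, B})"
    unfolding S_NC'_def by auto
  then have un: "\<Union>P1 = {1..p}" "\<Union>P2 = {p+1..p+q}" and ne: "A \<noteq> {}" "B \<noteq> {}"
    by (auto simp: NC_def partition_on_def)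
  have sub: "A \<subseteq> {1..p}" "B \<subseteq> {p+1..p+q}" using un * by blast+
  have disj: "{1..p} \<inter> {p+1..p+q} = {}" by auto
  have "A \<union> B \<notin> P"
  proof
    assume "A \<union> B \<in> P"
    then have "A \<union> B \<subseteq> {1..p} \<or> A \<union> B \<subseteq> {p+1..p+q}"
      using * un by blast
    then show False using ne sub disj by blast
  qed
  then have d: "P - \<U> = {A, B}" using * by auto
  have "\<Union>(P - \<U>) \<inter> {1..p} = A" "\<Union>(P - \<U>) \<inter> {p+1..p+q} = B"
    unfolding d using sub disj by auto
  then show ?thesis by (intro that[of P1 P2 A B] * d)
qed

lemma S_NC'_merged_card_less:
  assumes "(\<U>, P) \<in> S_NC' p q" "(\<U>, P) \<noteq> ({{1..p+q}}, {{1..p}, {p+1..p+q}})"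
  shows "card (\<Union>(P - \<U>) \<inter> {1..p}) + card (\<Union>(P - \<U>) \<inter> {p+1..p+q}) < p + q"
proof -
  obtain P1 P2 A B where *: "P1 \<in> NC {1..p}" "P2 \<in> NC {p+1..p+q}" "A \<in> P1" "B \<in> P2"
    "P = P1 \<union> P2" "\<U> = insert (A \<union> B) (P - {A, B})"
    and AB: "\<Union>(P - \<U>) \<inter> {1..p} = A" "\<Union>(P - \<U>) \<inter> {p+1..p+q} = B"
    using S_NC'_merged[OF assms(1)] by metis
  have le: "card A \<le> p" "card B \<le> q"
    using card_mono[of "{1..p}" A] card_mono[of "{p+1..p+q}" B] AB by auto
  show ?thesis
  proof (cases "P1 = {{1..p}} \<and> P2 = {{p+1..p+q}}")
    case True
    then have "P = {{1..p}, {p+1..p+q}}" "A = {1..p}" "B = {p+1..p+q}"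
      using * by auto
    moreover have "{1..p} \<union> {p+1..p+q} = {1..p+q}" by auto
    ultimately show ?thesis using * assms(2) by auto
  next
    case False
    then have "card A < p \<or> card B < q"
      using NC_block_card_less[of P1 "{1..p}" A] NC_block_card_less[of P2 "{p+1..p+q}" B] *
      by auto
    then show ?thesis unfolding AB using le by linarith
  qed
qed


section \<open>Cumulants\<close>

text \<open>Positions in a list are numbered from 1.\<close>

definition entries :: "'a list \<Rightarrow> nat list \<Rightarrow> 'a list" where
  "entries xs is = map (\<lambda>i. xs ! (i - 1)) is"

lemma length_entries [simp]: "length (entries xs is) = length is"
  by (simp add: entries_def)

text \<open>The moment-cumulant formula solved for the term of the one-block partition;
  see \<open>moment_cumulant\<close> below. Only nonempty argument lists are meaningful.\<close>

function free_cumulant :: "('a::ring_1 \<Rightarrow> complex) \<Rightarrow> 'a list \<Rightarrow> complex" where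
  "free_cumulant \<phi> xs =
     \<phi> (prod_list xs)
     - (\<Sum>P \<in> NC {1..length xs} - {{{1..length xs}}}.
          \<Prod>V\<in>P. free_cumulant \<phi> (entries xs (sorted_list_of_set V)))"
  by auto
termination
proof (relation "measure (\<lambda>(\<phi>, xs). length xs)", goal_cases)
  case (2 \<phi> xs P V)
  then show ?case using NC_block_card_less[of P "{1..length xs}" V] by simp
qed simp

declare free_cumulant.simps [simp del]

text \<open>The second order moment-cumulant formula solved for the term of \<open>S_NC'\<close> in which
  \<open>{1..p}\<close> and \<open>{p+1..p+q}\<close> are the merged blocks; see \<open>second_order_moment_cumulant\<close> below.
  The arguments at a cycle of an annular permutation are read off starting from its least element.\<close>

function free_cumulant2 ::
  "('a::ring_1 \<Rightarrow> complex) \<Rightarrow> ('a \<Rightarrow> 'a \<Rightarrow> complex) \<Rightarrow> 'a list \<Rightarrow> 'a list \<Rightarrow> complex" where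
  "free_cumulant2 \<phi> \<phi>2 xs ys =
     (let p = length xs; q = length ys in
     \<phi>2 (prod_list xs) (prod_list ys)
     - (\<Sum>\<pi> \<in> S_NC p q.
          \<Prod>V\<in>perm_cycles {1..p+q} \<pi>. free_cumulant \<phi> (entries (xs @ ys) (support \<pi> (Min V))))
     - (\<Sum>(\<U>, P) \<in> S_NC' p q - {({{1..p+q}}, {{1..p}, {p+1..p+q}})}.
          let A = \<Union>(P - \<U>) \<inter> {1..p}; B = \<Union>(P - \<U>) \<inter> {p+1..p+q} in
          free_cumulant2 \<phi> \<phi>2 (entries (xs @ ys) (sorted_list_of_set A))
                              (entries (xs @ ys) (sorted_list_of_set B))
          * (\<Prod>V\<in>P - {A, B}. free_cumulant \<phi> (entries (xs @ ys) (sorted_list_of_set V)))))"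
  by auto
termination
proof (relation "measure (\<lambda>(\<phi>, \<phi>2, xs, ys). length xs + length ys)", goal_cases)
  case (2 \<phi> \<phi>2 xs ys p q R \<U> P A B)
  then show ?case using S_NC'_merged_card_less[of \<U> P p q] by auto
qed simp

declare free_cumulant2.simps [simp del]

lemma moment_cumulant:
  assumes "xs \<noteq> []"
  shows "\<phi> (prod_list xs) =
    (\<Sum>P\<in>NC {1..length xs}. \<Prod>V\<in>P. free_cumulant \<phi> (entries xs (sorted_list_of_set V)))"
proof -
  let ?n = "length xs"
  have "finite (NC {1..?n})"
    by (rule finite_subset[of _ "Pow (Pow {1..?n})"]) (auto simp: NC_def partition_on_def)
  moreover have "{{1..?n}} \<in> NC {1..?n}"
    using assms by (cases xs) (auto simp: NC_def noncrossing_def intro!: partition_on_space)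
  moreover have "entries xs [1..<Suc ?n] = xs"
    by (rule nth_equalityI) (auto simp: entries_def simp del: upt_Suc)
  moreover have "sorted_list_of_set {1..?n} = [1..<Suc ?n]"
    by (metis atLeastLessThanSuc_atLeastAtMost sorted_list_of_set_range)
  ultimately show ?thesis
    by (simp add: sum.remove[of _ "{{1..?n}}"] free_cumulant.simps[of \<phi> xs] del: upt_Suc)
qed

lemma second_order_moment_cumulant:
  fixes xs ys :: "'a::ring_1 list"
  defines "p \<equiv> length xs" and "q \<equiv> length ys"
  assumes "xs \<noteq> []" "ys \<noteq> []"
  shows "\<phi>2 (prod_list xs) (prod_list ys) =
     (\<Sum>\<pi> \<in> S_NC p q.
        \<Prod>V\<in>perm_cycles {1..p+q} \<pi>. free_cumulant \<phi> (entries (xs @ ys) (support \<pi> (Min V))))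
     + (\<Sum>(\<U>, P) \<in> S_NC' p q.
          let A = \<Union>(P - \<U>) \<inter> {1..p}; B = \<Union>(P - \<U>) \<inter> {p+1..p+q} in
          free_cumulant2 \<phi> \<phi>2 (entries (xs @ ys) (sorted_list_of_set A))
                              (entries (xs @ ys) (sorted_list_of_set B))
          * (\<Prod>V\<in>P - {A, B}. free_cumulant \<phi> (entries (xs @ ys) (sorted_list_of_set V))))"
    (is "_ = _ + sum ?f _")
proof -
  let ?t = "({{1..p+q}}, {{1..p}, {p+1..p+q}})"
  have pq: "p \<ge> 1" "q \<ge> 1" using assms by (auto simp: Suc_le_eq)
  have "finite (S_NC' p q)"
  proof (rule finite_subset)
    show "S_NC' p q \<subseteq> Pow (Pow {1..p+q}) \<times> Pow (Pow {1..p+q})"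
    proof
      fix x assume "x \<in> S_NC' p q"
      then obtain P1 P2 A B where x: "P1 \<in> NC {1..p}" "P2 \<in> NC {p+1..p+q}" "A \<in> P1" "B \<in> P2"
        "snd x = P1 \<union> P2" "fst x = insert (A \<union> B) (snd x - {A, B})"
        unfolding S_NC'_def by auto
      then have "\<Union>P1 = {1..p}" "\<Union>P2 = {p+1..p+q}"
        by (auto simp: NC_def partition_on_def)
      then have "P1 \<subseteq> Pow {1..p}" "P2 \<subseteq> Pow {p+1..p+q}" by blast+
      moreover have "{1..p} \<subseteq> {1..p+q}" "{p+1..p+q} \<subseteq> {1..p+q}" by auto
      ultimately have "P1 \<union> P2 \<subseteq> Pow {1..p+q}" by blast
      then have "fst x \<subseteq> Pow {1..p+q}" "snd x \<subseteq> Pow {1..p+q}"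
        using x by blast+
      then show "x \<in> Pow (Pow {1..p+q}) \<times> Pow (Pow {1..p+q})"
        by (simp add: mem_Times_iff)
    qed
  qed simp
  moreover have t: "?t \<in> S_NC' p q"
  proof -
    have "{{1..p}} \<in> NC {1..p}" "{{p+1..p+q}} \<in> NC {p+1..p+q}"
      using pq by (auto simp: NC_def noncrossing_def intro!: partition_on_space)
    moreover have "{{1..p+q}} = insert ({1..p} \<union> {p+1..p+q})
        ({{1..p}, {p+1..p+q}} - {{1..p}, {p+1..p+q}})"
      by auto
    moreover have "{{1..p}, {p+1..p+q}} = {{1..p}} \<union> {{p+1..p+q}}" by blast
    ultimately show ?thesis
      unfolding S_NC'_def mem_Collect_eq prod.case
      by (intro bexI[of _ "{{1..p}}"] bexI[of _ "{{p+1..p+q}}"]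
            bexI[of _ "{1..p}"] bexI[of _ "{p+1..p+q}"] conjI) simp_all
  qed
  ultimately have s: "sum ?f (S_NC' p q) = ?f ?t + sum ?f (S_NC' p q - {?t})"
    by (rule sum.remove)
  have l: "sorted_list_of_set {1..p} = [1..<Suc p]"
    "sorted_list_of_set {p+1..p+q} = [p+1..<Suc (p+q)]"
    by (metis atLeastLessThanSuc_atLeastAtMost sorted_list_of_set_range)+
  have e: "entries (xs @ ys) [1..<Suc p] = xs" "entries (xs @ ys) [p+1..<Suc (p+q)] = ys"
    by (rule nth_equalityI;
        auto simp: entries_def p_def q_def nth_append simp del: upt_Suc)+
  have "{{1..p}, {p+1..p+q}} - {{1..p+q}} = {{1..p}, {p+1..p+q}}"
    using pq by (auto simp: Icc_eq_Icc)
  then have "\<Union>({{1..p}, {p+1..p+q}} - {{1..p+q}}) \<inter> {1..p} = {1..p}"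
    "\<Union>({{1..p}, {p+1..p+q}} - {{1..p+q}}) \<inter> {p+1..p+q} = {p+1..p+q}"
    by auto
  then have ft: "?f ?t = free_cumulant2 \<phi> \<phi>2 xs ys"
    using l e by (simp add: Let_def del: upt_Suc)
  have eq: "x = y + S" if "S = T + R" "T = c" "c = x - y - R" for x y S T R c :: complex
    using that by simp
  show ?thesis
    apply (rule eq[OF s ft])
    apply (subst free_cumulant2.simps)
    unfolding Let_def p_def q_def
    apply (rule refl)
    done
qed

text \<open>Vanishing of mixed cumulants. A choice of arguments from \<open>{a, b}\<close> is encoded by a
  list of labels, and it is mixed if both labels occur; so the condition is also meaningful
  for \<open>a = b\<close>, in which case it says that \<open>a\<close> is free from itself.\<close>

definition second_order_free ::
  "('a::ring_1 \<Rightarrow> complex) \<Rightarrow> ('a \<Rightarrow> 'a \<Rightarrow> complex) \<Rightarrow> 'a \<Rightarrow> 'a \<Rightarrow> bool" where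
  "second_order_free \<phi> \<phi>2 a b \<longleftrightarrow>
     (\<forall>ls. set ls = {True, False} \<longrightarrow>
        free_cumulant \<phi> (map (\<lambda>l. if l then a else b) ls) = 0) \<and>
     (\<forall>ls ms. ls \<noteq> [] \<longrightarrow> ms \<noteq> [] \<longrightarrow> set ls \<union> set ms = {True, False} \<longrightarrow>
        free_cumulant2 \<phi> \<phi>2 (map (\<lambda>l. if l then a else b) ls)
                           (map (\<lambda>l. if l then a else b) ms) = 0)"

definition kappa :: "('a::ring_1 \<Rightarrow> complex) \<Rightarrow> 'a \<Rightarrow> nat \<Rightarrow> complex" where
  "kappa \<phi> x n = free_cumulant \<phi> (replicate n x)"

definition kappa2 ::
  "('a::ring_1 \<Rightarrow> complex) \<Rightarrow> ('a \<Rightarrow> 'a \<Rightarrow> complex) \<Rightarrow> 'a \<Rightarrow> nat \<Rightarrow> nat \<Rightarrow> complex" where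
  "kappa2 \<phi> \<phi>2 x n m = free_cumulant2 \<phi> \<phi>2 (replicate n x) (replicate m x)"

definition kappa_prod :: "('a::ring_1 \<Rightarrow> complex) \<Rightarrow> 'a \<Rightarrow> nat set set \<Rightarrow> complex" where
  "kappa_prod \<phi> x \<sigma> = (\<Prod>V\<in>\<sigma>. kappa \<phi> x (card V))"

end

theory Submission
  imports Defs
begin

text \<open>
  Write a non-crossing permutation \<open>\<alpha>\<close> of \<open>\<gamma>\<close> as a factorization \<open>\<gamma> = \<alpha>\<delta>\<close> for which the
  genus inequality is an equality; its Kreweras complement is \<open>\<delta>\<close>. Expanding the moments
  of the alternating word \<open>abab\<dots>ab\<close> in cumulants, freeness leaves the permutations that
  preserve the letters, i.e. pairs \<open>(\<alpha>, \<beta>)\<close>, and these are the factorizations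
  \<open>\<gamma> = \<alpha>\<beta>\<delta>\<close> of minimal genus. Grouping them by \<open>\<sigma> = \<alpha>\<beta>\<close> gives the moment-cumulant
  formula of \<open>ab\<close> with the claimed right-hand sides in place of the cumulants. In the annular
  case either \<open>\<sigma>\<close> connects the two circles and \<open>\<alpha>\<close> refines the cycles of \<open>\<sigma>\<close>, or \<open>\<sigma>\<close> is a
  pair of discs and \<open>\<alpha>\<close> joins exactly one cycle of each; the two remaining sums come from the
  merged pairs of cycles in \<open>\<alpha>\<close> or in \<open>\<beta>\<close>. The moment-cumulant formula determines
  the cumulants by induction.
\<close>

section \<open>Cycles of products and the genus inequality\<close>

text \<open>Planarity is used only as an equality between cycle counts; crossings are examined only
  where \<open>NC\<close> is translated into geodesics. The genus inequality bounds \<open>nc X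
  \<alpha> + nc X \<beta> + nc X (\<alpha> \<circ> \<beta>)\<close> by \<open>card X\<close> plus
  twice the number of joint orbits, so every loss of a joint orbit costs two. This is the origin of
  the annular constants: if \<open>\<gamma>\<close> has two cycles, then
  \<open>nc X \<sigma> + nc X (inv \<sigma> \<circ> \<gamma>)\<close> is at most
  \<open>card X + 2\<close>, and at most \<open>card X\<close> if \<open>\<sigma>\<close> connects
  the circles. In a connected factorization \<open>\<gamma> = \<alpha>\<beta>\<delta>\<close> of
  minimal genus the deficit of two is spent exactly once, either between
  \<open>\<sigma> = \<alpha>\<beta>\<close> and \<open>\<gamma>\<close> or between
  \<open>\<alpha>\<close> and \<open>\<sigma>\<close>. The obstacle is the second case, where the
  fusion has to be located: \<open>\<alpha>\<close> is annular on the union of one cycle of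
  \<open>\<sigma>\<close> from each circle and planar elsewhere. That union is an arbitrary subset
  of the positions; for this reason the convolutions are set up on arbitrary finite sets and brought
  back to \<open>{1..n}\<close> by relabelling along cycles.\<close>

definition eqcl :: "('x \<times> 'x) set \<Rightarrow> ('x \<times> 'x) set" where
  "eqcl r = (r \<union> r\<inverse>)\<^sup>*"

text \<open>One relation for a whole set of maps: the cycles of a single permutation and the joint
  orbits of several become instances of the same \<open>classes\<close> and can be compared by
  comparing relations.\<close>

definition moves :: "'x set \<Rightarrow> ('x \<Rightarrow> 'x) set \<Rightarrow> ('x \<times> 'x) set" where
  "moves X F = {(x, f x) | x f. x \<in> X \<and> f \<in> F}"

definition classes :: "'x set \<Rightarrow> ('x \<times> 'x) set \<Rightarrow> 'x set set" where
  "classes X r = (\<lambda>x. eqcl r `` {x}) ` X"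

abbreviation nc :: "'x set \<Rightarrow> ('x \<Rightarrow> 'x) \<Rightarrow> nat" where
  "nc X f \<equiv> card (perm_cycles X f)"

lemma eqcl_refl [simp, intro]: "(x, x) \<in> eqcl r"
  by (simp add: eqcl_def)

lemma eqcl_base: "(x, y) \<in> r \<Longrightarrow> (x, y) \<in> eqcl r"
  by (auto simp: eqcl_def)

lemma eqcl_sym: "(x, y) \<in> eqcl r \<Longrightarrow> (y, x) \<in> eqcl r"
  unfolding eqcl_def by (rule symD[OF sym_rtrancl[OF sym_Un_converse]])

lemma eqcl_trans: "(x, y) \<in> eqcl r \<Longrightarrow> (y, z) \<in> eqcl r \<Longrightarrow> (x, z) \<in> eqcl r"
  by (auto simp: eqcl_def)

lemma eqcl_least:
  assumes "r \<subseteq> eqcl s"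
  shows "eqcl r \<subseteq> eqcl s"
proof -
  have "r \<union> r\<inverse> \<subseteq> eqcl s" using assms by (auto intro: eqcl_sym)
  then have "eqcl r \<subseteq> (eqcl s)\<^sup>*" unfolding eqcl_def[of r] by (rule rtrancl_mono)
  also have "\<dots> = eqcl s" unfolding eqcl_def by (rule rtrancl_idemp)
  finally show ?thesis .
qed

lemma eqcl_eqI: "r \<subseteq> eqcl s \<Longrightarrow> s \<subseteq> eqcl r \<Longrightarrow> eqcl r = eqcl s"
  by (intro equalityI eqcl_least)

lemma equiv_eqcl: "equiv UNIV (eqcl r)"
  by (rule equivI) (auto simp: refl_on_def intro: symI transI eqcl_sym eqcl_trans)

lemma eqcl_class_eq_iff: "eqcl r `` {x} = eqcl r `` {y} \<longleftrightarrow> (x, y) \<in> eqcl r"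
  using equiv_class_eq_iff[OF equiv_eqcl, of x y r] by simp

lemma eqcl_class_eq: "(x, y) \<in> eqcl r \<Longrightarrow> eqcl r `` {x} = eqcl r `` {y}"
  by (simp add: eqcl_class_eq_iff)

lemma eqcl_class_subset:
  assumes "x \<in> S" "\<And>u v. (u, v) \<in> r \<Longrightarrow> u \<in> S \<longleftrightarrow> v \<in> S"
  shows "eqcl r `` {x} \<subseteq> S"
proof
  fix y assume "y \<in> eqcl r `` {x}"
  then have "(x, y) \<in> (r \<union> r\<inverse>)\<^sup>*" by (simp add: eqcl_def)
  then show "y \<in> S" by induction (use assms in auto)
qed

text \<open>A path through the new edge enters and leaves it at \<open>i\<close> or
  \<open>j\<close>, so the only effect is to fuse the classes of these two points. If they were
  related before, the second alternative implies the first.\<close>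

lemma eqcl_insert_iff:
  "(x, y) \<in> eqcl (insert (i, j) r) \<longleftrightarrow>
     (x, y) \<in> eqcl r \<or> (x \<in> eqcl r `` {i, j} \<and> y \<in> eqcl r `` {i, j})"
proof
  assume "(x, y) \<in> eqcl (insert (i, j) r)"
  then have "(x, y) \<in> (insert (i, j) r \<union> (insert (i, j) r)\<inverse>)\<^sup>*" by (simp add: eqcl_def)
  then show "(x, y) \<in> eqcl r \<or> (x \<in> eqcl r `` {i, j} \<and> y \<in> eqcl r `` {i, j})"
  proof induction
    case (step y z)
    then have "(y, z) \<in> eqcl r \<or> y \<in> {i, j} \<and> z \<in> {i, j}"
      by (auto intro: eqcl_base eqcl_sym)
    then show ?case
    proof
      assume "(y, z) \<in> eqcl r"
      then show ?thesis using step.IH eqcl_trans[of x y r z] eqcl_trans[of i y r z] eqcl_trans[of j y r z] by auto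
    next
      assume "y \<in> {i, j} \<and> z \<in> {i, j}"
      then show ?thesis using step.IH eqcl_sym[of x y r] by auto
    qed
  qed simp
next
  let ?s = "insert (i, j) r"
  have sub: "eqcl r \<subseteq> eqcl ?s" by (intro eqcl_least) (auto intro: eqcl_base)
  have ij: "(i, j) \<in> eqcl ?s" by (auto intro: eqcl_base)
  have i: "(i, z) \<in> eqcl ?s" if "z \<in> eqcl r `` {i, j}" for z
    using that subsetD[OF sub] eqcl_trans[OF ij] by auto
  assume "(x, y) \<in> eqcl r \<or> (x \<in> eqcl r `` {i, j} \<and> y \<in> eqcl r `` {i, j})"
  then show "(x, y) \<in> eqcl ?s"
    using subsetD[OF sub] eqcl_trans[OF eqcl_sym[OF i[of x]] i[of y]] by auto
qed

lemma eqcl_insert_same: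
  assumes "(i, j) \<in> eqcl r"
  shows "eqcl (insert (i, j) r) = eqcl r"
  using assms by (intro eqcl_eqI) (auto intro: eqcl_base)

text \<open>Exactly the classes of \<open>i\<close> and \<open>j\<close> are replaced, by their
  union. That union is not an old class because the two classes were different.\<close>

lemma card_classes_insert:
  assumes "finite X" "i \<in> X" "j \<in> X" "(i, j) \<notin> eqcl r"
  shows "card (classes X (insert (i, j) r)) + 1 = card (classes X r)"
proof -
  let ?c = "\<lambda>x. eqcl r `` {x}"
  have new: "eqcl (insert (i, j) r) `` {x} = (if x \<in> ?c i \<union> ?c j then ?c i \<union> ?c j else ?c x)" for x
  proof (cases "x \<in> ?c i \<union> ?c j")
    case True
    then have "?c x \<subseteq> ?c i \<union> ?c j" using eqcl_class_eq[of i x r] eqcl_class_eq[of j x r] by auto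
    then show ?thesis using True eqcl_insert_iff[of x _ i j r] by auto
  next
    case False
    then show ?thesis using eqcl_insert_iff[of x _ i j r] by auto
  qed
  have ne: "?c i \<noteq> ?c j" using assms(4) by (simp add: eqcl_class_eq_iff)
  have notin: "?c i \<union> ?c j \<notin> classes X r"
  proof
    assume "?c i \<union> ?c j \<in> classes X r"
    then obtain x where "?c i \<union> ?c j = ?c x" by (auto simp: classes_def)
    then have "?c x = ?c i" "?c x = ?c j" unfolding eqcl_class_eq_iff using eqcl_refl by fast+
    then show False using ne by simp
  qed
  have eq: "classes X (insert (i, j) r) = insert (?c i \<union> ?c j) (classes X r - {?c i, ?c j})"
  proof (intro equalityI subsetI)
    fix C assume "C \<in> classes X (insert (i, j) r)"
    then obtain x where x: "x \<in> X" "C = eqcl (insert (i, j) r) `` {x}" by (auto simp: classes_def)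
    show "C \<in> insert (?c i \<union> ?c j) (classes X r - {?c i, ?c j})"
    proof (cases "x \<in> ?c i \<union> ?c j")
      case False
      then have "?c x \<noteq> ?c i" "?c x \<noteq> ?c j" using eqcl_refl[of x r] by auto
      then show ?thesis using False x new by (auto simp: classes_def)
    qed (use x new in auto)
  next
    fix C assume "C \<in> insert (?c i \<union> ?c j) (classes X r - {?c i, ?c j})"
    then consider "C = ?c i \<union> ?c j" | x where "x \<in> X" "C = ?c x" "?c x \<noteq> ?c i" "?c x \<noteq> ?c j"
      by (auto simp: classes_def)
    then show "C \<in> classes X (insert (i, j) r)"
    proof cases
      case 1
      then have "C = eqcl (insert (i, j) r) `` {i}" using new[of i] by auto
      then show ?thesis using assms(2) by (auto simp: classes_def)
    next
      case 2
      then have "x \<notin> ?c i \<union> ?c j" using eqcl_class_eq[of i x r] eqcl_class_eq[of j x r] by auto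
      then show ?thesis using 2 new[of x] by (auto simp: classes_def)
    qed
  qed
  have "?c i \<in> classes X r" "?c j \<in> classes X r" using assms by (auto simp: classes_def)
  moreover have fin: "finite (classes X r)" using assms(1) by (simp add: classes_def)
  ultimately have "card (classes X r - {?c i, ?c j}) + 2 = card (classes X r)"
    using ne card_mono[of "classes X r" "{?c i, ?c j}"] by (simp add: card_Diff_subset)
  then show ?thesis unfolding eq using notin fin by simp
qed

lemma classes_cong: "eqcl r = eqcl s \<Longrightarrow> classes X r = classes X s"
  by (simp add: classes_def)

text \<open>An injective map that sends a finite set into itself maps it onto itself. Forward
  invariance thus already closes the set under the backward steps that \<open>eqcl\<close>
  allows.\<close>

lemma moves_class_subset:
  assumes "finite S" "x \<in> S" "S \<subseteq> X" "\<And>f. f \<in> F \<Longrightarrow> bij_betw f X X" "\<And>f. f \<in> F \<Longrightarrow> f ` S \<subseteq> S"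
  shows "eqcl (moves X F) `` {x} \<subseteq> S"
proof (rule eqcl_class_subset[OF assms(2)])
  fix u v assume "(u, v) \<in> moves X F"
  then obtain f where f: "f \<in> F" "v = f u" "u \<in> X" by (auto simp: moves_def)
  have inj: "inj_on f X" using assms(4) f by (auto simp: bij_betw_def)
  then have "f ` S = S" using assms f by (metis endo_inj_surj inj_on_subset)
  then show "u \<in> S \<longleftrightarrow> v \<in> S" using f inj assms(3) by (metis image_eqI inj_on_image_mem_iff)
qed

text \<open>The maps are bijections of \<open>X\<close> only and may be arbitrary outside.
  \<open>restrict_id f X\<close> is a permutation with the same orbits in \<open>X\<close>, to which
  facts on permutations apply.\<close>

lemma orbit_restrict_id:
  assumes "bij_betw f X X" "x \<in> X"
  shows "orbit f x = orbit (restrict_id f X) x" "orbit f x \<subseteq> X"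
proof -
  show sub: "orbit f x \<subseteq> X"
  proof
    fix y assume "y \<in> orbit f x"
    then show "y \<in> X" by induction (use assms in \<open>auto simp: bij_betw_def\<close>)
  qed
  show "orbit f x = orbit (restrict_id f X) x"
    by (rule orbit_cong0[OF assms(2)]) (use assms in \<open>auto simp: bij_betw_def\<close>)
qed

lemma self_in_orbit:
  assumes "finite X" "bij_betw f X X" "x \<in> X"
  shows "x \<in> orbit f x"
proof -
  have "permutation (restrict_id f X)"
    using assms permutes_restrict_id permutes_imp_permutation by blast
  then show ?thesis using orbit_restrict_id(1)[OF assms(2,3)] permutation_self_in_orbit by metis
qed

text \<open>Orbits go forward only. They are nevertheless full classes, because an orbit in a finite
  set is invariant under the injective map \<open>f\<close>.\<close>

lemma orbit_eq_class:
  assumes "finite X" "bij_betw f X X" "x \<in> X"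
  shows "orbit f x = eqcl (moves X {f}) `` {x}"
proof
  show "orbit f x \<subseteq> eqcl (moves X {f}) `` {x}"
  proof
    fix y assume "y \<in> orbit f x"
    then have "y \<in> X \<and> (x, y) \<in> eqcl (moves X {f})"
    proof induction
      case base
      then show ?case using assms by (auto simp: moves_def bij_betw_def intro: eqcl_base)
    next
      case (step y)
      then have "(y, f y) \<in> eqcl (moves X {f})" by (auto simp: moves_def intro: eqcl_base)
      then show ?case using step assms(2) eqcl_trans by (auto simp: bij_betw_def intro: eqcl_trans)
    qed
    then show "y \<in> eqcl (moves X {f}) `` {x}" by blast
  qed
  show "eqcl (moves X {f}) `` {x} \<subseteq> orbit f x"
    using assms orbit_restrict_id(2)[OF assms(2,3)] self_in_orbit[OF assms]
    by (intro moves_class_subset) (auto intro: finite_subset orbit.step)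
qed

lemma perm_cycles_eq_classes:
  "finite X \<Longrightarrow> bij_betw f X X \<Longrightarrow> perm_cycles X f = classes X (moves X {f})"
  unfolding perm_cycles_def classes_def by (rule image_cong) (auto simp: orbit_eq_class)

section \<open>Transpositions merge or split cycles\<close>

lemma bij_betw_transpose:
  "i \<in> X \<Longrightarrow> j \<in> X \<Longrightarrow> bij_betw (transpose i j) X X"
  by (simp add: permutes_imp_bij permutes_swap_id)

lemma bij_betw_comp: "bij_betw f X X \<Longrightarrow> bij_betw g X X \<Longrightarrow> bij_betw (f \<circ> g) X X"
  by (rule bij_betw_trans)

text \<open>If \<open>i\<close> and \<open>j\<close> lie in different cycles of \<open>f\<close>,
  precomposing with the transposition joins these cycles, which has the same effect on the classes
  as one new edge.\<close>

lemma eqcl_moves_transpose: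
  assumes "finite X" "bij_betw f X X" "i \<in> X" "j \<in> X" "(i, j) \<notin> eqcl (moves X {f})"
  shows "eqcl (moves X {f \<circ> transpose i j}) = eqcl (insert (i, j) (moves X {f}))"
proof -
  let ?g = "f \<circ> transpose i j" and ?r = "insert (i, j) (moves X {f})"
  have ij: "(i, j) \<in> eqcl ?r" by (auto intro: eqcl_base)
  have mf: "(x, f x) \<in> eqcl ?r" if "x \<in> X" for x
    using that by (intro eqcl_base) (auto simp: moves_def)
  have mg: "(x, ?g x) \<in> eqcl (moves X {?g})" if "x \<in> X" for x
    using that by (intro eqcl_base) (auto simp: moves_def)
  have i: "i \<notin> orbit f j" using orbit_eq_class[OF assms(1,2,4)] assms(5) eqcl_sym[of j i] by auto
  \<comment> \<open>\<open>?g\<close> sends \<open>i\<close> to \<open>f j\<close> and then agrees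
    with \<open>f\<close> along the cycle of \<open>j\<close>, which avoids \<open>i\<close>, until
    \<open>j\<close> is reached.\<close>
  have "(i, y) \<in> eqcl (moves X {?g})" if "y \<in> orbit f j" for y
    using that
  proof induction
    case base then show ?case using mg[OF assms(3)] by (simp add: comp_def)
  next
    case (step y)
    show ?case
    proof (cases "y = j")
      case True then show ?thesis using mg[OF assms(3)] by (simp add: comp_def)
    next
      case False
      have "y \<in> X" using step(1) orbit_restrict_id(2)[OF assms(2,4)] by blast
      then have "(y, f y) \<in> eqcl (moves X {?g})" using mg[of y] False step(1) i by (metis comp_apply transpose_apply_other)
      then show ?thesis using step.IH eqcl_trans by metis
    qed
  qed
  then have ij': "(i, j) \<in> eqcl (moves X {?g})" using self_in_orbit assms by metis
  show ?thesis
  proof (rule eqcl_eqI)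
    show "moves X {?g} \<subseteq> eqcl ?r"
    proof
      fix z assume "z \<in> moves X {?g}"
      then obtain x where x: "x \<in> X" "z = (x, ?g x)" by (auto simp: moves_def)
      have "(x, transpose i j x) \<in> eqcl ?r" using ij eqcl_sym[OF ij] by (auto simp: transpose_def)
      moreover have "transpose i j x \<in> X" using x assms by (auto simp: transpose_def)
      ultimately show "z \<in> eqcl ?r" using x(2) mf eqcl_trans by (metis comp_apply)
    qed
    show "?r \<subseteq> eqcl (moves X {?g})"
    proof
      fix z assume "z \<in> ?r"
      then consider "z = (i, j)" | x where "x \<in> X" "z = (x, f x)" by (auto simp: moves_def)
      then show "z \<in> eqcl (moves X {?g})"
      proof cases
        case 2
        have "(x, transpose i j x) \<in> eqcl (moves X {?g})" using ij' eqcl_sym[OF ij'] by (auto simp: transpose_def)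
        moreover have "transpose i j x \<in> X" using 2 assms by (auto simp: transpose_def)
        ultimately show ?thesis using 2 mg eqcl_trans by (metis comp_apply transpose_involutory)
      qed (use ij' in simp)
    qed
  qed
qed

text \<open>The arc \<open>f i, f (f i), ..., j\<close> becomes a cycle of its own:
  \<open>?g\<close> sends \<open>j\<close> to \<open>f i\<close> and agrees with \<open>f\<close> on
  the other points of the arc. It does not contain \<open>i\<close>.\<close>

lemma eqcl_moves_transpose_split:
  assumes "finite X" "bij_betw f X X" "i \<in> X" "j \<in> X" "i \<noteq> j" "(i, j) \<in> eqcl (moves X {f})"
  shows "(i, j) \<notin> eqcl (moves X {f \<circ> transpose i j})"
proof -
  let ?g = "f \<circ> transpose i j"
  have "j \<in> orbit f i" using orbit_eq_class[OF assms(1-3)] assms(6) by auto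
  then have "\<exists>n. 0 < n \<and> (f ^^ n) i = j" by (auto simp: orbit_altdef)
  \<comment> \<open>By minimality \<open>j\<close> occurs only at the end of the arc, and a visit to
    \<open>i\<close> on the way would make \<open>j\<close> appear earlier.\<close>
  then obtain n where n: "0 < n" "(f ^^ n) i = j" and least: "\<And>l. l < n \<Longrightarrow> 0 < l \<Longrightarrow> (f ^^ l) i \<noteq> j"
    using exists_least_iff[of "\<lambda>n. 0 < n \<and> (f ^^ n) i = j"] by auto
  define S where "S = (\<lambda>l. (f ^^ l) i) ` {1..n}"
  have SX: "S \<subseteq> X" unfolding S_def
  proof clarify
    fix l show "(f ^^ l) i \<in> X" using assms(2,3) by (induction l) (auto simp: bij_betw_def)
  qed
  have iS: "i \<notin> S"
  proof
    assume "i \<in> S"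
    then obtain l where l: "1 \<le> l" "l \<le> n" "(f ^^ l) i = i" unfolding S_def by auto
    then have "l < n" using n assms(5) by (metis le_neq_implies_less)
    have "(f ^^ (n - l)) ((f ^^ l) i) = j" using n l by (metis funpow_add comp_apply le_add_diff_inverse2)
    then show False using least[of "n - l"] l \<open>l < n\<close> by simp
  qed
  have "?g ` S \<subseteq> S"
  proof
    fix y assume "y \<in> ?g ` S"
    then obtain l where l: "1 \<le> l" "l \<le> n" "y = ?g ((f ^^ l) i)" unfolding S_def by auto
    show "y \<in> S"
    proof (cases "l = n")
      case True
      then have "y = (f ^^ 1) i" using l n by simp
      then show ?thesis unfolding S_def using n(1) by (intro image_eqI[of _ _ 1]) auto
    next
      case False
      have "(f ^^ l) i \<in> S" unfolding S_def using l by simp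
      then have "(f ^^ l) i \<noteq> i" using iS by metis
      moreover have "(f ^^ l) i \<noteq> j" using False l least by simp
      ultimately have "transpose i j ((f ^^ l) i) = (f ^^ l) i" by (simp add: transpose_apply_other)
      then have "y = (f ^^ Suc l) i" using l by simp
      then show ?thesis unfolding S_def using l False by (intro image_eqI[of _ _ "Suc l"]) auto
    qed
  qed
  moreover have "j \<in> S" unfolding S_def using n by (intro image_eqI[of _ _ n]) auto
  ultimately have "eqcl (moves X {?g}) `` {j} \<subseteq> S"
    using assms SX by (intro moves_class_subset bij_betw_comp) (auto simp: S_def intro: bij_betw_trans bij_betw_transpose)
  then show ?thesis using iS eqcl_sym[of i j "moves X {?g}"] by auto
qed

lemma nc_merge:
  assumes "finite X" "bij_betw f X X" "i \<in> X" "j \<in> X" "(i, j) \<notin> eqcl (moves X {f})"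
  shows "nc X (f \<circ> transpose i j) + 1 = nc X f"
  using card_classes_insert[OF assms(1,3,4,5)] classes_cong[OF eqcl_moves_transpose[OF assms]]
  using assms by (simp add: perm_cycles_eq_classes bij_betw_trans[OF bij_betw_transpose])

text \<open>Composing with the transposition once more restores \<open>f\<close>, so a split is a
  merge read backwards.\<close>

lemma nc_split:
  assumes "finite X" "bij_betw f X X" "i \<in> X" "j \<in> X" "i \<noteq> j" "(i, j) \<in> eqcl (moves X {f})"
  shows "nc X (f \<circ> transpose i j) = nc X f + 1"
proof -
  have "bij_betw (f \<circ> transpose i j) X X" using assms by (metis bij_betw_comp bij_betw_transpose)
  then have "nc X (f \<circ> transpose i j \<circ> transpose i j) + 1 = nc X (f \<circ> transpose i j)"
    using assms eqcl_moves_transpose_split[OF assms] by (intro nc_merge)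
  then show ?thesis by (simp add: comp_assoc)
qed

lemma perm_cycles_cong:
  assumes "bij_betw f X X" "\<And>x. x \<in> X \<Longrightarrow> f x = g x"
  shows "perm_cycles X f = perm_cycles X g"
proof -
  have "orbit f x = orbit g x" if "x \<in> X" for x
    by (rule orbit_cong0[OF that]) (use assms in \<open>auto simp: bij_betw_def\<close>)
  then show ?thesis by (simp add: perm_cycles_def)
qed

lemma perm_cycles_id:
  assumes "\<And>x. x \<in> X \<Longrightarrow> f x = x"
  shows "perm_cycles X f = (\<lambda>x. {x}) ` X"
  unfolding perm_cycles_def using assms by (intro image_cong) (auto simp: orbit_eq_singleton_iff)

lemma nc_id: "(\<And>x. x \<in> X \<Longrightarrow> f x = x) \<Longrightarrow> nc X f = card X"
  by (simp add: perm_cycles_id card_image)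

text \<open>Induction on the number of points moved by \<open>\<beta>\<close>: multiplying by a transposition
  changes the number of cycles by one, and it lowers the number of joint orbits only
  if it merges two cycles of the product as well.\<close>

theorem genus_inequality:
  assumes "finite X" "bij_betw \<alpha> X X" "bij_betw \<beta> X X"
  shows "nc X \<alpha> + nc X \<beta> + nc X (\<alpha> \<circ> \<beta>) \<le> card X + 2 * card (classes X (moves X {\<alpha>, \<beta>}))"
  using assms(3)
proof (induction "card {x\<in>X. \<beta> x \<noteq> x}" arbitrary: \<beta> rule: less_induct)
  case (less \<beta>)
  show ?case
  proof (cases "\<exists>i\<in>X. \<beta> i \<noteq> i")
    case False
    then have "eqcl (moves X {\<alpha>, \<beta>}) = eqcl (moves X {\<alpha>})"
      by (intro eqcl_eqI) (auto simp: moves_def intro: eqcl_base)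
    moreover have "nc X (\<alpha> \<circ> \<beta>) = nc X \<alpha>"
      using False assms less.prems by (intro arg_cong[of _ _ card] perm_cycles_cong) (auto intro: bij_betw_comp)
    ultimately show ?thesis using False assms
      by (simp add: nc_id perm_cycles_eq_classes classes_def)
  next
    case True
    then obtain i where i: "i \<in> X" "\<beta> i \<noteq> i" by blast
    then have "i \<in> \<beta> ` X" using bij_betw_imp_surj_on[OF less.prems] by auto
    then obtain p where p: "p \<in> X" "\<beta> p = i" by auto
    then have pi: "p \<noteq> i" using i by auto
    \<comment> \<open>As \<open>p\<close> is the preimage of \<open>i\<close>, the map
      \<open>\<beta>0\<close> fixes \<open>i\<close> and moves no point that \<open>\<beta>\<close>
      fixes, so the induction hypothesis applies to it. Going back to \<open>\<beta>\<close> merges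
      the singleton cycle of \<open>i\<close> with the cycle of \<open>p\<close>.\<close>
    define \<beta>0 where "\<beta>0 = \<beta> \<circ> transpose i p"
    have b0: "bij_betw \<beta>0 X X" unfolding \<beta>0_def using i p less.prems by (intro bij_betw_comp bij_betw_transpose)
    have \<beta>: "\<beta> = \<beta>0 \<circ> transpose i p" by (simp add: \<beta>0_def comp_assoc)
    have b0i: "\<beta>0 i = i" using p by (simp add: \<beta>0_def)
    have ib: "\<beta> i \<noteq> i" by (rule i(2))
    have sup: "{x\<in>X. \<beta>0 x \<noteq> x} \<subset> {x\<in>X. \<beta> x \<noteq> x}"
      using i p pi b0i by (auto simp: \<beta>0_def transpose_def split: if_splits)
    then have "card {x\<in>X. \<beta>0 x \<noteq> x} < card {x\<in>X. \<beta> x \<noteq> x}"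
      using assms(1) by (intro psubset_card_mono) auto
    from less.hyps[OF this b0] have IH: "nc X \<alpha> + nc X \<beta>0 + nc X (\<alpha> \<circ> \<beta>0) \<le> card X + 2 * card (classes X (moves X {\<alpha>, \<beta>0}))" .
    have "eqcl (moves X {\<beta>0}) `` {i} \<subseteq> {i}"
      using b0 b0i i by (intro moves_class_subset) auto
    then have "(i, p) \<notin> eqcl (moves X {\<beta>0})" using pi by blast
    then have c1: "nc X \<beta> + 1 = nc X \<beta>0" unfolding \<beta> using i p assms b0 by (intro nc_merge)
    have ba: "bij_betw (\<alpha> \<circ> \<beta>0) X X" using assms b0 by (intro bij_betw_comp)
    let ?r = "moves X {\<alpha>, \<beta>0}"
    \<comment> \<open>The edge \<open>(i, p)\<close> is implied by \<open>\<beta> p = i\<close>.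
      Conversely, each step of \<open>\<beta>\<close> is a step of \<open>\<beta>0\<close>, possibly
      preceded by this edge.\<close>
    have J: "eqcl (moves X {\<alpha>, \<beta>}) = eqcl (insert (i, p) ?r)"
    proof (rule eqcl_eqI)
      have ip: "(i, p) \<in> eqcl (insert (i, p) ?r)" by (auto intro: eqcl_base)
      have m: "(x, \<beta>0 x) \<in> eqcl (insert (i, p) ?r)" "(x, \<alpha> x) \<in> eqcl (insert (i, p) ?r)" if "x \<in> X" for x
        using that by (auto simp: moves_def intro: eqcl_base)
      have "(x, \<beta> x) \<in> eqcl (insert (i, p) ?r)" if "x \<in> X" for x
      proof -
        have "(x, transpose i p x) \<in> eqcl (insert (i, p) ?r)" using ip eqcl_sym[OF ip] by (auto simp: transpose_def)
        moreover have "transpose i p x \<in> X" using that i p by (auto simp: transpose_def)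
        ultimately show ?thesis unfolding \<beta> using m eqcl_trans by (metis comp_apply)
      qed
      then show "moves X {\<alpha>, \<beta>} \<subseteq> eqcl (insert (i, p) ?r)" using m by (auto simp: moves_def)
      let ?s = "moves X {\<alpha>, \<beta>}"
      have m': "(x, \<beta> x) \<in> eqcl ?s" "(x, \<alpha> x) \<in> eqcl ?s" if "x \<in> X" for x
        using that by (auto simp: moves_def intro: eqcl_base)
      have pi': "(p, i) \<in> eqcl ?s" using m'[OF p(1)] p(2) by simp
      have "(x, \<beta>0 x) \<in> eqcl ?s" if "x \<in> X" for x
      proof -
        have "(x, transpose i p x) \<in> eqcl ?s" using pi' eqcl_sym[OF pi'] by (auto simp: transpose_def)
        moreover have "transpose i p x \<in> X" using that i p by (auto simp: transpose_def)
        ultimately show ?thesis unfolding \<beta>0_def using m' eqcl_trans by (metis comp_apply)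
      qed
      then show "insert (i, p) ?r \<subseteq> eqcl ?s" using m' eqcl_sym[OF pi'] by (auto simp: moves_def)
    qed
    have ab: "\<alpha> \<circ> \<beta> = (\<alpha> \<circ> \<beta>0) \<circ> transpose i p" by (simp add: \<beta> comp_assoc)
    have sub: "eqcl (moves X {\<alpha> \<circ> \<beta>0}) \<subseteq> eqcl ?r"
    proof (rule eqcl_least)
      show "moves X {\<alpha> \<circ> \<beta>0} \<subseteq> eqcl ?r"
      proof
        fix z assume "z \<in> moves X {\<alpha> \<circ> \<beta>0}"
        then obtain x where x: "x \<in> X" "z = (x, \<alpha> (\<beta>0 x))" by (auto simp: moves_def)
        then have "\<beta>0 x \<in> X" using b0 by (auto simp: bij_betw_def)
        then have "(x, \<beta>0 x) \<in> eqcl ?r" "(\<beta>0 x, \<alpha> (\<beta>0 x)) \<in> eqcl ?r" using x by (auto simp: moves_def intro: eqcl_base)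
        then show "z \<in> eqcl ?r" using x eqcl_trans by metis
      qed
    qed
    show ?thesis
    proof (cases "(i, p) \<in> eqcl ?r")
      case True
      then have "classes X (moves X {\<alpha>, \<beta>}) = classes X ?r" using J eqcl_insert_same by (metis classes_cong)
      moreover have "nc X (\<alpha> \<circ> \<beta>) \<le> nc X (\<alpha> \<circ> \<beta>0) + 1"
        unfolding ab using nc_merge[OF assms(1) ba i(1) p(1)] nc_split[OF assms(1) ba i(1) p(1)] pi by fastforce
      ultimately show ?thesis using IH c1 by simp
    next
      case False
      then have "card (classes X (moves X {\<alpha>, \<beta>})) + 1 = card (classes X ?r)"
        using card_classes_insert[OF assms(1) i(1) p(1) False] J by (metis classes_cong)
      moreover have "nc X (\<alpha> \<circ> \<beta>) + 1 = nc X (\<alpha> \<circ> \<beta>0)"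
        unfolding ab using False sub by (intro nc_merge assms ba i p) auto
      ultimately show ?thesis using IH c1 by linarith
    qed
  qed
qed

section \<open>Geodesics in the symmetric group and convolution\<close>

lemma bij_betw_invariant:
  assumes "finite S" "S \<subseteq> X" "bij_betw f X X" "f ` S \<subseteq> S"
  shows "bij_betw f S S"
  using assms by (metis bij_betw_def endo_inj_surj inj_on_subset)

lemma partition_on_perm_cycles:
  assumes "finite X" "bij_betw f X X"
  shows "partition_on X (perm_cycles X f)"
proof (rule partition_onI)
  show "\<Union>(perm_cycles X f) = X"
    using orbit_restrict_id(2)[OF assms(2)] self_in_orbit[OF assms] by (auto simp: perm_cycles_def)
  fix C D assume "C \<in> perm_cycles X f" "D \<in> perm_cycles X f" "C \<noteq> D"
  then obtain x y where "x \<in> X" "y \<in> X" "C = eqcl (moves X {f}) `` {x}" "D = eqcl (moves X {f}) `` {y}"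
    using assms by (auto simp: perm_cycles_eq_classes classes_def)
  then show "disjnt C D"
    using \<open>C \<noteq> D\<close> eqcl_class_eq[of x _ "moves X {f}"] eqcl_class_eq[of y _ "moves X {f}"] by (auto simp: disjnt_def)
next
  show "{} \<notin> perm_cycles X f" using orbit.base by (fastforce simp: perm_cycles_def)
qed

lemma finite_perm_cycles [simp]: "finite X \<Longrightarrow> finite (perm_cycles X f)"
  by (simp add: perm_cycles_def)

lemma perm_cycles_subset:
  "bij_betw f X X \<Longrightarrow> C \<in> perm_cycles X f \<Longrightarrow> C \<subseteq> X"
  using orbit_restrict_id(2) by (fastforce simp: perm_cycles_def)

lemma perm_cycles_nonempty: "C \<in> perm_cycles X f \<Longrightarrow> C \<noteq> {}"
  using orbit.base by (fastforce simp: perm_cycles_def)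

lemma perm_cycles_image:
  assumes "finite X" "bij_betw f X X" "C \<in> perm_cycles X f"
  shows "f ` C = C"
proof -
  have "f ` C \<subseteq> C" using assms(3) by (auto simp: perm_cycles_def intro: orbit.step)
  then have "bij_betw f C C"
    using perm_cycles_subset[OF assms(2,3)] finite_subset[OF _ assms(1)] by (intro bij_betw_invariant[OF _ _ assms(2)])
  then show ?thesis by (simp add: bij_betw_def)
qed

lemma perm_cycles_Un: "perm_cycles (S \<union> T) f = perm_cycles S f \<union> perm_cycles T f"
  by (simp add: perm_cycles_def image_Un)

lemma perm_cycles_disjoint:
  assumes "bij_betw f S S" "bij_betw f T T" "S \<inter> T = {}"
  shows "perm_cycles S f \<inter> perm_cycles T f = {}"
  using perm_cycles_subset[OF assms(1)] perm_cycles_subset[OF assms(2)] assms(3) perm_cycles_nonempty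
  by (metis Int_emptyI Int_greatest subset_empty)

lemma nc_Un:
  assumes "finite S" "finite T" "bij_betw f S S" "bij_betw f T T" "S \<inter> T = {}"
  shows "nc (S \<union> T) f = nc S f + nc T f"
  using assms by (simp add: perm_cycles_Un card_Un_disjoint perm_cycles_disjoint)

text \<open>Sending an \<open>r\<close>-class to the \<open>s\<close>-class that contains it is a
  surjection. If the numbers agree it is injective, so no two \<open>r\<close>-classes have been
  fused.\<close>

lemma card_classes_mono:
  assumes "finite X" "r \<subseteq> eqcl s"
  shows "card (classes X s) \<le> card (classes X r)"
    and "card (classes X s) = card (classes X r) \<Longrightarrow> x \<in> X \<Longrightarrow> y \<in> X \<Longrightarrow> (x, y) \<in> eqcl s \<Longrightarrow> (x, y) \<in> eqcl r"
proof -
  let ?g = "\<lambda>C. eqcl s `` C"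
  have g: "?g (eqcl r `` {x}) = eqcl s `` {x}" for x
  proof
    show "?g (eqcl r `` {x}) \<subseteq> eqcl s `` {x}"
      using subsetD[OF eqcl_least[OF assms(2)]] eqcl_trans[of x _ s] by auto
  qed auto
  then have im: "classes X s = ?g ` classes X r" unfolding classes_def image_image by simp
  have fin: "finite (classes X r)" using assms(1) by (simp add: classes_def)
  show "card (classes X s) \<le> card (classes X r)" unfolding im by (rule card_image_le[OF fin])
  assume "card (classes X s) = card (classes X r)" "x \<in> X" "y \<in> X" "(x, y) \<in> eqcl s"
  then have "inj_on ?g (classes X r)" "?g (eqcl r `` {x}) = ?g (eqcl r `` {y})"
    using im fin eqcl_class_eq[of x y s] by (metis eq_card_imp_inj_on, simp only: g)
  then have "eqcl r `` {x} = eqcl r `` {y}"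
    using \<open>x \<in> X\<close> \<open>y \<in> X\<close> by (auto simp: classes_def dest: inj_onD)
  then show "(x, y) \<in> eqcl r" by (simp add: eqcl_class_eq_iff)
qed

lemma moves_comp:
  assumes "\<beta> ` X \<subseteq> X"
  shows "moves X {\<alpha> \<circ> \<beta>} \<subseteq> eqcl (moves X {\<alpha>, \<beta>})"
proof
  fix z assume "z \<in> moves X {\<alpha> \<circ> \<beta>}"
  then obtain x where x: "x \<in> X" "z = (x, \<alpha> (\<beta> x))" by (auto simp: moves_def)
  then have "\<beta> x \<in> X" using assms by blast
  then have "(x, \<beta> x) \<in> eqcl (moves X {\<alpha>, \<beta>})" "(\<beta> x, \<alpha> (\<beta> x)) \<in> eqcl (moves X {\<alpha>, \<beta>})"
    using x by (auto simp: moves_def intro: eqcl_base)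
  then show "z \<in> eqcl (moves X {\<alpha>, \<beta>})" using x eqcl_trans by metis
qed

text \<open>Every cycle of the product lies in a joint orbit, so the number of joint orbits in the
  genus inequality is at most \<open>nc X (\<alpha> \<circ> \<beta>)\<close>. Equality forces the
  joint orbits to be the cycles of the product, and joint orbits are preserved by
  \<open>\<alpha>\<close>.\<close>

lemma nc_triangle:
  assumes "finite X" "bij_betw \<alpha> X X" "bij_betw \<beta> X X"
  shows "nc X \<alpha> + nc X \<beta> \<le> card X + nc X (\<alpha> \<circ> \<beta>)"
    and "nc X \<alpha> + nc X \<beta> = card X + nc X (\<alpha> \<circ> \<beta>) \<Longrightarrow> C \<in> perm_cycles X (\<alpha> \<circ> \<beta>) \<Longrightarrow> \<alpha> ` C \<subseteq> C"
proof -
  let ?s = "moves X {\<alpha>, \<beta>}" and ?r = "moves X {\<alpha> \<circ> \<beta>}"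
  have bij: "bij_betw (\<alpha> \<circ> \<beta>) X X" using assms by (intro bij_betw_comp)
  have sub: "?r \<subseteq> eqcl ?s" by (rule moves_comp) (use assms(3) in \<open>simp add: bij_betw_def\<close>)
  have c: "nc X (\<alpha> \<circ> \<beta>) = card (classes X ?r)" using assms(1) bij by (simp add: perm_cycles_eq_classes)
  have le: "card (classes X ?s) \<le> card (classes X ?r)" by (rule card_classes_mono[OF assms(1) sub])
  note gen = genus_inequality[OF assms]
  show "nc X \<alpha> + nc X \<beta> \<le> card X + nc X (\<alpha> \<circ> \<beta>)" using gen le c by linarith
  assume eq: "nc X \<alpha> + nc X \<beta> = card X + nc X (\<alpha> \<circ> \<beta>)" and C: "C \<in> perm_cycles X (\<alpha> \<circ> \<beta>)"
  have ceq: "card (classes X ?s) = card (classes X ?r)" using gen le c eq by linarith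
  show "\<alpha> ` C \<subseteq> C"
  proof
    fix y assume "y \<in> \<alpha> ` C"
    then obtain x where x: "x \<in> C" "y = \<alpha> x" by blast
    have CX: "C \<subseteq> X" using perm_cycles_subset[OF bij C] .
    obtain z where z: "C = eqcl ?r `` {z}" using C assms(1) bij by (auto simp: perm_cycles_eq_classes classes_def)
    have xX: "x \<in> X" "\<alpha> x \<in> X" using x CX assms(2) by (auto simp: bij_betw_def)
    then have "(x, \<alpha> x) \<in> eqcl ?s" by (auto simp: moves_def intro: eqcl_base)
    then have "(x, y) \<in> eqcl ?r" using card_classes_mono(2)[OF assms(1) sub ceq] xX x by blast
    then show "y \<in> C" using x z eqcl_trans[of z x ?r y] by auto
  qed
qed

text \<open>With \<open>card X - nc X \<pi>\<close> as the length of \<pi>, the least number of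
  transpositions needed to write it, these are the permutations on a geodesic from the identity to
  \<open>\<sigma>\<close>, i.e. the interval below \<open>\<sigma>\<close> in the absolute order. It
  is the equality case of \<open>nc_inv_triangle\<close>.\<close>

definition geo :: "'x set \<Rightarrow> ('x \<Rightarrow> 'x) \<Rightarrow> ('x \<Rightarrow> 'x) set" where
  "geo X \<sigma> = {\<alpha>. \<alpha> permutes X \<and> nc X \<alpha> + nc X (inv \<alpha> \<circ> \<sigma>) = card X + nc X \<sigma>}"

lemma finite_geo [simp]: "finite X \<Longrightarrow> finite (geo X \<sigma>)"
  by (rule finite_subset[OF _ finite_permutations]) (auto simp: geo_def)

lemma bij_betw_inv_comp: "\<alpha> permutes X \<Longrightarrow> bij_betw \<sigma> X X \<Longrightarrow> bij_betw (inv \<alpha> \<circ> \<sigma>) X X"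
  by (simp add: bij_betw_comp permutes_imp_bij permutes_inv)

lemma comp_inv_comp: "\<alpha> permutes X \<Longrightarrow> \<alpha> \<circ> (inv \<alpha> \<circ> \<sigma>) = \<sigma>"
  by (simp add: comp_assoc[symmetric] permutes_inv_o)

lemma inv_comp_comp: "\<alpha> permutes X \<Longrightarrow> inv \<alpha> \<circ> (\<alpha> \<circ> \<sigma>) = \<sigma>"
  by (simp add: comp_assoc[symmetric] permutes_inv_o)

lemma nc_inv_triangle:
  assumes "finite X" "\<alpha> permutes X" "bij_betw \<sigma> X X"
  shows "nc X \<alpha> + nc X (inv \<alpha> \<circ> \<sigma>) \<le> card X + nc X \<sigma>"
  using nc_triangle(1)[OF assms(1) permutes_imp_bij[OF assms(2)] bij_betw_inv_comp[OF assms(2,3)]]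
  by (simp add: comp_inv_comp[OF assms(2)])

lemma geo_cycle:
  assumes "finite X" "bij_betw \<sigma> X X" "\<alpha> \<in> geo X \<sigma>" "C \<in> perm_cycles X \<sigma>"
  shows "\<alpha> ` C = C"
proof -
  have \<alpha>: "\<alpha> permutes X" using assms by (simp add: geo_def)
  have "\<alpha> ` C \<subseteq> C"
    using nc_triangle(2)[OF assms(1) permutes_imp_bij[OF \<alpha>] bij_betw_inv_comp[OF \<alpha> assms(2)]] assms(3,4)
    by (simp add: comp_inv_comp[OF \<alpha>] geo_def)
  then have "bij_betw \<alpha> C C"
    using assms perm_cycles_subset[OF assms(2,4)] permutes_imp_bij[OF \<alpha>]
    by (intro bij_betw_invariant[of C X]) (auto intro: finite_subset)
  then show ?thesis by (simp add: bij_betw_def)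
qed

text \<open>A set invariant under \<open>\<sigma>\<close> is a union of cycles of
  \<open>\<sigma>\<close>, and each of these is preserved by \<open>\<alpha>\<close>.\<close>

lemma geo_invariant:
  assumes "finite X" "bij_betw \<sigma> X X" "\<alpha> \<in> geo X \<sigma>" "S \<subseteq> X" "bij_betw \<sigma> S S"
  shows "bij_betw \<alpha> S S"
proof -
  have fS: "finite S" using assms finite_subset by blast
  have "S = \<Union>(perm_cycles S \<sigma>)" using partition_on_perm_cycles[OF fS assms(5)] by (simp add: partition_on_def)
  moreover have "perm_cycles S \<sigma> \<subseteq> perm_cycles X \<sigma>" using assms(4) by (auto simp: perm_cycles_def)
  ultimately have "\<alpha> ` S = (\<Union>C\<in>perm_cycles S \<sigma>. \<alpha> ` C)" "\<And>C. C \<in> perm_cycles S \<sigma> \<Longrightarrow> \<alpha> ` C = C"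
    using geo_cycle[OF assms(1-3)] by (metis image_Union, blast)
  then have "\<alpha> ` S \<subseteq> S" using \<open>S = \<Union>(perm_cycles S \<sigma>)\<close> by auto
  then show ?thesis
    using bij_betw_invariant[OF fS assms(4)] assms(3) by (simp add: geo_def permutes_imp_bij)
qed

text \<open>Transitivity of the absolute order. The triangle inequality for
  \<open>inv \<alpha> \<circ> \<sigma>\<close> and \<open>inv \<sigma> \<circ> \<gamma>\<close>
  gives the bound opposite to the general one.\<close>

lemma geo_trans:
  assumes "finite X" "\<sigma> \<in> geo X \<gamma>" "\<alpha> \<in> geo X \<sigma>" "bij_betw \<gamma> X X"
  shows "\<alpha> \<in> geo X \<gamma>"
proof -
  have p: "\<sigma> permutes X" "\<alpha> permutes X" using assms by (auto simp: geo_def)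
  have "inv \<alpha> \<circ> \<sigma> \<circ> (inv \<sigma> \<circ> \<gamma>) = inv \<alpha> \<circ> \<gamma>"
    by (simp add: comp_assoc comp_inv_comp[OF p(1)])
  then have "nc X (inv \<alpha> \<circ> \<sigma>) + nc X (inv \<sigma> \<circ> \<gamma>) \<le> card X + nc X (inv \<alpha> \<circ> \<gamma>)"
    using nc_triangle(1)[OF assms(1) bij_betw_inv_comp[OF p(2) permutes_imp_bij[OF p(1)]] bij_betw_inv_comp[OF p(1) assms(4)]]
    by simp
  then show ?thesis
    using nc_inv_triangle[OF assms(1) p(2) assms(4)] assms p unfolding geo_def by simp
qed

text \<open>Invariance is demanded of \<open>S\<close> alone: a permutation of the union that maps
  \<open>S\<close> onto itself does the same with the complement \<open>T\<close>.\<close>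

lemma bij_betw_permutes_Un:
  assumes "S \<inter> T = {}"
  shows "bij_betw (\<lambda>(a, b). a \<circ> b) ({a. a permutes S} \<times> {b. b permutes T}) {c. c permutes S \<union> T \<and> bij_betw c S S}"
proof (rule bij_betw_byWitness[where f' = "\<lambda>c. (restrict_id c S, restrict_id c T)"])
  show "\<forall>p\<in>{a. a permutes S} \<times> {b. b permutes T}.
      (restrict_id (case p of (a, b) \<Rightarrow> a \<circ> b) S, restrict_id (case p of (a, b) \<Rightarrow> a \<circ> b) T) = p"
    using assms by (auto simp: restrict_id_def fun_eq_iff permutes_not_in disjoint_iff permutes_in_image)
      (metis permutes_not_in permutes_in_image)+
  show "\<forall>c\<in>{c. c permutes S \<union> T \<and> bij_betw c S S}.
      (case (restrict_id c S, restrict_id c T) of (a, b) \<Rightarrow> a \<circ> b) = c"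
  proof
    fix c assume "c \<in> {c. c permutes S \<union> T \<and> bij_betw c S S}"
    then have c: "c permutes S \<union> T" "bij_betw c S S" by auto
    have cT: "c x \<in> T" if "x \<in> T" for x
    proof (rule ccontr)
      assume "c x \<notin> T"
      then have "c x \<in> S" using c that by (metis UnCI UnE permutes_in_image)
      then obtain y where "y \<in> S" "c y = c x" using c(2) by (metis bij_betw_def imageE)
      then have "y = x" using c(1) by (metis permutes_def)
      then show False using that \<open>y \<in> S\<close> assms by blast
    qed
    show "(case (restrict_id c S, restrict_id c T) of (a, b) \<Rightarrow> a \<circ> b) = c"
      using assms cT permutes_not_in[OF c(1)] by (auto simp: restrict_id_def fun_eq_iff)
  qed
  show "(\<lambda>(a, b). a \<circ> b) ` ({a. a permutes S} \<times> {b. b permutes T}) \<subseteq> {c. c permutes S \<union> T \<and> bij_betw c S S}"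
  proof clarsimp
    fix a b assume ab: "a permutes S" "b permutes T"
    have "a \<circ> b permutes S \<union> T"
      using ab by (intro permutes_compose) (auto intro: permutes_subset)
    moreover have "bij_betw (a \<circ> b) S S \<longleftrightarrow> bij_betw a S S"
      using assms permutes_not_in[OF ab(2)] by (intro bij_betw_cong) (auto simp: disjoint_iff)
    ultimately show "a \<circ> b permutes S \<union> T \<and> bij_betw (a \<circ> b) S S"
      using permutes_imp_bij[OF ab(1)] by simp
  qed
  show "(\<lambda>c. (restrict_id c S, restrict_id c T)) ` {c. c permutes S \<union> T \<and> bij_betw c S S}
      \<subseteq> {a. a permutes S} \<times> {b. b permutes T}"
  proof clarsimp
    fix c assume c: "c permutes S \<union> T" "bij_betw c S S"
    have "bij_betw c (S \<union> T - S) (S \<union> T - S)"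
      using c permutes_imp_bij[OF c(1)] by (metis bij_betw_DiffI sup_ge1)
    then have "bij_betw c T T" using assms by (metis Un_Diff_cancel2 Un_commute Diff_triv Int_commute Un_Diff sup_bot.right_neutral Diff_cancel sup_bot_left)
    then show "restrict_id c S permutes S \<and> restrict_id c T permutes T"
      using c(2) permutes_restrict_id by blast
  qed
qed

lemma comp_disjoint_eqs:
  assumes "S \<inter> T = {}" "a permutes S" "b permutes T"
  shows "x \<in> S \<Longrightarrow> (a \<circ> b) x = a x" "x \<in> T \<Longrightarrow> (a \<circ> b) x = b x"
    "x \<in> S \<Longrightarrow> inv (a \<circ> b) x = inv a x" "x \<in> T \<Longrightarrow> inv (a \<circ> b) x = inv b x"
proof -
  have *: "inv (a \<circ> b) = inv b \<circ> inv a"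
    using assms(2,3) by (simp add: o_inv_distrib permutes_bij)
  have "inv a permutes S" "inv b permutes T" using assms by (auto intro: permutes_inv)
  then show "x \<in> S \<Longrightarrow> (a \<circ> b) x = a x" "x \<in> T \<Longrightarrow> (a \<circ> b) x = b x"
    "x \<in> S \<Longrightarrow> inv (a \<circ> b) x = inv a x" "x \<in> T \<Longrightarrow> inv (a \<circ> b) x = inv b x"
    using assms unfolding * by (simp_all add: disjoint_iff) (metis permutes_not_in permutes_in_image)+
qed

lemma perm_cycles_comp_disjoint:
  assumes "S \<inter> T = {}" "a permutes S" "b permutes T" "bij_betw \<sigma> S S" "bij_betw \<sigma> T T"
  shows "perm_cycles S (a \<circ> b) = perm_cycles S a" "perm_cycles T (a \<circ> b) = perm_cycles T b"
    "perm_cycles S (inv (a \<circ> b) \<circ> \<sigma>) = perm_cycles S (inv a \<circ> \<sigma>)"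
    "perm_cycles T (inv (a \<circ> b) \<circ> \<sigma>) = perm_cycles T (inv b \<circ> \<sigma>)"
proof -
  note e = comp_disjoint_eqs[OF assms(1-3)]
  have \<sigma>: "x \<in> S \<Longrightarrow> \<sigma> x \<in> S" "x \<in> T \<Longrightarrow> \<sigma> x \<in> T" for x using assms(4,5) by (auto simp: bij_betw_def)
  show "perm_cycles S (a \<circ> b) = perm_cycles S a" "perm_cycles T (a \<circ> b) = perm_cycles T b"
    using perm_cycles_cong[OF permutes_imp_bij[OF assms(2)], of "a \<circ> b"]
      perm_cycles_cong[OF permutes_imp_bij[OF assms(3)], of "a \<circ> b"] e by simp_all
  show "perm_cycles S (inv (a \<circ> b) \<circ> \<sigma>) = perm_cycles S (inv a \<circ> \<sigma>)"
    "perm_cycles T (inv (a \<circ> b) \<circ> \<sigma>) = perm_cycles T (inv b \<circ> \<sigma>)"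
    using perm_cycles_cong[OF bij_betw_inv_comp[OF assms(2,4)], of "inv (a \<circ> b) \<circ> \<sigma>"]
      perm_cycles_cong[OF bij_betw_inv_comp[OF assms(3,5)], of "inv (a \<circ> b) \<circ> \<sigma>"] e \<sigma> by simp_all
qed

text \<open>Cycle counts add over the two parts, and each part satisfies its own triangle
  inequality, so equality for the union means equality in both. That every geodesic of the union
  splits follows from \<open>geo_invariant\<close>.\<close>

lemma geo_Un:
  assumes "finite S" "finite T" "S \<inter> T = {}" "bij_betw \<sigma> S S" "bij_betw \<sigma> T T"
  shows "bij_betw (\<lambda>(a, b). a \<circ> b) (geo S \<sigma> \<times> geo T \<sigma>) (geo (S \<union> T) \<sigma>)"
proof -
  let ?h = "\<lambda>(a, b). a \<circ> b"
  have \<sigma>: "bij_betw \<sigma> (S \<union> T) (S \<union> T)" using assms by (auto intro: bij_betw_combine)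
  have key: "a \<circ> b \<in> geo (S \<union> T) \<sigma> \<longleftrightarrow> a \<in> geo S \<sigma> \<and> b \<in> geo T \<sigma>"
    if ab: "a permutes S" "b permutes T" for a b
  proof -
    have c: "a \<circ> b permutes S \<union> T" using ab by (intro permutes_compose) (auto intro: permutes_subset)
    have bS: "bij_betw (a \<circ> b) S S \<longleftrightarrow> bij_betw a S S" "bij_betw (a \<circ> b) T T \<longleftrightarrow> bij_betw b T T"
      "bij_betw (inv (a \<circ> b)) S S \<longleftrightarrow> bij_betw (inv a) S S" "bij_betw (inv (a \<circ> b)) T T \<longleftrightarrow> bij_betw (inv b) T T"
      using comp_disjoint_eqs[OF assms(3) ab] by (auto intro!: bij_betw_cong)
    then have b: "bij_betw (a \<circ> b) S S" "bij_betw (a \<circ> b) T T"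
      "bij_betw (inv (a \<circ> b) \<circ> \<sigma>) S S" "bij_betw (inv (a \<circ> b) \<circ> \<sigma>) T T"
      using ab permutes_imp_bij permutes_inv assms by (blast intro: bij_betw_comp)+
    note cy = perm_cycles_comp_disjoint[OF assms(3) ab assms(4,5)]
    have "nc (S \<union> T) (a \<circ> b) = nc S a + nc T b"
      "nc (S \<union> T) (inv (a \<circ> b) \<circ> \<sigma>) = nc S (inv a \<circ> \<sigma>) + nc T (inv b \<circ> \<sigma>)"
      "nc (S \<union> T) \<sigma> = nc S \<sigma> + nc T \<sigma>" "card (S \<union> T) = card S + card T"
      using nc_Un[OF assms(1,2) b(1,2) assms(3)] nc_Un[OF assms(1,2) b(3,4) assms(3)] nc_Un[OF assms(1,2,4,5,3)]
        assms cy by (auto simp: card_Un_disjoint)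
    then show ?thesis
      using nc_inv_triangle[OF assms(1) ab(1) assms(4)] nc_inv_triangle[OF assms(2) ab(2) assms(5)] ab c
      unfolding geo_def by auto
  qed
  note B = bij_betw_permutes_Un[OF assms(3)]
  have "?h ` (geo S \<sigma> \<times> geo T \<sigma>) = geo (S \<union> T) \<sigma>"
  proof (intro equalityI subsetI)
    fix c assume "c \<in> ?h ` (geo S \<sigma> \<times> geo T \<sigma>)"
    then show "c \<in> geo (S \<union> T) \<sigma>" using key by (auto simp: geo_def)
  next
    fix c assume c: "c \<in> geo (S \<union> T) \<sigma>"
    then have "c permutes S \<union> T" "bij_betw c S S"
      using geo_invariant[OF _ \<sigma> c _ assms(4)] assms by (auto simp: geo_def)
    then have "c \<in> ?h ` ({a. a permutes S} \<times> {b. b permutes T})" using B by (auto simp: bij_betw_def)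
    then obtain a b where ab: "a permutes S" "b permutes T" "c = a \<circ> b" by auto
    then show "c \<in> ?h ` (geo S \<sigma> \<times> geo T \<sigma>)" using key c by (intro image_eqI[of _ _ "(a, b)"]) auto
  qed
  moreover have "inj_on ?h (geo S \<sigma> \<times> geo T \<sigma>)"
    using B unfolding bij_betw_def by (rule inj_on_subset[OF conjunct1]) (auto simp: geo_def)
  ultimately show ?thesis by (simp add: bij_betw_def)
qed

definition wt :: "(nat \<Rightarrow> complex) \<Rightarrow> 'x set set \<Rightarrow> complex" where
  "wt f P = (\<Prod>V\<in>P. f (card V))"

text \<open>The boxed convolution of the multiplicative functions of \<open>f\<close> and
  \<open>g\<close>, evaluated at \<open>\<sigma>\<close>;
  \<open>inv \<alpha> \<circ> \<sigma>\<close> is the Kreweras complement of \<open>\<alpha>\<close>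
  relative to \<open>\<sigma>\<close>.\<close>

definition conv :: "(nat \<Rightarrow> complex) \<Rightarrow> (nat \<Rightarrow> complex) \<Rightarrow> 'x set \<Rightarrow> ('x \<Rightarrow> 'x) \<Rightarrow> complex" where
  "conv f g X \<sigma> = (\<Sum>\<alpha>\<in>geo X \<sigma>. wt f (perm_cycles X \<alpha>) * wt g (perm_cycles X (inv \<alpha> \<circ> \<sigma>)))"

lemma sum_geo_Un:
  assumes "finite S" "finite T" "S \<inter> T = {}" "bij_betw \<sigma> S S" "bij_betw \<sigma> T T"
  shows "(\<Sum>\<alpha>\<in>geo (S \<union> T) \<sigma>. F \<alpha>) = (\<Sum>a\<in>geo S \<sigma>. \<Sum>b\<in>geo T \<sigma>. F (a \<circ> b))"
proof -
  have "(\<Sum>\<alpha>\<in>geo (S \<union> T) \<sigma>. F \<alpha>) = (\<Sum>p\<in>geo S \<sigma> \<times> geo T \<sigma>. F (case p of (a, b) \<Rightarrow> a \<circ> b))"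
    by (rule sum.reindex_bij_betw[OF geo_Un[OF assms], symmetric])
  then show ?thesis by (simp add: sum.cartesian_product split_def)
qed

lemma wt_comp_disjoint:
  assumes "finite S" "finite T" "S \<inter> T = {}" "bij_betw \<sigma> S S" "bij_betw \<sigma> T T" "a permutes S" "b permutes T"
  shows "wt f (perm_cycles (S \<union> T) (a \<circ> b)) = wt f (perm_cycles S a) * wt f (perm_cycles T b)"
    "wt f (perm_cycles (S \<union> T) (inv (a \<circ> b) \<circ> \<sigma>)) =
       wt f (perm_cycles S (inv a \<circ> \<sigma>)) * wt f (perm_cycles T (inv b \<circ> \<sigma>))"
proof -
  note cy = perm_cycles_comp_disjoint[OF assms(3,6,7,4,5)]
  have "perm_cycles S a \<inter> perm_cycles T b = {}"
    "perm_cycles S (inv a \<circ> \<sigma>) \<inter> perm_cycles T (inv b \<circ> \<sigma>) = {}"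
    using perm_cycles_subset[OF permutes_imp_bij[OF assms(6)]] perm_cycles_subset[OF permutes_imp_bij[OF assms(7)]]
      perm_cycles_subset[OF bij_betw_inv_comp[OF assms(6,4)]] perm_cycles_subset[OF bij_betw_inv_comp[OF assms(7,5)]]
      perm_cycles_nonempty assms(3) by (metis Int_emptyI Int_greatest subset_empty)+
  then show "wt f (perm_cycles (S \<union> T) (a \<circ> b)) = wt f (perm_cycles S a) * wt f (perm_cycles T b)"
    "wt f (perm_cycles (S \<union> T) (inv (a \<circ> b) \<circ> \<sigma>)) =
       wt f (perm_cycles S (inv a \<circ> \<sigma>)) * wt f (perm_cycles T (inv b \<circ> \<sigma>))"
    using assms(1,2) by (simp_all add: wt_def perm_cycles_Un cy prod.union_disjoint)
qed

lemma conv_Un: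
  assumes "finite S" "finite T" "S \<inter> T = {}" "bij_betw \<sigma> S S" "bij_betw \<sigma> T T"
  shows "conv f g (S \<union> T) \<sigma> = conv f g S \<sigma> * conv f g T \<sigma>"
proof -
  have "conv f g (S \<union> T) \<sigma> = (\<Sum>a\<in>geo S \<sigma>. \<Sum>b\<in>geo T \<sigma>.
      wt f (perm_cycles (S \<union> T) (a \<circ> b)) * wt g (perm_cycles (S \<union> T) (inv (a \<circ> b) \<circ> \<sigma>)))"
    unfolding conv_def by (rule sum_geo_Un[OF assms])
  also have "\<dots> = (\<Sum>a\<in>geo S \<sigma>. \<Sum>b\<in>geo T \<sigma>.
      (wt f (perm_cycles S a) * wt g (perm_cycles S (inv a \<circ> \<sigma>))) * (wt f (perm_cycles T b) * wt g (perm_cycles T (inv b \<circ> \<sigma>))))"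
    by (intro sum.cong refl) (simp add: wt_comp_disjoint[OF assms] geo_def mult_ac)
  also have "\<dots> = conv f g S \<sigma> * conv f g T \<sigma>"
    unfolding conv_def by (simp add: sum_product)
  finally show ?thesis .
qed

section \<open>Invariance of geodesics and convolution under relabelling\<close>

lemma orbit_image:
  assumes "\<And>x. x \<in> X \<Longrightarrow> g (h x) = h (f x)" "f ` X \<subseteq> X" "x \<in> X"
  shows "orbit g (h x) = h ` orbit f x"
proof -
  have fX: "y \<in> X" if "y \<in> orbit f x" for y
    using that by induction (use assms in auto)
  show ?thesis
  proof (intro equalityI subsetI)
    fix y assume "y \<in> orbit g (h x)"
    then show "y \<in> h ` orbit f x"
    proof induction
      case base show ?case unfolding assms(1)[OF assms(3)] by (rule imageI) (rule orbit.base)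
    next
      case (step y) then show ?case using assms(1) fX orbit.step by fastforce
    qed
  next
    fix y assume "y \<in> h ` orbit f x"
    then obtain z where "z \<in> orbit f x" "y = h z" by blast
    then show "y \<in> orbit g (h x)"
    proof (induction arbitrary: y)
      case base then show ?case using assms(1)[OF assms(3)] orbit.base[of g "h x"] by simp
    next
      case (step z) then show ?case using assms(1)[OF fX[OF step(1)]] orbit.step[of "h z" g "h x"] by simp
    qed
  qed
qed

lemma perm_cycles_relabel:
  assumes "\<And>x. x \<in> X \<Longrightarrow> g (h x) = h (f x)" "f ` X \<subseteq> X"
  shows "perm_cycles (h ` X) g = (`) h ` perm_cycles X f"
  unfolding perm_cycles_def image_image using orbit_image[of X g h f, OF assms] by (intro image_cong) auto

lemma inj_on_image_cycles:
  assumes "inj_on h X" "bij_betw f X X"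
  shows "inj_on ((`) h) (perm_cycles X f)"
  using perm_cycles_subset[OF assms(2)] inj_on_image_eq_iff[OF assms(1)] by (intro inj_onI) metis

lemma wt_relabel:
  assumes "inj_on h X" "bij_betw f X X" "\<And>x. x \<in> X \<Longrightarrow> g (h x) = h (f x)"
  shows "wt k (perm_cycles (h ` X) g) = wt k (perm_cycles X f)" "nc (h ` X) g = nc X f"
proof -
  have e: "perm_cycles (h ` X) g = (`) h ` perm_cycles X f"
    using assms by (intro perm_cycles_relabel) (auto simp: bij_betw_def)
  show "nc (h ` X) g = nc X f" unfolding e by (rule card_image[OF inj_on_image_cycles[OF assms(1,2)]])
  have "card (h ` C) = card C" if "C \<in> perm_cycles X f" for C
    using that perm_cycles_subset[OF assms(2)] assms(1) by (meson card_image inj_on_subset)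
  then show "wt k (perm_cycles (h ` X) g) = wt k (perm_cycles X f)"
    unfolding wt_def e by (simp add: prod.reindex[OF inj_on_image_cycles[OF assms(1,2)]])
qed

lemma map_permutation_inv:
  assumes "inj_on h X" "\<alpha> permutes X" "x \<in> X"
  shows "inv (map_permutation X h \<alpha>) (h x) = h (inv \<alpha> x)"
proof -
  have "map_permutation X h \<alpha> permutes h ` X"
    using assms by (intro map_permutation_permutes) (auto simp: bij_betw_def)
  moreover have "inv \<alpha> x \<in> X" using assms by (simp add: permutes_in_image permutes_inv)
  ultimately show ?thesis
    using assms by (simp add: permutes_inv_eq map_permutation_apply permutes_inverses)
qed

lemma bij_betw_map_permutation:
  assumes "inj_on h X"
  shows "bij_betw (map_permutation X h) {\<alpha>. \<alpha> permutes X} {\<beta>. \<beta> permutes h ` X}"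
proof (rule bij_betw_byWitness[where f' = "map_permutation (h ` X) (inv_into X h)"])
  have h: "bij_betw h X (h ` X)" using assms by (simp add: bij_betw_def)
  have h': "bij_betw (inv_into X h) (h ` X) X" by (rule bij_betw_inv_into[OF h])
  show "\<forall>\<alpha>\<in>{\<alpha>. \<alpha> permutes X}. map_permutation (h ` X) (inv_into X h) (map_permutation X h \<alpha>) = \<alpha>"
    using h assms by (auto intro!: map_permutation_compose_inv)
  show "\<forall>\<beta>\<in>{\<beta>. \<beta> permutes h ` X}. map_permutation X h (map_permutation (h ` X) (inv_into X h) \<beta>) = \<beta>"
    using map_permutation_compose_inv[OF h', of _ h] by (simp add: f_inv_into_f)
  show "map_permutation X h ` {\<alpha>. \<alpha> permutes X} \<subseteq> {\<beta>. \<beta> permutes h ` X}"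
    using map_permutation_permutes[OF h] by auto
  show "map_permutation (h ` X) (inv_into X h) ` {\<beta>. \<beta> permutes h ` X} \<subseteq> {\<alpha>. \<alpha> permutes X}"
    using map_permutation_permutes[OF h'] by auto
qed

lemma inv_comp_relabel:
  assumes "inj_on h X" "bij_betw \<sigma> X X" "\<And>x. x \<in> X \<Longrightarrow> \<tau> (h x) = h (\<sigma> x)" "\<alpha> permutes X" "x \<in> X"
  shows "(inv (map_permutation X h \<alpha>) \<circ> \<tau>) (h x) = h ((inv \<alpha> \<circ> \<sigma>) x)"
proof -
  have "\<sigma> x \<in> X" using assms by (auto simp: bij_betw_def)
  then show ?thesis using assms by (simp add: map_permutation_inv)
qed

lemma geo_relabel:
  assumes "inj_on h X" "bij_betw \<sigma> X X" "\<And>x. x \<in> X \<Longrightarrow> \<tau> (h x) = h (\<sigma> x)"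
  shows "bij_betw (map_permutation X h) (geo X \<sigma>) (geo (h ` X) \<tau>)"
proof -
  note B = bij_betw_map_permutation[OF assms(1)]
  have key: "map_permutation X h \<alpha> \<in> geo (h ` X) \<tau> \<longleftrightarrow> \<alpha> \<in> geo X \<sigma>" if \<alpha>: "\<alpha> permutes X" for \<alpha>
  proof -
    have "map_permutation X h \<alpha> permutes h ` X" using B \<alpha> by (auto simp: bij_betw_def)
    moreover have "nc (h ` X) (map_permutation X h \<alpha>) = nc X \<alpha>"
      using assms \<alpha> by (intro wt_relabel) (auto simp: permutes_imp_bij map_permutation_apply)
    moreover have "nc (h ` X) (inv (map_permutation X h \<alpha>) \<circ> \<tau>) = nc X (inv \<alpha> \<circ> \<sigma>)"
      by (intro wt_relabel bij_betw_inv_comp \<alpha> assms inv_comp_relabel)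
    moreover have "nc (h ` X) \<tau> = nc X \<sigma>" using assms by (intro wt_relabel)
    moreover have "card (h ` X) = card X" using assms(1) by (rule card_image)
    ultimately show ?thesis using \<alpha> by (simp add: geo_def)
  qed
  show ?thesis
  proof (rule bij_betw_imageI)
    show "inj_on (map_permutation X h) (geo X \<sigma>)"
      using B unfolding bij_betw_def by (rule inj_on_subset[OF conjunct1]) (auto simp: geo_def)
    show "map_permutation X h ` geo X \<sigma> = geo (h ` X) \<tau>"
    proof (intro equalityI subsetI)
      fix \<beta> assume \<beta>: "\<beta> \<in> geo (h ` X) \<tau>"
      then obtain \<alpha> where "\<alpha> permutes X" "\<beta> = map_permutation X h \<alpha>" using B by (auto simp: bij_betw_def geo_def)
      then show "\<beta> \<in> map_permutation X h ` geo X \<sigma>" using key \<beta> by blast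
    qed (use key in \<open>auto simp: geo_def\<close>)
  qed
qed

lemma conv_relabel:
  assumes "inj_on h X" "bij_betw \<sigma> X X" "\<And>x. x \<in> X \<Longrightarrow> \<tau> (h x) = h (\<sigma> x)"
  shows "conv f g (h ` X) \<tau> = conv f g X \<sigma>"
proof -
  have "conv f g (h ` X) \<tau> = (\<Sum>\<alpha>\<in>geo X \<sigma>. wt f (perm_cycles (h ` X) (map_permutation X h \<alpha>))
      * wt g (perm_cycles (h ` X) (inv (map_permutation X h \<alpha>) \<circ> \<tau>)))"
    unfolding conv_def by (rule sum.reindex_bij_betw[OF geo_relabel[OF assms], symmetric])
  also have "\<dots> = conv f g X \<sigma>"
    unfolding conv_def
  proof (intro sum.cong refl)
    fix \<alpha> assume "\<alpha> \<in> geo X \<sigma>"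
    then have \<alpha>: "\<alpha> permutes X" by (simp add: geo_def)
    have "wt f (perm_cycles (h ` X) (map_permutation X h \<alpha>)) = wt f (perm_cycles X \<alpha>)"
      using assms \<alpha> by (intro wt_relabel) (auto simp: permutes_imp_bij map_permutation_apply)
    moreover have "wt g (perm_cycles (h ` X) (inv (map_permutation X h \<alpha>) \<circ> \<tau>)) = wt g (perm_cycles X (inv \<alpha> \<circ> \<sigma>))"
      by (intro wt_relabel bij_betw_inv_comp \<alpha> assms inv_comp_relabel)
    ultimately show "wt f (perm_cycles (h ` X) (map_permutation X h \<alpha>))
      * wt g (perm_cycles (h ` X) (inv (map_permutation X h \<alpha>) \<circ> \<tau>)) =
      wt f (perm_cycles X \<alpha>) * wt g (perm_cycles X (inv \<alpha> \<circ> \<sigma>))" by simp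
  qed
  finally show ?thesis .
qed

section \<open>The long cycle on a set of numbers\<close>

lemma gamma_permutes: "finite A \<Longrightarrow> gamma A permutes A"
  unfolding gamma_def using cycle_permutes[of "sorted_list_of_set A"] by simp

lemma gamma_notin: "finite A \<Longrightarrow> x \<notin> A \<Longrightarrow> gamma A x = x"
  using gamma_permutes permutes_not_in by metis

lemma gamma_nth:
  fixes A :: "nat set"
  assumes "finite A" "i < card A"
  shows "gamma A (sorted_list_of_set A ! i) = sorted_list_of_set A ! (Suc i mod card A)"
proof -
  let ?l = "sorted_list_of_set A"
  have "map (cycle_of_list ?l ^^ 1) ?l = rotate 1 ?l" by (rule cyclic_rotation) simp
  then have "map (cycle_of_list ?l) ?l ! i = rotate1 ?l ! i" by simp
  then show ?thesis using assms by (simp add: gamma_def nth_rotate1)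
qed

lemma gamma_next:
  fixes A :: "nat set"
  assumes "finite A" "x \<in> A" "y \<in> A" "x < y" "\<And>z. z \<in> A \<Longrightarrow> x < z \<Longrightarrow> y \<le> z"
  shows "gamma A x = y"
proof -
  let ?l = "sorted_list_of_set A"
  have l: "set ?l = A" "length ?l = card A" "sorted_wrt (<) ?l" using assms(1) by auto
  obtain i j where ij: "i < card A" "j < card A" "?l ! i = x" "?l ! j = y"
    using assms(2,3) l by (metis in_set_conv_nth)
  have "i < j" using l(3) ij assms(4) by (metis l(2) not_less_iff_gr_or_eq sorted_wrt_nth_less order_less_asym)
  then have "Suc i < card A" using ij by simp
  moreover have "x < ?l ! Suc i" using l ij calculation by (metis lessI sorted_wrt_nth_less)
  moreover have "?l ! Suc i \<in> A" using calculation l by (metis nth_mem)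
  ultimately have "y \<le> ?l ! Suc i" using assms(5) by blast
  then have "j = Suc i" using \<open>i < j\<close> ij l by (metis Suc_lessI leD sorted_wrt_nth_less)
  then show ?thesis using gamma_nth[OF assms(1) ij(1)] ij by simp
qed

lemma gamma_last:
  fixes A :: "nat set"
  assumes "finite A" "x \<in> A" "\<And>z. z \<in> A \<Longrightarrow> z \<le> x"
  shows "gamma A x = Min A"
proof -
  let ?l = "sorted_list_of_set A"
  have l: "set ?l = A" "length ?l = card A" "sorted_wrt (<) ?l" using assms(1) by auto
  obtain i where i: "i < card A" "?l ! i = x" using assms(2) l by (metis in_set_conv_nth)
  have "\<not> Suc i < card A"
  proof
    assume "Suc i < card A"
    then have "x < ?l ! Suc i" "?l ! Suc i \<in> A" using l i by (metis lessI sorted_wrt_nth_less, metis nth_mem)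
    then show False using assms(3) leD by blast
  qed
  then have "Suc i = card A" using i by simp
  moreover have "?l ! 0 = Min A"
  proof -
    have "?l ! 0 \<in> A" using l i by (metis calculation nth_mem zero_less_Suc)
    moreover have "?l ! 0 \<le> z" if z: "z \<in> A" for z
    proof -
      obtain k where k: "k < card A" "?l ! k = z" using z l by (metis in_set_conv_nth)
      then show ?thesis using l by (cases "k = 0") (auto simp: less_imp_le sorted_wrt_nth_less)
    qed
    ultimately show ?thesis using assms(1) by (metis Min_eqI)
  qed
  ultimately show ?thesis using gamma_nth[OF assms(1) i(1)] i by simp
qed

lemma gamma_atLeastAtMost:
  assumes "i \<in> {p+1..p+n}"
  shows "gamma {p+1..p+n} i = (if i = p + n then p + 1 else i + 1)"
proof (cases "i = p + n")
  case True
  then have "gamma {p+1..p+n} i = Min {p+1..p+n}" using assms by (intro gamma_last) auto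
  also have "\<dots> = p + 1" using assms by (intro Min_eqI) auto
  finally show ?thesis using True by simp
next
  case False
  then have "gamma {p+1..p+n} i = i + 1" using assms by (intro gamma_next) auto
  then show ?thesis using False by simp
qed

lemma perm_cycles_gamma:
  fixes A :: "nat set"
  assumes "finite A" "A \<noteq> {}"
  shows "perm_cycles A (gamma A) = {A}"
proof -
  let ?g = "gamma A"
  have b: "bij_betw ?g A A" using gamma_permutes[OF assms(1)] by (rule permutes_imp_bij)
  have m: "Min A \<in> A" using assms by simp
  have "y \<in> orbit ?g (Min A)" if "y \<in> A" for y
    using that
  proof (induction y rule: less_induct)
    case (less y)
    show ?case
    proof (cases "y = Min A")
      case True then show ?thesis using self_in_orbit[OF assms(1) b m] by simp
    next
      case False
      then have "Min A \<in> {z\<in>A. z < y}" using less.prems m assms by (simp add: less_le)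
      then have ne: "{z\<in>A. z < y} \<noteq> {}" by blast
      \<comment> \<open>The predecessor of \<open>y\<close> in \<open>A\<close>;
        \<open>gamma A\<close> sends it to \<open>y\<close>, so that every point is reached from the
        minimum.\<close>
      define z where "z = Max {z\<in>A. z < y}"
      have z: "z \<in> A" "z < y" using Max_in[OF _ ne] assms(1) unfolding z_def by auto
      have "?g z = y"
      proof (rule gamma_next[OF assms(1) z(1) less.prems z(2)])
        fix w assume w: "w \<in> A" "z < w"
        show "y \<le> w"
        proof (rule ccontr)
          assume "\<not> y \<le> w"
          then have "w \<le> z" unfolding z_def using w assms(1) by (intro Max_ge) auto
          then show False using w by simp
        qed
      qed
      then show ?thesis using orbit.step[OF less.IH[OF z(2,1)]] by simp
    qed
  qed
  then have A: "orbit ?g (Min A) = A" using orbit_restrict_id(2)[OF b m] by blast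
  then have "A \<in> perm_cycles A ?g" using m by (auto simp: perm_cycles_def)
  moreover have "C = A" if "C \<in> perm_cycles A ?g" for C
  proof -
    have "C \<inter> A \<noteq> {}" using perm_cycles_nonempty[OF that] perm_cycles_subset[OF b that] by blast
    then show ?thesis
      using that calculation partition_on_perm_cycles[OF assms(1) b] by (metis partition_onD2 disjointD)
  qed
  ultimately show ?thesis by blast
qed

text \<open>A permutation with a single cycle is conjugate to the long cycle: its points are
  numbered by the powers of \<open>\<sigma>\<close> applied to \<open>x\<close>. The offset
  \<open>p\<close> serves the second circle, whose positions start at \<open>p + 1\<close>.\<close>

lemma cyclic_relabel:
  assumes "finite X" "bij_betw \<sigma> X X" "x \<in> X" "orbit \<sigma> x = X" "card X = n"
  shows "\<exists>h. bij_betw h {p+1..p+n} X \<and> (\<forall>i\<in>{p+1..p+n}. \<sigma> (h i) = h (gamma {p+1..p+n} i))"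
proof -
  let ?d = "funpow_dist1 \<sigma> x x"
  have xo: "x \<in> orbit \<sigma> x" using assms by simp
  have X: "X = (\<lambda>k. (\<sigma> ^^ k) x) ` {0..<?d}"
    using orbit_conv_funpow_dist1[OF xo] assms(4) by simp
  have inj: "inj_on (\<lambda>k. (\<sigma> ^^ k) x) {0..<?d}" by (rule inj_on_funpow_dist1[OF xo])
  have d: "?d = n" using assms(5) card_image[OF inj] X by simp
  have per: "(\<sigma> ^^ n) x = x" using funpow_dist1_prop[OF xo] d by simp
  define h where "h i = (\<sigma> ^^ (i - (p + 1))) x" for i
  have sh: "bij_betw (\<lambda>i. i - (p + 1)) {p+1..p+n} {0..<n}"
    by (rule bij_betw_byWitness[where f' = "\<lambda>i. i + (p + 1)"]) auto
  have "bij_betw (\<lambda>k. (\<sigma> ^^ k) x) {0..<n} X" using inj X d by (simp add: bij_betw_def)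
  from bij_betw_trans[OF sh this] have "bij_betw h {p+1..p+n} X" by (simp add: comp_def h_def[abs_def])
  moreover have "\<sigma> (h i) = h (gamma {p+1..p+n} i)" if i: "i \<in> {p+1..p+n}" for i
  proof -
    have "\<sigma> (h i) = (\<sigma> ^^ (i - p)) x" using i by (simp add: h_def Suc_diff_le Suc_diff_Suc flip: funpow.simps(2)[THEN fun_cong, unfolded comp_def])
    then show ?thesis using i per unfolding gamma_atLeastAtMost[OF i] by (auto simp: h_def)
  qed
  ultimately show ?thesis by blast
qed

text \<open>The candidate for the free cumulant of order \<open>n\<close> of a product: the sum over
  NC(n) of \<open>f\<close> on the blocks and \<open>g\<close> on the blocks of the Kreweras
  complement, written with geodesics below the long cycle.\<close>

definition prod_kappa :: "(nat \<Rightarrow> complex) \<Rightarrow> (nat \<Rightarrow> complex) \<Rightarrow> nat \<Rightarrow> complex" where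
  "prod_kappa f g n = conv f g {1..n} (gamma {1..n})"

lemma conv_cyclic:
  assumes "finite X" "bij_betw \<sigma> X X" "X \<in> perm_cycles X \<sigma>"
  shows "conv f g X \<sigma> = prod_kappa f g (card X)"
proof -
  obtain x where x: "x \<in> X" "orbit \<sigma> x = X" using assms(3) by (auto simp: perm_cycles_def)
  obtain h where h: "bij_betw h {0+1..0+card X} X" "\<forall>i\<in>{0+1..0+card X}. \<sigma> (h i) = h (gamma {0+1..0+card X} i)"
    using cyclic_relabel[OF assms(1,2) x refl, of 0] by blast
  have "bij_betw (gamma {1..card X}) {1..card X} {1..card X}" by (simp add: gamma_permutes permutes_imp_bij)
  then have "conv f g (h ` {1..card X}) \<sigma> = prod_kappa f g (card X)"
    unfolding prod_kappa_def using h by (intro conv_relabel) (auto simp: bij_betw_def)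
  then show ?thesis using h by (simp add: bij_betw_def)
qed

lemma perm_cycles_Diff:
  assumes "finite X" "bij_betw \<sigma> X X" "S \<subseteq> X" "bij_betw \<sigma> S S"
  shows "bij_betw \<sigma> (X - S) (X - S)" "perm_cycles (X - S) \<sigma> = perm_cycles X \<sigma> - perm_cycles S \<sigma>"
proof -
  show b: "bij_betw \<sigma> (X - S) (X - S)" by (rule bij_betw_DiffI[OF assms(2,4,3)]) (use assms in simp)
  have "perm_cycles X \<sigma> = perm_cycles S \<sigma> \<union> perm_cycles (X - S) \<sigma>"
    using assms(3) perm_cycles_Un[of S "X - S" \<sigma>] by (simp add: Un_absorb1)
  then show "perm_cycles (X - S) \<sigma> = perm_cycles X \<sigma> - perm_cycles S \<sigma>"
    using perm_cycles_disjoint[OF assms(4) b] by blast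
qed

lemma cycle_perm_cycles:
  assumes "finite X" "bij_betw \<sigma> X X" "C \<in> perm_cycles X \<sigma>"
  shows "bij_betw \<sigma> C C" "perm_cycles C \<sigma> = {C}"
proof -
  have CX: "C \<subseteq> X" using perm_cycles_subset[OF assms(2,3)] .
  show "bij_betw \<sigma> C C"
    using perm_cycles_image[OF assms] bij_betw_invariant[OF _ CX assms(2)] assms(1) CX finite_subset by blast
  have *: "orbit \<sigma> x = C" if "x \<in> C" for x
  proof -
    have "orbit \<sigma> x \<in> perm_cycles X \<sigma>" "x \<in> orbit \<sigma> x"
      using that CX self_in_orbit[OF assms(1,2)] by (auto simp: perm_cycles_def)
    then show ?thesis
      using assms(3) that partition_on_perm_cycles[OF assms(1,2)] by (metis IntI empty_iff partition_onD2 disjointD)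
  qed
  then show "perm_cycles C \<sigma> = {C}"
    using perm_cycles_nonempty[OF assms(3)] by (auto simp: perm_cycles_def)
qed

text \<open>Convolution is multiplicative over invariant sets, so one cycle of
  \<open>\<sigma>\<close> is split off at a time, and on a single cycle only the length matters.
  This turns the inner sum over \<open>\<alpha>\<close> into cumulants of the product.\<close>

lemma conv_eq_wt:
  assumes "finite X" "bij_betw \<sigma> X X"
  shows "conv f g X \<sigma> = wt (prod_kappa f g) (perm_cycles X \<sigma>)"
  using assms
proof (induction "card X" arbitrary: X rule: less_induct)
  case (less X)
  show ?case
  proof (cases "X = {}")
    case True
    have "geo {} \<sigma> = {id}" by (auto simp: geo_def perm_cycles_def)
    then show ?thesis using True by (simp add: conv_def wt_def perm_cycles_def)
  next
    case False
    then obtain C where C: "C \<in> perm_cycles X \<sigma>" by (auto simp: perm_cycles_def)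
    note CX = perm_cycles_subset[OF less.prems(2) C]
    have fC: "finite C" using CX less.prems(1) finite_subset by blast
    note cc = cycle_perm_cycles[OF less.prems C]
    note D = perm_cycles_Diff[OF less.prems CX cc(1)]
    have "card (X - C) < card X"
      using perm_cycles_nonempty[OF C] CX less.prems(1) by (intro psubset_card_mono) auto
    then have IH: "conv f g (X - C) \<sigma> = wt (prod_kappa f g) (perm_cycles (X - C) \<sigma>)"
      using less.hyps D(1) less.prems(1) by blast
    have "conv f g X \<sigma> = conv f g C \<sigma> * conv f g (X - C) \<sigma>"
      using conv_Un[OF fC _ _ cc(1) D(1), of f g] less.prems(1) CX by (simp add: Un_absorb1)
    also have "conv f g C \<sigma> = prod_kappa f g (card C)" using cc by (intro conv_cyclic fC) auto
    finally show ?thesis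
      using C IH less.prems(1) unfolding D(2) cc(2) wt_def by (simp add: prod.remove[of _ C])
  qed
qed

text \<open>A pair \<open>(\<alpha>, \<beta>)\<close> stands for the factorization \<open>\<gamma> = \<alpha>\<beta>\<delta>\<close>.\<close>

definition tri :: "'x set \<Rightarrow> ('x \<Rightarrow> 'x) \<Rightarrow> (('x \<Rightarrow> 'x) \<times> ('x \<Rightarrow> 'x)) set" where
  "tri X \<gamma> = {(\<alpha>, \<beta>). \<alpha> permutes X \<and> \<beta> permutes X \<and>
     nc X \<alpha> + nc X \<beta> + nc X (inv \<beta> \<circ> inv \<alpha> \<circ> \<gamma>) = 2 * card X + nc X \<gamma>}"

lemma inv_comp_permutes: "\<alpha> permutes X \<Longrightarrow> \<beta> permutes X \<Longrightarrow> inv (\<alpha> \<circ> \<beta>) = inv \<beta> \<circ> inv \<alpha>"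
  by (simp add: o_inv_distrib permutes_bij)

text \<open>The equation in \<open>tri\<close> is the sum of the equations that place
  \<open>\<alpha> \<circ> \<beta>\<close> below \<open>\<gamma>\<close> and \<open>\<alpha>\<close>
  below \<open>\<alpha> \<circ> \<beta>\<close>. Each holds in general as an inequality, so the sum
  is attained only if both are.\<close>

lemma tri_iff:
  assumes "finite X" "bij_betw \<gamma> X X" "\<alpha> permutes X" "\<beta> permutes X"
  shows "(\<alpha>, \<beta>) \<in> tri X \<gamma> \<longleftrightarrow> \<alpha> \<circ> \<beta> \<in> geo X \<gamma> \<and> \<alpha> \<in> geo X (\<alpha> \<circ> \<beta>)"
proof -
  have p: "\<alpha> \<circ> \<beta> permutes X" using assms permutes_compose by blast
  have "nc X (\<alpha> \<circ> \<beta>) + nc X (inv \<beta> \<circ> inv \<alpha> \<circ> \<gamma>) \<le> card X + nc X \<gamma>"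
    using nc_inv_triangle[OF assms(1) p assms(2)] by (simp add: inv_comp_permutes[OF assms(3,4)])
  moreover have "nc X \<alpha> + nc X \<beta> \<le> card X + nc X (\<alpha> \<circ> \<beta>)"
    using nc_triangle(1)[OF assms(1)] assms(3,4) permutes_imp_bij by blast
  ultimately show ?thesis
    using p assms(3,4) by (auto simp: tri_def geo_def inv_comp_permutes[OF assms(3,4)] inv_comp_comp[OF assms(3)])
qed

text \<open>The change of variables from \<open>(\<alpha>, \<beta>)\<close> to
  \<open>(\<alpha> \<circ> \<beta>, \<alpha>)\<close>. The sets \<open>S\<close> and
  \<open>M \<sigma>\<close> are left open because the planar case and both annular cases use
  it.\<close>

lemma sum_factorizations:
  assumes "finite X"
    and Q: "\<And>\<alpha> \<beta>. \<alpha> permutes X \<Longrightarrow> \<beta> permutes X \<Longrightarrow> Q (\<alpha>, \<beta>) \<longleftrightarrow> \<alpha> \<circ> \<beta> \<in> S \<and> \<alpha> \<in> M (\<alpha> \<circ> \<beta>)"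
    and S: "S \<subseteq> {\<sigma>. \<sigma> permutes X}" "\<And>\<sigma>. M \<sigma> \<subseteq> {\<alpha>. \<alpha> permutes X}"
  shows "(\<Sum>(\<alpha>, \<beta>)\<in>{p. fst p permutes X \<and> snd p permutes X \<and> Q p}. F \<alpha> \<beta>) =
    (\<Sum>\<sigma>\<in>S. \<Sum>\<alpha>\<in>M \<sigma>. F \<alpha> (inv \<alpha> \<circ> \<sigma>))"
proof -
  have finS: "finite S" "\<And>\<sigma>. finite (M \<sigma>)"
    using S finite_permutations[OF assms(1)] finite_subset by blast+
  have "(\<Sum>\<sigma>\<in>S. \<Sum>\<alpha>\<in>M \<sigma>. F \<alpha> (inv \<alpha> \<circ> \<sigma>)) = (\<Sum>(\<sigma>, \<alpha>)\<in>(SIGMA \<sigma>:S. M \<sigma>). F \<alpha> (inv \<alpha> \<circ> \<sigma>))"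
    using finS by (intro sum.Sigma) auto
  also have "\<dots> = (\<Sum>(\<alpha>, \<beta>)\<in>{p. fst p permutes X \<and> snd p permutes X \<and> Q p}. F \<alpha> \<beta>)"
  proof (rule sum.reindex_bij_witness[where j = "\<lambda>(\<sigma>, \<alpha>). (\<alpha>, inv \<alpha> \<circ> \<sigma>)" and i = "\<lambda>(\<alpha>, \<beta>). (\<alpha> \<circ> \<beta>, \<alpha>)"])
    fix z assume "z \<in> (SIGMA \<sigma>:S. M \<sigma>)"
    then obtain \<sigma> \<alpha> where z: "z = (\<sigma>, \<alpha>)" "\<sigma> \<in> S" "\<alpha> \<in> M \<sigma>" by auto
    then have p: "\<sigma> permutes X" "\<alpha> permutes X" using S by auto
    then have "inv \<alpha> \<circ> \<sigma> permutes X" by (simp add: permutes_compose permutes_inv)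
    then show "(\<lambda>(\<sigma>, \<alpha>). (\<alpha>, inv \<alpha> \<circ> \<sigma>)) z \<in> {p. fst p permutes X \<and> snd p permutes X \<and> Q p}"
      using Q[OF p(2), of "inv \<alpha> \<circ> \<sigma>"] z p comp_inv_comp[OF p(2), of \<sigma>] by simp
    show "(\<lambda>(\<alpha>, \<beta>). (\<alpha> \<circ> \<beta>, \<alpha>)) ((\<lambda>(\<sigma>, \<alpha>). (\<alpha>, inv \<alpha> \<circ> \<sigma>)) z) = z"
      using z comp_inv_comp[OF p(2)] by simp
    show "(case (case z of (\<sigma>, \<alpha>) \<Rightarrow> (\<alpha>, inv \<alpha> \<circ> \<sigma>)) of (\<alpha>, \<beta>) \<Rightarrow> F \<alpha> \<beta>) = (case z of (\<sigma>, \<alpha>) \<Rightarrow> F \<alpha> (inv \<alpha> \<circ> \<sigma>))"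
      using z by simp
  next
    fix z assume "z \<in> {p. fst p permutes X \<and> snd p permutes X \<and> Q p}"
    then obtain \<alpha> \<beta> where z: "z = (\<alpha>, \<beta>)" "\<alpha> permutes X" "\<beta> permutes X" "Q (\<alpha>, \<beta>)" by (cases z) auto
    show "(\<lambda>(\<sigma>, \<alpha>). (\<alpha>, inv \<alpha> \<circ> \<sigma>)) ((\<lambda>(\<alpha>, \<beta>). (\<alpha> \<circ> \<beta>, \<alpha>)) z) = z"
      using z(1) by (simp add: inv_comp_comp[OF z(2)])
    show "(\<lambda>(\<alpha>, \<beta>). (\<alpha> \<circ> \<beta>, \<alpha>)) z \<in> (SIGMA \<sigma>:S. M \<sigma>)" using z Q by auto
  qed
  finally show ?thesis by simp
qed

lemma sum_tri:
  assumes "finite X" "bij_betw \<gamma> X X"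
  shows "(\<Sum>(\<alpha>, \<beta>)\<in>tri X \<gamma>. F \<alpha> \<beta>) = (\<Sum>\<sigma>\<in>geo X \<gamma>. \<Sum>\<alpha>\<in>geo X \<sigma>. F \<alpha> (inv \<alpha> \<circ> \<sigma>))"
proof -
  have "{p. fst p permutes X \<and> snd p permutes X \<and> p \<in> tri X \<gamma>} = tri X \<gamma>" by (auto simp: tri_def)
  moreover have "(\<Sum>(\<alpha>, \<beta>)\<in>{p. fst p permutes X \<and> snd p permutes X \<and> p \<in> tri X \<gamma>}. F \<alpha> \<beta>) =
      (\<Sum>\<sigma>\<in>geo X \<gamma>. \<Sum>\<alpha>\<in>geo X \<sigma>. F \<alpha> (inv \<alpha> \<circ> \<sigma>))"
    by (rule sum_factorizations[OF assms(1) tri_iff[OF assms]]) (auto simp: geo_def)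
  ultimately show ?thesis by simp
qed

lemma sum_tri_wt:
  assumes "finite X" "bij_betw \<gamma> X X"
  shows "(\<Sum>(\<alpha>, \<beta>)\<in>tri X \<gamma>. wt f (perm_cycles X \<alpha>) * wt g (perm_cycles X \<beta>))
    = (\<Sum>\<sigma>\<in>geo X \<gamma>. wt (prod_kappa f g) (perm_cycles X \<sigma>))"
  unfolding sum_tri[OF assms]
  by (intro sum.cong refl, subst conv_eq_wt[symmetric]) (auto simp: assms conv_def geo_def permutes_imp_bij)

section \<open>Non-crossing partitions as geodesics\<close>

lemma block_unique: "partition_on X P \<Longrightarrow> V \<in> P \<Longrightarrow> W \<in> P \<Longrightarrow> x \<in> V \<Longrightarrow> x \<in> W \<Longrightarrow> V = W"
  by (metis IntI disjointD empty_iff partition_onD2)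

lemma perm_of_block:
  assumes "partition_on X P" "V \<in> P" "x \<in> V"
  shows "perm_of P x = gamma V x"
proof -
  have "{W \<in> P. x \<in> W} = {V}" using assms block_unique[OF assms(1)] by auto
  then show ?thesis by (simp add: perm_of_def gamma_def)
qed

lemma perm_of_notin: "partition_on X P \<Longrightarrow> x \<notin> X \<Longrightarrow> perm_of P x = x"
proof -
  assume "partition_on X P" "x \<notin> X"
  then have e: "{W \<in> P. x \<in> W} = {}" by (auto simp: partition_on_def)
  show ?thesis unfolding perm_of_def e by simp
qed

lemma block_finite: "finite X \<Longrightarrow> partition_on X P \<Longrightarrow> V \<in> P \<Longrightarrow> finite V"
  by (metis Sup_upper finite_subset partition_onD1)

lemma perm_of_permutes:
  assumes "finite X" "partition_on X P"
  shows "perm_of P permutes X"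
proof (rule bij_imp_permutes)
  have V: "perm_of P ` V = V" if "V \<in> P" for V
  proof -
    have "perm_of P ` V = gamma V ` V"
      using perm_of_block[OF assms(2) that] by (intro image_cong) auto
    then show ?thesis
      using gamma_permutes block_finite[OF assms that] by (metis permutes_image)
  qed
  have "perm_of P ` X = (\<Union>V\<in>P. perm_of P ` V)"
    using partition_onD1[OF assms(2)] by blast
  also have "\<dots> = X" using V partition_onD1[OF assms(2)] by auto
  finally show "bij_betw (perm_of P) X X"
    using assms(1) by (simp add: bij_betw_def finite_surj_inj)
qed (rule perm_of_notin[OF assms(2)])

lemma perm_cycles_perm_of:
  assumes "finite X" "partition_on X P"
  shows "perm_cycles X (perm_of P) = P"
proof -
  have V: "perm_cycles V (perm_of P) = {V}" if "V \<in> P" for V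
  proof -
    have "V \<noteq> {}" using that assms(2) by (auto simp: partition_on_def)
    have "perm_cycles V (gamma V) = perm_cycles V (perm_of P)"
      using perm_of_block[OF assms(2) that] block_finite[OF assms that]
      by (intro perm_cycles_cong) (auto intro: permutes_imp_bij gamma_permutes)
    then show ?thesis using perm_cycles_gamma[OF block_finite[OF assms that] \<open>V \<noteq> {}\<close>] by simp
  qed
  have "perm_cycles X (perm_of P) = (\<Union>V\<in>P. perm_cycles V (perm_of P))"
    unfolding partition_onD1[OF assms(2)] perm_cycles_def by blast
  then show ?thesis using V by simp
qed

lemma perm_of_single: "finite X \<Longrightarrow> X \<noteq> {} \<Longrightarrow> perm_of {X} = gamma X"
proof
  fix x assume X: "finite X" "X \<noteq> {}"
  then have "partition_on X {X}" by (simp add: partition_on_space)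
  then show "perm_of {X} x = gamma X x"
    using X by (cases "x \<in> X") (auto simp: perm_of_block perm_of_notin gamma_notin)
qed

lemma perm_of_Un:
  assumes "finite S" "finite T" "partition_on S P" "partition_on T Q" "S \<inter> T = {}"
  shows "perm_of (P \<union> Q) = perm_of P \<circ> perm_of Q"
proof
  fix x
  have pq: "partition_on (S \<union> T) (P \<union> Q)" using assms by (auto simp: partition_on_def intro: disjoint_union)
  note e = comp_disjoint_eqs(1,2)[OF assms(5) perm_of_permutes[OF assms(1,3)] perm_of_permutes[OF assms(2,4)]]
  consider V where "V \<in> P" "x \<in> V" | V where "V \<in> Q" "x \<in> V" | "x \<notin> S \<union> T"
    using partition_onD1[OF pq] by blast
  then show "perm_of (P \<union> Q) x = (perm_of P \<circ> perm_of Q) x"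
  proof cases
    case 1
    then have "x \<in> S" using assms(3) by (auto simp: partition_on_def)
    then show ?thesis unfolding e(1)[OF \<open>x \<in> S\<close>] using 1 perm_of_block[OF pq, of V x] perm_of_block[OF assms(3), of V x] by simp
  next
    case 2
    then have "x \<in> T" using assms(4) by (auto simp: partition_on_def)
    then show ?thesis unfolding e(2)[OF \<open>x \<in> T\<close>] using 2 perm_of_block[OF pq, of V x] perm_of_block[OF assms(4), of V x] by simp
  next
    case 3
    then show ?thesis using perm_of_notin[OF pq] perm_of_notin[OF assms(3)] perm_of_notin[OF assms(4)] by simp
  qed
qed

section \<open>Cutting the long cycle along a chord\<close>

lemma gamma_next_ex:
  fixes A :: "nat set"
  assumes "finite A" "x \<in> A" "\<exists>z\<in>A. x < z"
  obtains y where "y \<in> A" "x < y" "\<And>z. z \<in> A \<Longrightarrow> x < z \<Longrightarrow> y \<le> z" "gamma A x = y"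
proof -
  let ?M = "{z\<in>A. x < z}"
  have M: "finite ?M" "?M \<noteq> {}" using assms by auto
  have y: "Min ?M \<in> A" "x < Min ?M" using Min_in[OF M] by auto
  have le: "Min ?M \<le> z" if "z \<in> A" "x < z" for z using M(1) that by (intro Min_le) auto
  show ?thesis by (rule that[OF y le gamma_next[OF assms(1,2) y le]])
qed

text \<open>After the transposition \<open>j\<close> jumps back to the successor of
  \<open>i\<close>, which closes up the interval above \<open>i\<close> up to \<open>j\<close>, and
  \<open>i\<close> jumps to the successor of \<open>j\<close>, which closes up the rest.\<close>

lemma gamma_transpose:
  fixes X :: "nat set"
  assumes "finite X" "i \<in> X" "j \<in> X" "i < j"
  defines "I \<equiv> {y\<in>X. i < y \<and> y \<le> j}"
  shows "x \<in> I \<Longrightarrow> (gamma X \<circ> transpose i j) x = gamma I x"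
    and "x \<in> X - I \<Longrightarrow> (gamma X \<circ> transpose i j) x = gamma (X - I) x"
proof -
  have fI: "finite I" "finite (X - I)" and jI: "j \<in> I" and iI: "i \<in> X - I" using assms by auto
  show "(gamma X \<circ> transpose i j) x = gamma I x" if x: "x \<in> I"
  proof (cases "x = j")
    case True
    have "gamma X i = Min I"
    proof (rule gamma_next[OF assms(1,2)])
      have m: "Min I \<in> I" using fI(1) jI by (intro Min_in) auto
      then show "Min I \<in> X" "i < Min I" by (auto simp: I_def)
      fix z assume "z \<in> X" "i < z"
      then show "Min I \<le> z" using fI(1) m by (cases "z \<le> j") (auto simp: I_def intro: Min_le)
    qed
    moreover have "gamma I j = Min I" using jI fI by (intro gamma_last) (auto simp: I_def)
    ultimately show ?thesis using True by simp
  next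
    case False
    then have "\<exists>z\<in>I. x < z" using x jI by (auto simp: I_def intro!: bexI[of _ j])
    then obtain y where y: "y \<in> I" "x < y" "\<And>z. z \<in> I \<Longrightarrow> x < z \<Longrightarrow> y \<le> z" "gamma I x = y"
      using gamma_next_ex[OF fI(1) x] by metis
    have "gamma X x = y"
    proof (rule gamma_next[OF assms(1)])
      fix z assume "z \<in> X" "x < z"
      then show "y \<le> z" using y x by (cases "z \<le> j") (auto simp: I_def)
    qed (use x y in \<open>auto simp: I_def\<close>)
    then show ?thesis using False x y by (auto simp: I_def)
  qed
  show "(gamma X \<circ> transpose i j) x = gamma (X - I) x" if x: "x \<in> X - I"
  proof -
    define x' where "x' = transpose i j x"
    have x': "x' \<in> X" "x' = (if x = i then j else x)" using x jI assms by (auto simp: x'_def transpose_def)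
    \<comment> \<open>Only \<open>x = i\<close> needs an argument: \<open>I\<close> contains all
      points of \<open>X\<close> above \<open>i\<close> up to \<open>j\<close>, so the same points
      of \<open>X - I\<close> lie above \<open>i\<close> as above \<open>j\<close>.\<close>
    have between: "z \<in> X - I \<Longrightarrow> x < z \<Longrightarrow> x' < z" "z \<in> X \<Longrightarrow> x' < z \<Longrightarrow> x < z" for z
      using x x'(2) assms(4) by (cases "x = i"; auto simp: I_def)+
    have "gamma X x' = gamma (X - I) x"
    proof (cases "\<exists>z\<in>X. x' < z")
      case True
      then obtain y where y: "y \<in> X" "x' < y" "\<And>z. z \<in> X \<Longrightarrow> x' < z \<Longrightarrow> y \<le> z" "gamma X x' = y"
        using gamma_next_ex[OF assms(1) x'(1)] by metis
      have "y \<notin> I"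
      proof
        assume yI: "y \<in> I"
        then have "x \<noteq> i" using y(2) x' by (auto simp: I_def)
        then have "x < i" using yI y(2) x x' by (auto simp: I_def)
        then have "y \<le> i" using y(3) assms x' by auto
        then show False using yI by (auto simp: I_def)
      qed
      then have "gamma (X - I) x = y"
        using x y between fI by (intro gamma_next) auto
      then show ?thesis using y by simp
    next
      case False
      then have last: "\<And>z. z \<in> X \<Longrightarrow> z \<le> x'" by (meson not_less)
      have "gamma X x' = Min X" using last x' assms by (intro gamma_last) auto
      moreover have "gamma (X - I) x = Min (X - I)"
      proof (rule gamma_last[OF fI(2) x])
        fix z assume "z \<in> X - I" then show "z \<le> x" using between(1)[of z] last[of z] by force
      qed
      moreover have "Min (X - I) = Min X"
      proof (rule Min_eqI[OF fI(2)])
        have "Min X \<le> i" using assms by simp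
        moreover have "Min X \<in> X" using assms by (metis Min_in empty_iff)
        ultimately show "Min X \<in> X - I" by (auto simp: I_def)
      qed (use assms in auto)
      ultimately show ?thesis by simp
    qed
    then show ?thesis by (simp add: x'_def)
  qed
qed

lemma geo_cong:
  assumes "bij_betw \<sigma> S S" "\<And>x. x \<in> S \<Longrightarrow> \<sigma> x = \<tau> x"
  shows "geo S \<sigma> = geo S \<tau>"
proof -
  have "perm_cycles S (inv \<alpha> \<circ> \<sigma>) = perm_cycles S (inv \<alpha> \<circ> \<tau>)" if "\<alpha> permutes S" for \<alpha>
    using assms that by (intro perm_cycles_cong bij_betw_inv_comp) auto
  then show ?thesis using perm_cycles_cong[OF assms] by (auto simp: geo_def)
qed

text \<open>\<open>\<delta>\<close> has two cycles and \<open>inv \<delta> \<circ> gamma X\<close>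
  is the transposition, with \<open>card X - 1\<close> cycles. The counts add up to
  \<open>card X + 1\<close>, so the cut circle lies below the full one.\<close>

lemma gamma_split:
  fixes X :: "nat set"
  assumes "finite X" "i \<in> X" "j \<in> X" "i < j"
  defines "I \<equiv> {y\<in>X. i < y \<and> y \<le> j}" and "\<delta> \<equiv> gamma X \<circ> transpose i j"
  shows "bij_betw \<delta> I I" "bij_betw \<delta> (X - I) (X - I)" "bij_betw \<delta> X X" "nc X \<delta> = 2"
    "geo I \<delta> = geo I (gamma I)" "geo (X - I) \<delta> = geo (X - I) (gamma (X - I))"
    "\<delta> \<in> geo X (gamma X)"
proof -
  note g = gamma_transpose[OF assms(1-4), folded I_def \<delta>_def]
  have fI: "finite I" "finite (X - I)" and ne: "I \<noteq> {}" "X - I \<noteq> {}" using assms by (auto simp: I_def)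
  have gb: "bij_betw (gamma I) I I" "bij_betw (gamma (X - I)) (X - I) (X - I)"
    using fI by (auto intro!: permutes_imp_bij gamma_permutes)
  show b: "bij_betw \<delta> I I" "bij_betw \<delta> (X - I) (X - I)"
    using gb bij_betw_cong[of I \<delta> "gamma I" I] bij_betw_cong[of "X - I" \<delta> "gamma (X - I)" "X - I"] g by auto
  have un: "I \<union> (X - I) = X" by (auto simp: I_def)
  then show bX: "bij_betw \<delta> X X" using bij_betw_combine[OF b] by auto
  have c: "perm_cycles I \<delta> = {I}" "perm_cycles (X - I) \<delta> = {X - I}"
    using perm_cycles_cong[OF b(1) g(1)] perm_cycles_cong[OF b(2) g(2)] perm_cycles_gamma fI ne by auto
  show n2: "nc X \<delta> = 2" using nc_Un[OF fI b] un c by simp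
  show "geo I \<delta> = geo I (gamma I)" "geo (X - I) \<delta> = geo (X - I) (gamma (X - I))"
    using geo_cong[OF b(1) g(1)] geo_cong[OF b(2) g(2)] by auto
  have \<delta>: "\<delta> permutes X"
    unfolding \<delta>_def using assms by (intro permutes_compose gamma_permutes permutes_swap_id)
  have "inv \<delta> = transpose i j \<circ> inv (gamma X)"
    unfolding \<delta>_def using assms
    by (subst inv_comp_permutes[of _ X]) (auto intro: gamma_permutes permutes_swap_id)
  then have "inv \<delta> \<circ> gamma X = id \<circ> transpose i j"
    using permutes_inv_o(2)[OF gamma_permutes[OF assms(1)]] by (simp add: comp_assoc)
  moreover have "(i, j) \<notin> eqcl (moves X {id})"
  proof -
    have "eqcl (moves X {id}) `` {i} \<subseteq> {i}" using assms by (intro moves_class_subset) auto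
    then show ?thesis using assms by auto
  qed
  ultimately have "nc X (inv \<delta> \<circ> gamma X) + 1 = card X"
    using nc_merge[of X id i j] assms by (simp add: nc_id)
  moreover have "nc X (gamma X) = 1" using perm_cycles_gamma[OF assms(1)] assms(2) by (metis card_1_singleton_iff empty_iff One_nat_def)
  ultimately show "\<delta> \<in> geo X (gamma X)" using \<delta> n2 by (simp add: geo_def)
qed

lemma gamma_in_geo: "finite X \<Longrightarrow> gamma X \<in> geo X (gamma X)"
  using gamma_permutes[of X] permutes_inv_o(2)[OF gamma_permutes[of X]] by (simp add: geo_def nc_id)

lemma NC_D: "P \<in> NC X \<Longrightarrow> partition_on X P" "P \<in> NC X \<Longrightarrow> noncrossing P"
  by (simp_all add: NC_def)

lemma noncrossingD:
  assumes "noncrossing P" "U \<in> P" "V \<in> P" "i \<in> U" "j \<in> V" "k \<in> U" "l \<in> V"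
    "i < j" "j < k" "k < l"
  shows "U = V"
proof (rule ccontr)
  assume n: "U \<noteq> V"
  have "\<exists>U\<in>P. \<exists>V\<in>P. U \<noteq> V \<and> (\<exists>i\<in>U. \<exists>j\<in>V. \<exists>k\<in>U. \<exists>l\<in>V. i < j \<and> j < k \<and> k < l)"
    by (rule bexI[OF _ assms(2)], rule bexI[OF _ assms(3)], rule conjI[OF n], rule bexI[OF _ assms(4)],
        rule bexI[OF _ assms(5)], rule bexI[OF _ assms(6)], rule bexI[OF _ assms(7)], intro conjI assms)
  then show False using assms(1) unfolding noncrossing_def by (rule notE[rotated])
qed

lemma noncrossing_subset:
  assumes "noncrossing P" "Q \<subseteq> P"
  shows "noncrossing Q"
  unfolding noncrossing_def
proof clarify
  fix U V i j k l
  assume "U \<in> Q" "V \<in> Q" "U \<noteq> V" "i \<in> U" "j \<in> V" "k \<in> U" "l \<in> V" "i < j" "j < k" "k < l"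
  then show False using noncrossingD[OF assms(1), of U V i j k l] assms(2) by auto
qed

text \<open>The convex hull of a block is a union of blocks, which splits off a smaller partition.\<close>

lemma perm_of_NC_in_geo:
  assumes "finite X" "P \<in> NC X"
  shows "perm_of P \<in> geo X (gamma X)"
  using assms
proof (induction "card X" arbitrary: X P rule: less_induct)
  case (less X P)
  note P = NC_D[OF less.prems(2)]
  consider "X = {}" | "X \<noteq> {}" "P = {X}" | "X \<noteq> {}" "P \<noteq> {X}" by blast
  then show ?case
  proof cases
    case 1
    then have "perm_of P permutes {}" using perm_of_permutes[OF less.prems(1) P(1)] by simp
    then show ?thesis using 1 by (simp add: geo_def perm_cycles_def)
  next
    case 2
    then show ?thesis using perm_of_single[OF less.prems(1)] gamma_in_geo less.prems(1) by simp
  next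
    case 3
    let ?m = "Min X"
    have mX: "?m \<in> X" using 3 less.prems by simp
    \<comment> \<open>A block without the minimum leaves a point of \<open>X\<close> to the left of
      its hull, so the hull is a proper subset.\<close>
    have "\<exists>V\<in>P. ?m \<notin> V"
    proof (rule ccontr)
      assume *: "\<not> (\<exists>V\<in>P. ?m \<notin> V)"
      obtain W where W: "W \<in> P" using mX partition_onD1[OF P(1)] by blast
      then have "P = {W}" using * block_unique[OF P(1)] by blast
      then show False using 3 partition_onD1[OF P(1)] by simp
    qed
    then obtain V where V: "V \<in> P" "?m \<notin> V" by blast
    have VX: "V \<subseteq> X" "finite V" "V \<noteq> {}"
      using V P(1) block_finite[OF less.prems(1) P(1)] by (auto simp: partition_on_def)
    define a where "a = Min V"
    define j where "j = Max V"
    have aj: "a \<in> V" "j \<in> V" "\<And>v. v \<in> V \<Longrightarrow> a \<le> v \<and> v \<le> j" using VX by (auto simp: a_def j_def)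
    have "?m < a" using V aj VX less.prems(1) by (metis Min_le le_neq_implies_less subsetD)
    \<comment> \<open>The predecessor of \<open>a\<close> in \<open>X\<close>: with it, the interval
      that \<open>gamma_split\<close> cuts off, above \<open>i\<close> and up to \<open>j\<close>,
      is exactly the hull of \<open>V\<close>.\<close>
    define i where "i = Max {z\<in>X. z < a}"
    have ne: "{z\<in>X. z < a} \<noteq> {}" "finite {z\<in>X. z < a}" using \<open>?m < a\<close> mX less.prems by auto
    have i: "i \<in> X" "i < a" using Max_in[OF ne(2,1)] by (auto simp: i_def)
    have below: "z \<le> i" if "z \<in> X" "z < a" for z using that ne(2) by (auto simp: i_def)
    have ij: "i < j" "j \<in> X" using i aj VX by (auto intro: less_le_trans)
    define I where "I = {y\<in>X. i < y \<and> y \<le> j}"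
    have I: "I = {y\<in>X. a \<le> y \<and> y \<le> j}" using below i unfolding I_def by force
    \<comment> \<open>A block other than \<open>V\<close> that meets the hull does so strictly
      between the end points, which belong to \<open>V\<close>. A further point outside the hull
      would make it cross \<open>V\<close>.\<close>
    have blocks: "W \<subseteq> I" if W: "W \<in> P" "w \<in> W" "w \<in> I" for W w
    proof
      fix u assume u: "u \<in> W"
      have uX: "u \<in> X" using u W P(1) by (auto simp: partition_on_def)
      show "u \<in> I"
      proof (cases "W = V")
        case True then show ?thesis using u aj uX by (simp add: I)
      next
        case False
        then have "w \<noteq> a" "w \<noteq> j" using W V aj block_unique[OF P(1)] by blast+
        then have w: "a < w" "w < j" using W(3) by (auto simp: I)
        show ?thesis
        proof (rule ccontr)
          assume "u \<notin> I"
          then consider "u < a" | "j < u" using uX by (auto simp: I)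
          then show False
          proof cases
            case 1 then show ?thesis using noncrossingD[OF P(2) W(1) V(1) u aj(1) W(2) aj(2)] w False by simp
          next
            case 2 then show ?thesis using noncrossingD[OF P(2) V(1) W(1) aj(1) W(2) aj(2) u] w False by simp
          qed
        qed
      qed
    qed
    define P1 where "P1 = {W\<in>P. W \<subseteq> I}"
    define P2 where "P2 = {W\<in>P. W \<subseteq> X - I}"
    have PU: "P = P1 \<union> P2" using blocks P(1) unfolding P1_def P2_def partition_on_def by blast
    have IX: "I \<subseteq> X" by (auto simp: I_def)
    have p1: "partition_on I P1"
    proof (rule partition_onI)
      show "\<Union>P1 = I"
      proof
        show "I \<subseteq> \<Union>P1" using blocks IX partition_onD1[OF P(1)] unfolding P1_def by blast
      qed (auto simp: P1_def)
    qed (use P(1) in \<open>auto simp: P1_def partition_on_def disjoint_def disjnt_def\<close>)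
    have p2: "partition_on (X - I) P2"
    proof (rule partition_onI)
      show "\<Union>P2 = X - I"
      proof
        show "X - I \<subseteq> \<Union>P2" using blocks partition_onD1[OF P(1)] unfolding P2_def by blast
      qed (auto simp: P2_def)
    qed (use P(1) in \<open>auto simp: P2_def partition_on_def disjoint_def disjnt_def\<close>)
    have nc1: "P1 \<in> NC I" "P2 \<in> NC (X - I)"
      using p1 p2 noncrossing_subset[OF P(2)] PU by (auto simp: NC_def)
    note G = gamma_split[OF less.prems(1) i(1) ij(2,1), folded I_def]
    have fin: "finite I" "finite (X - I)" using less.prems(1) by (auto simp: I_def)
    have "I \<subset> X" "X - I \<subset> X" using i aj VX ij by (auto simp: I_def)
    then have "card I < card X" "card (X - I) < card X" using less.prems(1) by (auto intro!: psubset_card_mono)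
    then have "perm_of P1 \<in> geo I (gamma I)" "perm_of P2 \<in> geo (X - I) (gamma (X - I))"
      using less.hyps nc1 fin by auto
    then have "perm_of P1 \<circ> perm_of P2 \<in> geo (I \<union> (X - I)) (gamma X \<circ> transpose i j)"
      using geo_Un[OF fin _ G(1,2)] G(5,6) by (auto simp: bij_betw_def)
    then have "perm_of P \<in> geo X (gamma X \<circ> transpose i j)"
      using perm_of_Un[OF fin p1 p2] PU IX by (simp add: Un_absorb1)
    then show ?thesis
      using geo_trans[OF less.prems(1) G(7)] gamma_permutes less.prems(1) permutes_imp_bij by blast
  qed
qed

text \<open>\<open>I\<close> is convex in \<open>X\<close>, whereas a crossing of an inner with an
  outer block would put an outer point strictly between two inner ones.\<close>

lemma noncrossing_Un_interval:
  assumes "noncrossing P" "noncrossing Q" "\<And>U. U \<in> P \<Longrightarrow> U \<subseteq> I" "\<And>V. V \<in> Q \<Longrightarrow> V \<subseteq> X - I"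
    and I: "\<And>u v w. u \<in> I \<Longrightarrow> w \<in> I \<Longrightarrow> v \<in> X \<Longrightarrow> u < v \<Longrightarrow> v < w \<Longrightarrow> v \<in> I"
  shows "noncrossing (P \<union> Q)"
  unfolding noncrossing_def
proof clarify
  fix U V i j k l
  assume *: "U \<in> P \<union> Q" "V \<in> P \<union> Q" "U \<noteq> V" "i \<in> U" "j \<in> V" "k \<in> U" "l \<in> V" "i < j" "j < k" "k < l"
  consider "U \<in> P" "V \<in> P" | "U \<in> Q" "V \<in> Q" | "U \<in> P" "V \<in> Q" | "U \<in> Q" "V \<in> P" using * by blast
  then show False
  proof cases
    case 1 then show ?thesis using noncrossingD[OF assms(1) 1 *(4-10)] *(3) by simp
  next
    case 2 then show ?thesis using noncrossingD[OF assms(2) 2 *(4-10)] *(3) by simp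
  next
    case 3
    then have "i \<in> I" "k \<in> I" "j \<in> X - I" using * assms(3,4) by blast+
    then show ?thesis using I[of i k j] * by blast
  next
    case 4
    then have "j \<in> I" "l \<in> I" "k \<in> X - I" using * assms(3,4) by blast+
    then show ?thesis using I[of j l k] * by blast
  qed
qed

text \<open>If \<open>\<alpha>\<close> is not the long cycle, its Kreweras complement moves some
  point. Splitting the cycle of that point by a transposition raises the counts for the complement
  and for the circle by one each. Hence \<open>\<alpha>\<close> is below a circle cut along a chord
  and consists of two smaller geodesics.\<close>

lemma geo_gamma_NC:
  fixes X :: "nat set"
  assumes "finite X" "\<alpha> \<in> geo X (gamma X)"
  shows "perm_cycles X \<alpha> \<in> NC X \<and> perm_of (perm_cycles X \<alpha>) = \<alpha>"
  using assms
proof (induction "card X" arbitrary: X \<alpha> rule: less_induct)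
  case (less X \<alpha>)
  have \<alpha>: "\<alpha> permutes X" and n\<alpha>: "nc X \<alpha> + nc X (inv \<alpha> \<circ> gamma X) = card X + nc X (gamma X)"
    using less.prems by (auto simp: geo_def)
  have gX: "gamma X permutes X" using gamma_permutes less.prems(1) .
  consider "X = {}" | "X \<noteq> {}" "\<alpha> = gamma X" | "X \<noteq> {}" "\<alpha> \<noteq> gamma X" by blast
  then show ?case
  proof cases
    case 1
    then have "\<alpha> = id" "perm_of {} = id" using \<alpha> by (auto simp: perm_of_def)
    then show ?thesis using 1 by (simp add: perm_cycles_def NC_def noncrossing_def partition_on_def)
  next
    case 2
    then have "perm_cycles X \<alpha> = {X}" using perm_cycles_gamma less.prems(1) by simp
    moreover have "{X} \<in> NC X" using 2 by (simp add: NC_def noncrossing_def partition_on_space)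
    ultimately show ?thesis using 2 perm_of_single less.prems(1) by simp
  next
    case 3
    let ?\<delta> = "inv \<alpha> \<circ> gamma X"
    have \<delta>: "?\<delta> permutes X" using \<alpha> gX by (simp add: permutes_compose permutes_inv)
    have "?\<delta> \<noteq> id" using 3 comp_inv_comp[OF \<alpha>, of "gamma X"] by auto
    then obtain u where u: "?\<delta> u \<noteq> u" by (auto simp: fun_eq_iff)
    then have uX: "u \<in> X" "?\<delta> u \<in> X" using \<delta> permutes_not_in permutes_in_image by metis+
    \<comment> \<open>A point and its image under the complement are the ends of the chord; they are
      ordered because \<open>gamma_split\<close> expects \<open>i < j\<close>.\<close>
    define i where "i = min u (?\<delta> u)"
    define j where "j = max u (?\<delta> u)"
    have ij: "i \<in> X" "j \<in> X" "i < j" using u uX by (auto simp: i_def j_def min_def max_def)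
    have uu: "(u, ?\<delta> u) \<in> eqcl (moves X {?\<delta>})" using uX by (intro eqcl_base) (auto simp: moves_def)
    have ijc: "(i, j) \<in> eqcl (moves X {?\<delta>})"
      using uu eqcl_sym[OF uu] by (auto simp: i_def j_def min_def max_def)
    define I where "I = {y\<in>X. i < y \<and> y \<le> j}"
    let ?\<gamma> = "gamma X \<circ> transpose i j"
    note G = gamma_split[OF less.prems(1) ij, folded I_def]
    have "nc X (inv \<alpha> \<circ> ?\<gamma>) = nc X ?\<delta> + 1"
      using nc_split[OF less.prems(1) permutes_imp_bij[OF \<delta>] ij(1,2) _ ijc] ij by (simp add: comp_assoc)
    moreover have "nc X (gamma X) = 1" using perm_cycles_gamma less.prems 3 by auto
    ultimately have \<alpha>g: "\<alpha> \<in> geo X ?\<gamma>" using n\<alpha> \<alpha> G(4) by (simp add: geo_def)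
    have fin: "finite I" "finite (X - I)" using less.prems(1) by (auto simp: I_def)
    have IX: "I \<union> (X - I) = X" by (auto simp: I_def)
    have "\<alpha> \<in> (\<lambda>(a, b). a \<circ> b) ` (geo I (gamma I) \<times> geo (X - I) (gamma (X - I)))"
      using \<alpha>g bij_betw_imp_surj_on[OF geo_Un[OF fin _ G(1,2)]] IX G(5,6) by auto
    then obtain a b where ab: "a \<in> geo I (gamma I)" "b \<in> geo (X - I) (gamma (X - I))" "\<alpha> = a \<circ> b"
      by auto
    have abp: "a permutes I" "b permutes X - I" using ab by (auto simp: geo_def)
    have "I \<subset> X" "X - I \<subset> X" using ij by (auto simp: I_def)
    then have "card I < card X" "card (X - I) < card X" using less.prems(1) by (auto intro!: psubset_card_mono)
    then have IH: "perm_cycles I a \<in> NC I" "perm_of (perm_cycles I a) = a"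
      "perm_cycles (X - I) b \<in> NC (X - I)" "perm_of (perm_cycles (X - I) b) = b"
      using less.hyps fin ab by blast+
    have cyc: "perm_cycles X \<alpha> = perm_cycles I a \<union> perm_cycles (X - I) b"
      using perm_cycles_comp_disjoint(1,2)[OF _ abp G(1,2)] perm_cycles_Un[of I "X - I" \<alpha>] IX ab(3) by auto
    have sub: "\<And>U. U \<in> perm_cycles I a \<Longrightarrow> U \<subseteq> I" "\<And>V. V \<in> perm_cycles (X - I) b \<Longrightarrow> V \<subseteq> X - I"
      using perm_cycles_subset abp permutes_imp_bij by blast+
    have "noncrossing (perm_cycles X \<alpha>)" unfolding cyc
      by (rule noncrossing_Un_interval[OF NC_D(2)[OF IH(1)] NC_D(2)[OF IH(3)] sub]) (auto simp: I_def)
    then have "perm_cycles X \<alpha> \<in> NC X"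
      using partition_on_perm_cycles[OF less.prems(1) permutes_imp_bij[OF \<alpha>]] by (simp add: NC_def)
    moreover have "perm_of (perm_cycles X \<alpha>) = \<alpha>"
      unfolding cyc using perm_of_Un[OF fin NC_D(1)[OF IH(1)] NC_D(1)[OF IH(3)]] IH ab(3) by auto
    ultimately show ?thesis by simp
  qed
qed

text \<open>The classical identification of non-crossing partitions with the interval between the
  identity and the long cycle in the absolute order.\<close>

theorem bij_betw_perm_of:
  assumes "finite X"
  shows "bij_betw perm_of (NC X) (geo X (gamma X))"
  by (rule bij_betw_byWitness[where f' = "perm_cycles X"])
    (use assms geo_gamma_NC perm_of_NC_in_geo in \<open>auto simp: perm_cycles_perm_of NC_D(1)\<close>)

lemma sum_NC:
  assumes "finite X"
  shows "(\<Sum>P\<in>NC X. F P (kreweras X P)) = (\<Sum>\<alpha>\<in>geo X (gamma X). F (perm_cycles X \<alpha>) (perm_cycles X (inv \<alpha> \<circ> gamma X)))"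
proof -
  have "(\<Sum>\<alpha>\<in>geo X (gamma X). F (perm_cycles X \<alpha>) (perm_cycles X (inv \<alpha> \<circ> gamma X)))
    = (\<Sum>P\<in>NC X. F (perm_cycles X (perm_of P)) (perm_cycles X (inv (perm_of P) \<circ> gamma X)))"
    by (rule sum.reindex_bij_betw[OF bij_betw_perm_of[OF assms], symmetric])
  then show ?thesis by (simp add: perm_cycles_perm_of[OF assms NC_D(1)] kreweras_def)
qed

section \<open>Alternating words\<close>

text \<open>The two embeddings \<open>u\<close> and \<open>v\<close> place the letters \<open>a\<close> and \<open>b\<close> of an alternating word.
  A permutation of the positions that preserves the letters is a pair of permutations
  \<open>(\<alpha>, \<beta>)\<close> of \<open>X\<close>.\<close>

definition dbl :: "'x set \<Rightarrow> ('x \<Rightarrow> 'y) \<Rightarrow> ('x \<Rightarrow> 'y) \<Rightarrow> ('x \<Rightarrow> 'x) \<Rightarrow> ('x \<Rightarrow> 'x) \<Rightarrow> 'y \<Rightarrow> 'y" where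
  "dbl X u v \<alpha> \<beta> = map_permutation X u \<alpha> \<circ> map_permutation X v \<beta>"

text \<open>\<open>\<gamma>2\<close> runs through \<open>u x, v x, u (\<gamma> x), ...\<close>, i.e.
  through the cycles of \<open>\<gamma>\<close> with each point replaced by a letter
  \<open>a\<close> followed by a letter \<open>b\<close>. The set and \<open>\<gamma>\<close> are
  left open, so that one circle and two circles are both covered.\<close>

locale doubling =
  fixes X :: "'x set" and u v :: "'x \<Rightarrow> 'y" and \<gamma> :: "'x \<Rightarrow> 'x" and \<gamma>2 :: "'y \<Rightarrow> 'y"
  assumes finite_X: "finite X"
    and inj_u: "inj_on u X" and inj_v: "inj_on v X" and disj: "u ` X \<inter> v ` X = {}"
    and bij_\<gamma>: "bij_betw \<gamma> X X"
    and \<gamma>2_u: "x \<in> X \<Longrightarrow> \<gamma>2 (u x) = v x" and \<gamma>2_v: "x \<in> X \<Longrightarrow> \<gamma>2 (v x) = u (\<gamma> x)"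
begin

abbreviation "X2 \<equiv> u ` X \<union> v ` X"

lemma finite_X2: "finite X2" using finite_X by simp

lemma u_neq_v: "x \<in> X \<Longrightarrow> y \<in> X \<Longrightarrow> u x \<noteq> v y"
  using disj by (metis IntI empty_iff imageI)

lemma images_disjoint:
  assumes "\<And>C. C \<in> \<C> \<Longrightarrow> C \<subseteq> X" "\<And>D. D \<in> \<D> \<Longrightarrow> D \<subseteq> X \<and> D \<noteq> {}"
  shows "(`) u ` \<C> \<inter> (`) v ` \<D> = {}"
proof (rule ccontr)
  assume "(`) u ` \<C> \<inter> (`) v ` \<D> \<noteq> {}"
  then obtain C D where CD: "C \<in> \<C>" "D \<in> \<D>" "u ` C = v ` D" by auto
  then obtain d where "d \<in> D" "d \<in> X" using assms(2)[of D] by blast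
  then have "v d \<in> u ` C" using CD(3) by blast
  then show False using u_neq_v assms(1)[OF CD(1)] \<open>d \<in> X\<close> by (metis imageE subsetD)
qed

lemma card_X2: "card X2 = 2 * card X"
  using finite_X disj by (simp add: card_Un_disjoint card_image inj_u inj_v)

lemma map_permutes:
  assumes "\<alpha> permutes X"
  shows "map_permutation X u \<alpha> permutes u ` X" "map_permutation X v \<alpha> permutes v ` X"
  using assms inj_u inj_v map_permutation_permutes[of u X "u ` X"] map_permutation_permutes[of v X "v ` X"]
  by (auto simp: bij_betw_def)

lemma bij_betw_dbl:
  "bij_betw (\<lambda>(\<alpha>, \<beta>). dbl X u v \<alpha> \<beta>) ({\<alpha>. \<alpha> permutes X} \<times> {\<beta>. \<beta> permutes X})
     {\<pi>. \<pi> permutes X2 \<and> bij_betw \<pi> (u ` X) (u ` X)}"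
proof -
  have "bij_betw (map_prod (map_permutation X u) (map_permutation X v))
      ({\<alpha>. \<alpha> permutes X} \<times> {\<beta>. \<beta> permutes X}) ({a. a permutes u ` X} \<times> {b. b permutes v ` X})"
    by (intro bij_betw_map_prod bij_betw_map_permutation inj_u inj_v)
  from bij_betw_trans[OF this bij_betw_permutes_Un[OF disj]]
  show ?thesis by (simp add: comp_def dbl_def case_prod_unfold)
qed

lemma dbl_permutes: "\<alpha> permutes X \<Longrightarrow> \<beta> permutes X \<Longrightarrow> dbl X u v \<alpha> \<beta> permutes X2"
  using bij_betw_dbl by (auto simp: bij_betw_def)

lemma dbl_apply:
  assumes "\<alpha> permutes X" "\<beta> permutes X" "x \<in> X"
  shows "dbl X u v \<alpha> \<beta> (u x) = u (\<alpha> x)" "dbl X u v \<alpha> \<beta> (v x) = v (\<beta> x)"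
    "inv (dbl X u v \<alpha> \<beta>) (u x) = u (inv \<alpha> x)" "inv (dbl X u v \<alpha> \<beta>) (v x) = v (inv \<beta> x)"
  using comp_disjoint_eqs[OF disj map_permutes(1)[OF assms(1)] map_permutes(2)[OF assms(2)]] assms(3)
    map_permutation_inv[OF inj_u assms(1,3)] map_permutation_inv[OF inj_v assms(2,3)]
  unfolding dbl_def by (simp_all add: map_permutation_apply inj_u inj_v del: comp_apply)

lemma cycles_dbl:
  assumes "\<alpha> permutes X" "\<beta> permutes X" "S \<subseteq> X" "\<alpha> ` S \<subseteq> S" "\<beta> ` S \<subseteq> S"
  shows "perm_cycles (u ` S) (dbl X u v \<alpha> \<beta>) = (`) u ` perm_cycles S \<alpha>"
    "perm_cycles (v ` S) (dbl X u v \<alpha> \<beta>) = (`) v ` perm_cycles S \<beta>"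
  using assms(3) dbl_apply[OF assms(1,2)] by (auto intro!: perm_cycles_relabel[OF _ assms(4)] perm_cycles_relabel[OF _ assms(5)])

lemma cycles_dbl_X:
  assumes "\<alpha> permutes X" "\<beta> permutes X"
  shows "perm_cycles (u ` X) (dbl X u v \<alpha> \<beta>) = (`) u ` perm_cycles X \<alpha>"
    "perm_cycles (v ` X) (dbl X u v \<alpha> \<beta>) = (`) v ` perm_cycles X \<beta>"
  using cycles_dbl[OF assms subset_refl] assms permutes_image by (metis subset_refl)+

lemma nc_dbl:
  assumes "\<alpha> permutes X" "\<beta> permutes X"
  shows "nc X2 (dbl X u v \<alpha> \<beta>) = nc X \<alpha> + nc X \<beta>"
proof -
  let ?d = "dbl X u v \<alpha> \<beta>"
  have b: "bij_betw \<alpha> X X" "bij_betw \<beta> X X" using assms permutes_imp_bij by auto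
  have d: "bij_betw ?d X2 X2" using dbl_permutes[OF assms] by (rule permutes_imp_bij)
  have "?d ` u ` X \<subseteq> u ` X" "?d ` v ` X \<subseteq> v ` X"
    using dbl_apply[OF assms] permutes_in_image[OF assms(1)] permutes_in_image[OF assms(2)] by auto
  then have "bij_betw ?d (u ` X) (u ` X)" "bij_betw ?d (v ` X) (v ` X)"
    using bij_betw_invariant[OF _ _ d] finite_X by auto
  then have "nc X2 ?d = nc (u ` X) ?d + nc (v ` X) ?d" using nc_Un finite_X disj by blast
  then show ?thesis
    unfolding cycles_dbl_X[OF assms]
    by (simp add: card_image[OF inj_on_image_cycles[OF inj_u b(1)]] card_image[OF inj_on_image_cycles[OF inj_v b(2)]])
qed

lemma bij_\<gamma>2: "bij_betw \<gamma>2 X2 X2"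
proof -
  have "\<gamma>2 ` u ` X = v ` X" unfolding image_image by (intro image_cong) (auto simp: \<gamma>2_u)
  moreover have "\<gamma>2 ` v ` X = u ` \<gamma> ` X" unfolding image_image by (intro image_cong) (auto simp: \<gamma>2_v)
  moreover have "\<gamma> ` X = X" by (rule bij_betw_imp_surj_on[OF bij_\<gamma>])
  ultimately have "\<gamma>2 ` X2 = X2" by (auto simp: image_Un)
  then show ?thesis using finite_X2 by (simp add: bij_betw_def finite_surj_inj)
qed

text \<open>\<open>\<rho>\<close> alternates between the letters: from \<open>u x\<close> to
  \<open>v (inv \<beta> x)\<close> to \<open>u (inv \<alpha> (\<gamma> (inv \<beta> x)))\<close>.
  Its cycles thus correspond to those of \<open>\<rho>'\<close>, which is conjugate by
  \<open>inv \<beta>\<close> to the third factor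
  \<open>inv \<beta> \<circ> inv \<alpha> \<circ> \<gamma>\<close>.\<close>

lemma nc_inv_dbl:
  assumes "\<alpha> permutes X" "\<beta> permutes X"
  shows "nc X2 (inv (dbl X u v \<alpha> \<beta>) \<circ> \<gamma>2) = nc X (inv \<beta> \<circ> inv \<alpha> \<circ> \<gamma>)"
proof -
  define \<rho> where "\<rho> = inv (dbl X u v \<alpha> \<beta>) \<circ> \<gamma>2"
  define \<rho>' where "\<rho>' = inv \<alpha> \<circ> \<gamma> \<circ> inv \<beta>"
  have ib: "inv \<beta> permutes X" "bij_betw (inv \<alpha>) X X" "bij_betw (inv \<beta>) X X"
    using assms permutes_inv permutes_imp_bij by blast+
  have \<rho>: "bij_betw \<rho> X2 X2" unfolding \<rho>_def
    by (intro bij_betw_inv_comp dbl_permutes assms bij_\<gamma>2)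
  have \<rho>': "bij_betw \<rho>' X X" unfolding \<rho>'_def using ib bij_\<gamma> by (intro bij_betw_comp)
  have \<beta>X: "inv \<beta> x \<in> X" if "x \<in> X" for x using that ib(1) permutes_in_image by metis
  have \<gamma>X: "\<gamma> x \<in> X" if "x \<in> X" for x using that bij_\<gamma> by (auto simp: bij_betw_def)
  have step_u: "\<rho> (u x) = v (inv \<beta> x)" if "x \<in> X" for x
    using that dbl_apply[OF assms] \<gamma>2_u by (simp add: \<rho>_def)
  have step_v: "\<rho> (v (inv \<beta> x)) = u (\<rho>' x)" if "x \<in> X" for x
    using that dbl_apply[OF assms] \<gamma>2_v \<gamma>X \<beta>X by (simp add: \<rho>_def \<rho>'_def)
  define J where "J C = u ` C \<union> v ` inv \<beta> ` C" for C
  have orbit_u: "orbit \<rho> (u x) = J (orbit \<rho>' x)" if x: "x \<in> X" for x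
  proof (intro equalityI subsetI)
    have oX: "orbit \<rho>' x \<subseteq> X" using orbit_restrict_id(2)[OF \<rho>' x] .
    fix y assume "y \<in> orbit \<rho> (u x)"
    then show "y \<in> J (orbit \<rho>' x)"
    proof induction
      case base
      then show ?case using step_u[OF x] self_in_orbit[OF finite_X \<rho>' x] by (auto simp: J_def)
    next
      case (step y)
      then consider k where "k \<in> orbit \<rho>' x" "y = u k" | k where "k \<in> orbit \<rho>' x" "y = v (inv \<beta> k)"
        by (auto simp: J_def)
      then show ?case
      proof cases
        case 1 then show ?thesis using step_u oX by (auto simp: J_def)
      next
        case 2 then show ?thesis using step_v oX orbit.step by (fastforce simp: J_def)
      qed
    qed
  next
    fix y assume y: "y \<in> J (orbit \<rho>' x)"
    have u: "k \<in> X \<and> u k \<in> orbit \<rho> (u x)" if "k \<in> orbit \<rho>' x" for k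
      using that
    proof induction
      case base
      have "\<rho> (\<rho> (u x)) \<in> orbit \<rho> (u x)" by (intro orbit.intros)
      then show ?case using step_u[OF x] step_v[OF x] \<rho>' x by (auto simp: bij_betw_def)
    next
      case (step k)
      then have "\<rho> (\<rho> (u k)) \<in> orbit \<rho> (u x)" by (intro orbit.step) auto
      then show ?case using step_u[of k] step_v[of k] \<rho>' step by (auto simp: bij_betw_def)
    qed
    have "v (inv \<beta> k) \<in> orbit \<rho> (u x)" if "k \<in> orbit \<rho>' x" for k
      using u[OF that] step_u[of k] orbit.step[of "u k" \<rho> "u x"] by auto
    then show "y \<in> orbit \<rho> (u x)" using u y by (auto simp: J_def)
  qed
  \<comment> \<open>Every point \<open>v x\<close> is the image of some \<open>u y\<close>, so there
    are no cycles besides those through the points \<open>u y\<close>.\<close>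
  have orbit_v: "orbit \<rho> (v x) \<in> orbit \<rho> ` u ` X" if x: "x \<in> X" for x
  proof -
    obtain y where y: "y \<in> X" "x = inv \<beta> y" using x ib(3) by (metis bij_betw_imp_surj_on imageE)
    have "\<rho> (u y) = v x" using step_u y by simp
    then have "v x \<in> orbit \<rho> (u y)" using orbit.base[of \<rho> "u y"] by simp
    moreover have "v x \<in> orbit \<rho> (v x)" using self_in_orbit[OF finite_X2 \<rho>] x by blast
    moreover have "orbit \<rho> (u y) \<in> perm_cycles X2 \<rho>" "orbit \<rho> (v x) \<in> perm_cycles X2 \<rho>"
      using x y by (auto simp: perm_cycles_def)
    ultimately have "orbit \<rho> (v x) = orbit \<rho> (u y)"
      using block_unique[OF partition_on_perm_cycles[OF finite_X2 \<rho>]] by metis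
    then show ?thesis using y by blast
  qed
  have "perm_cycles X2 \<rho> = orbit \<rho> ` u ` X"
    using orbit_v by (auto simp: perm_cycles_def)
  also have "\<dots> = J ` perm_cycles X \<rho>'"
    using orbit_u by (simp add: perm_cycles_def image_image)
  finally have J: "perm_cycles X2 \<rho> = J ` perm_cycles X \<rho>'" .
  have "inj_on J (perm_cycles X \<rho>')"
  proof (rule inj_onI)
    fix C D assume CD: "C \<in> perm_cycles X \<rho>'" "D \<in> perm_cycles X \<rho>'" "J C = J D"
    then have sub: "C \<subseteq> X" "D \<subseteq> X" using perm_cycles_subset[OF \<rho>'] by auto
    then have "J C \<inter> u ` X = u ` C" "J D \<inter> u ` X = u ` D" using u_neq_v \<beta>X by (auto simp: J_def subset_iff)
    then show "C = D" using CD(3) inj_on_image_eq_iff[OF inj_u sub] by simp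
  qed
  then have "nc X2 \<rho> = nc X \<rho>'" unfolding J by (rule card_image)
  also have "nc X \<rho>' = nc (inv \<beta> ` X) (inv \<beta> \<circ> inv \<alpha> \<circ> \<gamma>)"
    by (rule wt_relabel(2)[symmetric, OF _ \<rho>']) (use ib(3) in \<open>auto simp: \<rho>'_def bij_betw_def\<close>)
  also have "inv \<beta> ` X = X" using ib(3) by (simp add: bij_betw_def)
  finally show ?thesis unfolding \<rho>_def .
qed

text \<open>The preceding count for the two identity permutations.\<close>

lemma nc_\<gamma>2: "nc X2 \<gamma>2 = nc X \<gamma>"
proof -
  have "dbl X u v id id = id" by (simp add: dbl_def map_permutation_id' inj_u inj_v)
  then show ?thesis using nc_inv_dbl[of id id] by (simp add: inv_id[unfolded id_def] permutes_id[unfolded id_def])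
qed

lemma dbl_geo_iff:
  assumes "\<alpha> permutes X" "\<beta> permutes X"
  shows "dbl X u v \<alpha> \<beta> \<in> geo X2 \<gamma>2 \<longleftrightarrow> (\<alpha>, \<beta>) \<in> tri X \<gamma>"
  using assms dbl_permutes[OF assms] by (simp add: geo_def tri_def nc_dbl nc_inv_dbl nc_\<gamma>2 card_X2)

lemma sum_dbl:
  assumes "\<And>\<pi>. \<pi> permutes X2 \<Longrightarrow> Q \<pi> \<Longrightarrow> \<not> bij_betw \<pi> (u ` X) (u ` X) \<Longrightarrow> G \<pi> = 0"
  shows "(\<Sum>\<pi> | \<pi> permutes X2 \<and> Q \<pi>. G \<pi>) =
    (\<Sum>(\<alpha>, \<beta>) | \<alpha> permutes X \<and> \<beta> permutes X \<and> Q (dbl X u v \<alpha> \<beta>). G (dbl X u v \<alpha> \<beta>))"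
proof -
  let ?A = "{\<pi>. \<pi> permutes X2 \<and> bij_betw \<pi> (u ` X) (u ` X)}" and ?P = "{\<alpha>. \<alpha> permutes X} \<times> {\<beta>. \<beta> permutes X}"
  have fin: "finite {\<pi>. \<pi> permutes X2}" "finite ?P" using finite_X by (auto intro: finite_permutations)
  then have finA: "finite ?A" by (auto intro: finite_subset[of _ "{\<pi>. \<pi> permutes X2}"])
  have "(\<Sum>\<pi> | \<pi> permutes X2 \<and> Q \<pi>. G \<pi>) = (\<Sum>\<pi>\<in>{\<pi>\<in>?A. Q \<pi>}. G \<pi>)"
    using fin assms by (intro sum.mono_neutral_right) auto
  also have "\<dots> = (\<Sum>\<pi>\<in>?A. if Q \<pi> then G \<pi> else 0)" by (rule sum.inter_filter[OF finA])
  also have "\<dots> = (\<Sum>p\<in>?P. case p of (\<alpha>, \<beta>) \<Rightarrow> if Q (dbl X u v \<alpha> \<beta>) then G (dbl X u v \<alpha> \<beta>) else 0)"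
    by (subst sum.reindex_bij_betw[OF bij_betw_dbl, symmetric]) (auto intro: sum.cong)
  also have "\<dots> = (\<Sum>p\<in>{p\<in>?P. case p of (\<alpha>, \<beta>) \<Rightarrow> Q (dbl X u v \<alpha> \<beta>)}. case p of (\<alpha>, \<beta>) \<Rightarrow> G (dbl X u v \<alpha> \<beta>))"
    by (subst sum.inter_filter[OF fin(2)]) (auto intro: sum.cong)
  also have "{p\<in>?P. case p of (\<alpha>, \<beta>) \<Rightarrow> Q (dbl X u v \<alpha> \<beta>)} =
      {(\<alpha>, \<beta>). \<alpha> permutes X \<and> \<beta> permutes X \<and> Q (dbl X u v \<alpha> \<beta>)}" by auto
  finally show ?thesis .
qed

text \<open>The value that freeness gives to a cycle of an alternating word: a cumulant of
  \<open>a\<close> or of \<open>b\<close>, and 0 for a mixed cycle. The empty set would count as an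
  \<open>a\<close>-cycle, hence the nonemptiness assumption for images under
  \<open>v\<close>.\<close>

definition letter_wt :: "(nat \<Rightarrow> complex) \<Rightarrow> (nat \<Rightarrow> complex) \<Rightarrow> 'y set \<Rightarrow> complex" where
  "letter_wt f g V = (if V \<subseteq> u ` X then f (card V) else if V \<subseteq> v ` X then g (card V) else 0)"

lemma cycles_mono:
  assumes "\<pi> permutes X2" "\<forall>V\<in>perm_cycles X2 \<pi>. V \<subseteq> u ` X \<or> V \<subseteq> v ` X"
  shows "bij_betw \<pi> (u ` X) (u ` X)"
proof -
  have b: "bij_betw \<pi> X2 X2" using assms(1) by (rule permutes_imp_bij)
  have "\<pi> x \<in> u ` X" if "x \<in> u ` X" for x
  proof -
    have "orbit \<pi> x \<in> perm_cycles X2 \<pi>" "x \<in> orbit \<pi> x" "\<pi> x \<in> orbit \<pi> x"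
      using that self_in_orbit[OF finite_X2 b] orbit.base[of \<pi> x] by (auto simp: perm_cycles_def)
    then show ?thesis using assms(2) that disj by blast
  qed
  then show ?thesis using finite_X by (intro bij_betw_invariant[OF _ _ b]) auto
qed

lemma prod_letter_wt_zero:
  assumes "\<pi> permutes X2" "\<not> bij_betw \<pi> (u ` X) (u ` X)"
  shows "(\<Prod>V\<in>perm_cycles X2 \<pi>. letter_wt f g V) = 0"
proof -
  obtain V where "V \<in> perm_cycles X2 \<pi>" "\<not> V \<subseteq> u ` X" "\<not> V \<subseteq> v ` X"
    using cycles_mono[OF assms(1)] assms(2) by blast
  then show ?thesis
    using finite_X2 by (intro prod_zero) (auto simp: letter_wt_def simp del: Un_iff intro!: bexI[of _ V])
qed

lemma prod_letter_wt_u: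
  assumes "\<And>C. C \<in> \<C> \<Longrightarrow> C \<subseteq> X"
  shows "(\<Prod>V\<in>(`) u ` \<C>. letter_wt f g V) = wt f \<C>"
proof -
  have i: "inj_on ((`) u) \<C>" using assms inj_on_image_eq_iff[OF inj_u] by (intro inj_onI) metis
  have "letter_wt f g (u ` C) = f (card C)" if "C \<in> \<C>" for C
  proof -
    have "card (u ` C) = card C" using assms[OF that] inj_u by (meson card_image inj_on_subset)
    then show ?thesis using assms[OF that] by (auto simp: letter_wt_def)
  qed
  then show ?thesis by (simp add: wt_def prod.reindex[OF i])
qed

lemma letter_wt_v:
  assumes "C \<subseteq> X" "C \<noteq> {}"
  shows "letter_wt f g (v ` C) = g (card C)"
proof -
  have "card (v ` C) = card C" using assms(1) inj_v by (meson card_image inj_on_subset)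
  moreover have "\<not> v ` C \<subseteq> u ` X"
  proof
    assume "v ` C \<subseteq> u ` X"
    moreover obtain x where "x \<in> C" using assms(2) by blast
    ultimately have "v x \<in> u ` X" "x \<in> X" using assms(1) by auto
    then show False using u_neq_v by (metis imageE)
  qed
  ultimately show ?thesis using assms(1) by (auto simp: letter_wt_def)
qed

lemma prod_letter_wt_v:
  assumes "\<And>C. C \<in> \<C> \<Longrightarrow> C \<subseteq> X \<and> C \<noteq> {}"
  shows "(\<Prod>V\<in>(`) v ` \<C>. letter_wt f g V) = wt g \<C>"
proof -
  have i: "inj_on ((`) v) \<C>" using assms inj_on_image_eq_iff[OF inj_v] by (intro inj_onI) metis
  show ?thesis using assms by (simp add: wt_def prod.reindex[OF i] letter_wt_v)
qed

lemma prod_letter_wt_dbl: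
  assumes "\<alpha> permutes X" "\<beta> permutes X"
  shows "(\<Prod>V\<in>perm_cycles X2 (dbl X u v \<alpha> \<beta>). letter_wt f g V) = wt f (perm_cycles X \<alpha>) * wt g (perm_cycles X \<beta>)"
proof -
  have s: "\<And>C. C \<in> perm_cycles X \<alpha> \<Longrightarrow> C \<subseteq> X" "\<And>C. C \<in> perm_cycles X \<beta> \<Longrightarrow> C \<subseteq> X \<and> C \<noteq> {}"
    using perm_cycles_subset perm_cycles_nonempty permutes_imp_bij assms by blast+
  have "(`) u ` perm_cycles X \<alpha> \<inter> (`) v ` perm_cycles X \<beta> = {}"
    by (rule images_disjoint) (use s in auto)
  then show ?thesis
    using finite_X prod_letter_wt_u[OF s(1)] prod_letter_wt_v[OF s(2)]
    by (simp add: perm_cycles_Un cycles_dbl_X[OF assms] prod.union_disjoint)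
qed

lemma sum_geo_letter_wt:
  "(\<Sum>\<pi>\<in>geo X2 \<gamma>2. \<Prod>V\<in>perm_cycles X2 \<pi>. letter_wt f g V)
    = (\<Sum>(\<alpha>, \<beta>)\<in>tri X \<gamma>. wt f (perm_cycles X \<alpha>) * wt g (perm_cycles X \<beta>))"
proof -
  have g: "geo X2 \<gamma>2 = {\<pi>. \<pi> permutes X2 \<and> \<pi> \<in> geo X2 \<gamma>2}" by (auto simp: geo_def)
  have t: "{(\<alpha>, \<beta>). \<alpha> permutes X \<and> \<beta> permutes X \<and> dbl X u v \<alpha> \<beta> \<in> geo X2 \<gamma>2} = tri X \<gamma>"
    using dbl_geo_iff by (auto simp: tri_def)
  have "(\<Sum>\<pi>\<in>geo X2 \<gamma>2. \<Prod>V\<in>perm_cycles X2 \<pi>. letter_wt f g V) =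
      (\<Sum>(\<alpha>, \<beta>)\<in>tri X \<gamma>. \<Prod>V\<in>perm_cycles X2 (dbl X u v \<alpha> \<beta>). letter_wt f g V)"
    by (subst g, subst sum_dbl[OF prod_letter_wt_zero]) (simp_all add: t)
  also have "\<dots> = (\<Sum>(\<alpha>, \<beta>)\<in>tri X \<gamma>. wt f (perm_cycles X \<alpha>) * wt g (perm_cycles X \<beta>))"
    by (intro sum.cong refl) (auto simp: tri_def prod_letter_wt_dbl)
  finally show ?thesis .
qed

end

section \<open>Positions in alternating words and the cumulants of first order\<close>

abbreviation (input) odd_pos :: "nat \<Rightarrow> nat" where "odd_pos i \<equiv> 2 * i - 1"
abbreviation (input) even_pos :: "nat \<Rightarrow> nat" where "even_pos i \<equiv> 2 * i"

lemma odd_even_pos_Icc: "odd_pos ` {p+1..p+n} \<union> even_pos ` {p+1..p+n} = {2*p+1..2*p+2*n}"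
proof (intro equalityI subsetI)
  fix x assume x: "x \<in> {2*p+1..2*p+2*n}"
  show "x \<in> odd_pos ` {p+1..p+n} \<union> even_pos ` {p+1..p+n}"
  proof (cases "even x")
    case True
    then obtain k where "x = 2 * k" by (elim evenE)
    then show ?thesis using x by auto
  next
    case False
    then obtain k where "x = 2 * k + 1" by (elim oddE)
    then show ?thesis using x by (intro UnI1 image_eqI[of _ _ "k + 1"]) auto
  qed
qed auto

text \<open>The second circle starts at \<open>p + 1\<close> before doubling and at
  \<open>2 * p + 1\<close> afterwards, hence the general shift.\<close>

lemma doubling_gamma: "doubling {p+1..p+n} odd_pos even_pos (gamma {p+1..p+n}) (gamma {2*p+1..2*p+2*n})"
proof
  show "inj_on odd_pos {p+1..p+n}" by (auto simp: inj_on_def)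
  show "inj_on even_pos {p+1..p+n}" by (auto simp: inj_on_def)
  show "odd_pos ` {p+1..p+n} \<inter> even_pos ` {p+1..p+n} = {}"
    by (auto, presburger)
  show "bij_betw (gamma {p+1..p+n}) {p+1..p+n} {p+1..p+n}" by (intro permutes_imp_bij gamma_permutes) simp
  fix x assume x: "x \<in> {p+1..p+n}"
  then have "odd_pos x \<in> {2*p+1..2*p+2*n}" "even_pos x \<in> {2*p+1..2*p+2*n}" by auto
  then show "gamma {2*p+1..2*p+2*n} (odd_pos x) = even_pos x"
    "gamma {2*p+1..2*p+2*n} (even_pos x) = odd_pos (gamma {p+1..p+n} x)"
    using x gamma_atLeastAtMost[of x p n] gamma_atLeastAtMost[of "odd_pos x" "2*p" "2*n"] gamma_atLeastAtMost[of "even_pos x" "2*p" "2*n"]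
    by auto
qed simp

definition alt :: "'a \<Rightarrow> 'a \<Rightarrow> nat \<Rightarrow> 'a list" where
  "alt a b n = map (\<lambda>i. if odd i then a else b) [1..<Suc (2 * n)]"

lemma length_alt [simp]: "length (alt a b n) = 2 * n"
  by (simp add: alt_def)

lemma alt_nth: "i < 2 * n \<Longrightarrow> alt a b n ! i = (if even i then a else b)"
  by (simp add: alt_def nth_append del: upt_Suc)

lemma prod_list_alt: "prod_list (alt (a::'a::monoid_mult) b n) = prod_list (replicate n (a * b))"
proof (induction n)
  case (Suc n)
  have "alt a b (Suc n) = alt a b n @ [a, b]" by (simp add: alt_def)
  moreover have "prod_list (replicate n (a * b)) * (a * b) = a * b * prod_list (replicate n (a * b))"
    using power_commutes[of "a * b" n] by simp
  ultimately show ?case using Suc by (simp add: mult.assoc)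
qed (simp add: alt_def)

lemma entries_replicate:
  assumes "\<And>i. i \<in> set is \<Longrightarrow> 1 \<le> i \<and> i \<le> n"
  shows "entries (replicate n x) is = replicate (length is) x"
proof -
  have "entries (replicate n x) is = map (\<lambda>_. x) is"
    unfolding entries_def by (rule map_cong[OF refl]) (use assms in force)
  then show ?thesis by (simp add: map_replicate_const)
qed

lemma entries_alternating:
  assumes "\<And>i. i \<in> set is \<Longrightarrow> xs ! (i - 1) = (if odd i then a else b)"
  shows "entries xs is = map (\<lambda>l. if l then a else b) (map odd is)"
  using assms by (simp add: entries_def)

text \<open>By truncated subtraction \<open>odd_pos 0\<close> is the even number 0; therefore
  \<open>0 \<notin> X\<close>.\<close>

lemma odd_even_subset:
  fixes V :: "nat set"
  assumes "V \<subseteq> odd_pos ` X \<union> even_pos ` X" "0 \<notin> X"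
  shows "V \<subseteq> odd_pos ` X \<longleftrightarrow> (\<forall>i\<in>V. odd i)" "V \<subseteq> even_pos ` X \<longleftrightarrow> (\<forall>i\<in>V. even i)"
proof -
  have *: "odd (odd_pos x)" if "x \<in> X" for x using that assms(2) by (cases x) auto
  show "V \<subseteq> odd_pos ` X \<longleftrightarrow> (\<forall>i\<in>V. odd i)" "V \<subseteq> even_pos ` X \<longleftrightarrow> (\<forall>i\<in>V. even i)"
    using * assms(1) by fastforce+
qed

text \<open>Letters are encoded by the parity of positions, so a list with both parities gives a
  mixed cumulant. The list is arbitrary instead of a sorted block, since the cycles of annular
  permutations are read in cyclic order.\<close>

lemma cumulant_letter_wt:
  assumes "\<And>ls. set ls = {True, False} \<Longrightarrow> free_cumulant \<phi> (map (\<lambda>l. if l then a else b) ls) = 0"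
    and "doubling X odd_pos even_pos \<gamma> \<gamma>2" "0 \<notin> X" "set is \<subseteq> odd_pos ` X \<union> even_pos ` X" "is \<noteq> []" "distinct is"
    and "\<And>i. i \<in> set is \<Longrightarrow> xs ! (i - 1) = (if odd i then a else b)"
  shows "free_cumulant \<phi> (entries xs is) = doubling.letter_wt X odd_pos even_pos (kappa \<phi> a) (kappa \<phi> b) (set is)"
proof -
  interpret doubling X odd_pos even_pos \<gamma> \<gamma>2 by fact
  have c: "card (set is) = length is" using assms(6) by (rule distinct_card)
  have e: "entries xs is = map (\<lambda>l. if l then a else b) (map odd is)"
    by (rule entries_alternating) (rule assms(7))
  note oe = odd_even_subset[OF assms(4,3)]
  consider "\<forall>i\<in>set is. odd i" | "\<forall>i\<in>set is. even i" "\<exists>i\<in>set is. even i" | "\<exists>i\<in>set is. odd i" "\<exists>i\<in>set is. even i"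
    by blast
  then show ?thesis
  proof cases
    case 1
    have "entries xs is = map (\<lambda>_. a) is" by (rule trans[OF e]) (use 1 in auto)
    then have "entries xs is = replicate (length is) a" by (simp add: map_replicate_const)
    then show ?thesis using 1 oe c unfolding letter_wt_def kappa_def by simp
  next
    case 2
    have "entries xs is = map (\<lambda>_. b) is" by (rule trans[OF e]) (use 2 in auto)
    then have "entries xs is = replicate (length is) b" by (simp add: map_replicate_const)
    then show ?thesis using 2 oe c unfolding letter_wt_def kappa_def by auto
  next
    case 3
    then have "set (map odd is) = {True, False}" by (auto simp: image_iff)
    then have "free_cumulant \<phi> (entries xs is) = 0" unfolding e by (intro assms(1))
    then show ?thesis using 3 oe unfolding letter_wt_def by auto
  qed
qed

lemma finite_NC: "finite X \<Longrightarrow> finite (NC X)"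
  by (rule finite_subset[of _ "Pow (Pow X)"]) (auto simp: NC_def partition_on_def)

lemma NC_block: "finite X \<Longrightarrow> P \<in> NC X \<Longrightarrow> V \<in> P \<Longrightarrow> finite V \<and> V \<noteq> {} \<and> V \<subseteq> X"
  using block_finite[OF _ NC_D(1)] by (auto simp: NC_def partition_on_def)

lemma moment_alternating:
  assumes "\<And>ls. set ls = {True, False} \<Longrightarrow> free_cumulant \<phi> (map (\<lambda>l. if l then a else b) ls) = 0" "n \<ge> 1"
  shows "\<phi> (prod_list (replicate n (a * b))) =
    (\<Sum>P\<in>NC {1..n}. wt (prod_kappa (kappa \<phi> a) (kappa \<phi> b)) P)"
proof -
  let ?X = "{1..n}"
  let ?Y = "odd_pos ` ?X \<union> even_pos ` ?X"
  interpret doubling ?X odd_pos even_pos "gamma ?X" "gamma {1..2*n}"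
    using doubling_gamma[of 0 n] by simp
  have Y: "?Y = {1..2*n}" using odd_even_pos_Icc[of 0 n] by simp
  have "\<phi> (prod_list (replicate n (a * b))) = \<phi> (prod_list (alt a b n))" by (simp add: prod_list_alt)
  also have "\<dots> = (\<Sum>P\<in>NC {1..2*n}. \<Prod>V\<in>P. free_cumulant \<phi> (entries (alt a b n) (sorted_list_of_set V)))"
    using assms(2) by (subst moment_cumulant) (auto simp: alt_def)
  also have "\<dots> = (\<Sum>P\<in>NC {1..2*n}. \<Prod>V\<in>P. letter_wt (kappa \<phi> a) (kappa \<phi> b) V)"
  proof (intro sum.cong prod.cong refl)
    fix P V assume "P \<in> NC {1..2*n}" "V \<in> P"
    then have V: "finite V" "V \<noteq> {}" "V \<subseteq> {1..2*n}" using NC_block by auto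
    have "alt a b n ! (i - 1) = (if odd i then a else b)" if "i \<in> V" for i
    proof -
      have "i - 1 < 2 * n" "1 \<le> i" using that V(3) by force+
      then show ?thesis by (subst alt_nth) auto
    qed
    then show "free_cumulant \<phi> (entries (alt a b n) (sorted_list_of_set V)) = letter_wt (kappa \<phi> a) (kappa \<phi> b) V"
      using V Y by (subst cumulant_letter_wt[OF assms(1) doubling_axioms]) auto
  qed
  also have "\<dots> = (\<Sum>\<pi>\<in>geo {1..2*n} (gamma {1..2*n}). \<Prod>V\<in>perm_cycles {1..2*n} \<pi>. letter_wt (kappa \<phi> a) (kappa \<phi> b) V)"
    by (rule sum_NC) simp
  also have "\<dots> = (\<Sum>(\<alpha>, \<beta>)\<in>tri ?X (gamma ?X). wt (kappa \<phi> a) (perm_cycles ?X \<alpha>) * wt (kappa \<phi> b) (perm_cycles ?X \<beta>))"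
    using sum_geo_letter_wt unfolding Y .
  also have "\<dots> = (\<Sum>\<sigma>\<in>geo ?X (gamma ?X). wt (prod_kappa (kappa \<phi> a) (kappa \<phi> b)) (perm_cycles ?X \<sigma>))"
    by (rule sum_tri_wt) (auto intro: permutes_imp_bij gamma_permutes)
  also have "\<dots> = (\<Sum>P\<in>NC ?X. wt (prod_kappa (kappa \<phi> a) (kappa \<phi> b)) P)"
    by (rule sum_NC[symmetric]) simp
  finally show ?thesis .
qed

lemma moment_replicate:
  assumes "n \<ge> 1"
  shows "\<phi> (prod_list (replicate n x)) = (\<Sum>P\<in>NC {1..n}. wt (kappa \<phi> x) P)"
proof -
  have "\<phi> (prod_list (replicate n x)) = (\<Sum>P\<in>NC {1..n}. \<Prod>V\<in>P. free_cumulant \<phi> (entries (replicate n x) (sorted_list_of_set V)))"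
    using assms by (subst moment_cumulant) auto
  also have "\<dots> = (\<Sum>P\<in>NC {1..n}. wt (kappa \<phi> x) P)"
    unfolding wt_def
  proof (intro sum.cong prod.cong refl)
    fix P V assume "P \<in> NC {1..n}" "V \<in> P"
    then have "finite V" "V \<subseteq> {1..n}" using NC_block by auto
    then show "free_cumulant \<phi> (entries (replicate n x) (sorted_list_of_set V)) = kappa \<phi> x (card V)"
      by (subst entries_replicate) (auto simp: kappa_def)
  qed
  finally show ?thesis .
qed

lemma single_in_NC: "X \<noteq> {} \<Longrightarrow> {X} \<in> NC X"
  by (simp add: NC_def noncrossing_def partition_on_space)

text \<open>Both sequences satisfy the moment-cumulant formula for the moments of
  \<open>a * b\<close>, the right-hand one by \<open>moment_alternating\<close>. In every partition
  but the one-block one all blocks are shorter, so these terms cancel by induction.\<close>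

theorem kappa_prod_eq:
  assumes "\<And>ls. set ls = {True, False} \<Longrightarrow> free_cumulant \<phi> (map (\<lambda>l. if l then a else b) ls) = 0" "n \<ge> 1"
  shows "kappa \<phi> (a * b) n = prod_kappa (kappa \<phi> a) (kappa \<phi> b) n"
  using assms(2)
proof (induction n rule: less_induct)
  case (less n)
  let ?k = "prod_kappa (kappa \<phi> a) (kappa \<phi> b)"
  let ?S = "NC {1..n}"
  have one: "{{1..n}} \<in> ?S" using less.prems by (intro single_in_NC) auto
  have fin: "finite ?S" by (rule finite_NC) simp
  have "wt (kappa \<phi> (a * b)) P = wt ?k P" if P: "P \<in> ?S - {{{1..n}}}" for P
    unfolding wt_def
  proof (rule prod.cong[OF refl])
    fix V assume V: "V \<in> P"
    have "card V < card {1..n}" using NC_block_card_less[of P "{1..n}" V] P V by auto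
    moreover have "finite V" "V \<noteq> {}" using NC_block[of "{1..n}" P V] P V by auto
    ultimately show "kappa \<phi> (a * b) (card V) = ?k (card V)"
      by (intro less.IH) (auto simp: Suc_le_eq card_gt_0_iff)
  qed
  then have "(\<Sum>P\<in>?S - {{{1..n}}}. wt (kappa \<phi> (a * b)) P) = (\<Sum>P\<in>?S - {{{1..n}}}. wt ?k P)"
    by (rule sum.cong[OF refl])
  moreover have "(\<Sum>P\<in>?S. wt (kappa \<phi> (a * b)) P) = (\<Sum>P\<in>?S. wt ?k P)"
    using moment_replicate[OF less.prems, of \<phi> "a * b"] moment_alternating[OF assms(1) less.prems] by simp
  ultimately have "wt (kappa \<phi> (a * b)) {{1..n}} = wt ?k {{1..n}}"
    using sum.remove[OF fin one, of "wt (kappa \<phi> (a * b))"] sum.remove[OF fin one, of "wt ?k"] by simp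
  then show ?case by (simp add: wt_def)
qed

section \<open>Annular geodesics\<close>

text \<open>For permutations of a finite set this is transitivity of the group they generate, and
  for two of them it is the one-block join, by \<open>partition_join_eq_iff\<close>. The form with
  invariant subsets is the one that is easily transported to relabelled and doubled sets.\<close>

definition conn :: "'x set \<Rightarrow> ('x \<Rightarrow> 'x) set \<Rightarrow> bool" where
  "conn X F \<longleftrightarrow> (\<forall>S\<subseteq>X. (\<forall>f\<in>F. f ` S \<subseteq> S) \<longrightarrow> S = {} \<or> S = X)"

text \<open>The annular analogues of \<open>geo\<close> and \<open>tri\<close>, for \<open>\<sigma>\<close> and \<open>\<gamma>\<close> with two cycles.\<close>

definition ann :: "'x set \<Rightarrow> ('x \<Rightarrow> 'x) \<Rightarrow> ('x \<Rightarrow> 'x) set" where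
  "ann X \<sigma> = {\<alpha>. \<alpha> permutes X \<and> conn X {\<alpha>, \<sigma>} \<and> nc X \<alpha> + nc X (inv \<alpha> \<circ> \<sigma>) = card X}"

definition tri2 :: "'x set \<Rightarrow> ('x \<Rightarrow> 'x) \<Rightarrow> (('x \<Rightarrow> 'x) \<times> ('x \<Rightarrow> 'x)) set" where
  "tri2 X \<gamma> = {(\<alpha>, \<beta>). \<alpha> permutes X \<and> \<beta> permutes X \<and> conn X {\<alpha>, \<beta>, \<gamma>} \<and>
     nc X \<alpha> + nc X \<beta> + nc X (inv \<beta> \<circ> inv \<alpha> \<circ> \<gamma>) = 2 * card X}"

lemma connD:
  "conn X F \<Longrightarrow> S \<subseteq> X \<Longrightarrow> (\<And>f. f \<in> F \<Longrightarrow> f ` S \<subseteq> S) \<Longrightarrow> S = {} \<or> S = X"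
  by (auto simp: conn_def)

lemma connI:
  "(\<And>S. S \<subseteq> X \<Longrightarrow> (\<And>f. f \<in> F \<Longrightarrow> f ` S \<subseteq> S) \<Longrightarrow> S = {} \<or> S = X) \<Longrightarrow> conn X F"
  by (auto simp: conn_def)

lemma finite_ann [simp]: "finite X \<Longrightarrow> finite (ann X \<sigma>)"
  by (rule finite_subset[OF _ finite_permutations]) (auto simp: ann_def)

lemma eqcl_class_invariant:
  assumes "f \<in> F" "C = eqcl (moves X F) `` {x}" "C \<subseteq> X"
  shows "f ` C \<subseteq> C"
proof
  fix y assume "y \<in> f ` C"
  then obtain z where z: "z \<in> C" "y = f z" by blast
  then have "(z, f z) \<in> eqcl (moves X F)" using assms by (intro eqcl_base) (auto simp: moves_def)
  then show "y \<in> C" using z assms(2) eqcl_trans[of x z "moves X F"] by auto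
qed

lemma eqcl_class_in:
  assumes "finite X" "x \<in> X" "\<And>f. f \<in> F \<Longrightarrow> bij_betw f X X"
  shows "eqcl (moves X F) `` {x} \<subseteq> X"
  using assms by (intro moves_class_subset) (auto simp: bij_betw_def)

lemma conn_class:
  assumes "finite X" "x \<in> X" "\<And>f. f \<in> F \<Longrightarrow> bij_betw f X X" "conn X F"
  shows "eqcl (moves X F) `` {x} = X"
proof -
  let ?C = "eqcl (moves X F) `` {x}"
  have C: "?C \<subseteq> X" using assms by (intro eqcl_class_in)
  have "?C = {} \<or> ?C = X"
    using C eqcl_class_invariant[OF _ refl C] by (intro connD[OF assms(4) C])
  then show ?thesis by auto
qed

lemma conn_classes:
  assumes "finite X" "X \<noteq> {}" "\<And>f. f \<in> F \<Longrightarrow> bij_betw f X X" "conn X F"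
  shows "classes X (moves X F) = {X}"
  using conn_class[OF assms(1) _ assms(3,4)] assms(2) by (auto simp: classes_def)

lemma class_conn:
  assumes "finite X" "\<And>f. f \<in> F \<Longrightarrow> bij_betw f X X" "Z = eqcl (moves X F) `` {z}" "Z \<subseteq> X"
  shows "conn Z F"
proof (rule connI)
  fix S assume S: "S \<subseteq> Z" "\<And>f. f \<in> F \<Longrightarrow> f ` S \<subseteq> S"
  show "S = {} \<or> S = Z"
  proof (cases "S = {}")
    case False
    then obtain x where x: "x \<in> S" by blast
    then have "eqcl (moves X F) `` {x} \<subseteq> S"
      using S assms finite_subset[OF subset_trans[OF S(1) assms(4)] assms(1)]
      by (intro moves_class_subset) auto
    moreover have "eqcl (moves X F) `` {x} = Z" using x S(1) assms(3) eqcl_class_eq[of z x "moves X F"] by auto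
    ultimately show ?thesis using S(1) by auto
  qed simp
qed

text \<open>A step of either of \<open>\<sigma>\<close> and
  \<open>inv \<alpha> \<circ> \<sigma>\<close> is a step of the other followed by one of
  \<open>\<alpha>\<close>, taken forwards or backwards.\<close>

lemma eqcl_moves_inv_comp:
  assumes "\<alpha> permutes X" "bij_betw \<sigma> X X"
  shows "eqcl (moves X {\<alpha>, inv \<alpha> \<circ> \<sigma>}) = eqcl (moves X {\<alpha>, \<sigma>})"
proof (rule eqcl_eqI)
  let ?b = "inv \<alpha> \<circ> \<sigma>"
  have b: "?b x \<in> X" "\<alpha> (?b x) = \<sigma> x" if "x \<in> X" for x
    using that bij_betw_inv_comp[OF assms] permutes_inverses(1)[OF assms(1)] by (auto simp: bij_betw_def)
  have m: "(x, f x) \<in> eqcl (moves X F)" if "x \<in> X" "f \<in> F" for x f F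
    using that by (auto simp: moves_def intro!: eqcl_base)
  have "(x, ?b x) \<in> eqcl (moves X {\<alpha>, \<sigma>})" if x: "x \<in> X" for x
  proof -
    have "(x, \<sigma> x) \<in> eqcl (moves X {\<alpha>, \<sigma>})" "(?b x, \<sigma> x) \<in> eqcl (moves X {\<alpha>, \<sigma>})"
      using m[OF x, of \<sigma> "{\<alpha>, \<sigma>}"] m[OF b(1)[OF x], of \<alpha> "{\<alpha>, \<sigma>}"] b(2)[OF x] by simp_all
    then show ?thesis using eqcl_trans eqcl_sym by metis
  qed
  then show "moves X {\<alpha>, ?b} \<subseteq> eqcl (moves X {\<alpha>, \<sigma>})" by (auto simp: moves_def intro: eqcl_base)
  have "(x, \<sigma> x) \<in> eqcl (moves X {\<alpha>, ?b})" if x: "x \<in> X" for x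
  proof -
    have "(x, ?b x) \<in> eqcl (moves X {\<alpha>, ?b})" "(?b x, \<sigma> x) \<in> eqcl (moves X {\<alpha>, ?b})"
      using m[OF x, of ?b "{\<alpha>, ?b}"] m[OF b(1)[OF x], of \<alpha> "{\<alpha>, ?b}"] b(2)[OF x] by simp_all
    then show ?thesis by (rule eqcl_trans)
  qed
  then show "moves X {\<alpha>, \<sigma>} \<subseteq> eqcl (moves X {\<alpha>, ?b})" by (auto simp: moves_def intro: eqcl_base)
qed

lemma genus_inv:
  assumes "finite X" "\<alpha> permutes X" "bij_betw \<sigma> X X"
  shows "nc X \<alpha> + nc X (inv \<alpha> \<circ> \<sigma>) + nc X \<sigma> \<le> card X + 2 * card (classes X (moves X {\<alpha>, \<sigma>}))"
  using genus_inequality[OF assms(1) permutes_imp_bij[OF assms(2)] bij_betw_inv_comp[OF assms(2,3)]]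
    classes_cong[OF eqcl_moves_inv_comp[OF assms(2,3)]] by (simp only: comp_inv_comp[OF assms(2)])

lemma genus_conn:
  assumes "finite X" "X \<noteq> {}" "bij_betw \<alpha> X X" "bij_betw \<beta> X X" "conn X {\<alpha>, \<alpha> \<circ> \<beta>}"
  shows "nc X \<alpha> + nc X \<beta> + nc X (\<alpha> \<circ> \<beta>) \<le> card X + 2"
proof -
  have "conn X {\<alpha>, \<beta>}"
  proof (rule connI)
    fix S assume S: "S \<subseteq> X" "\<And>f. f \<in> {\<alpha>, \<beta>} \<Longrightarrow> f ` S \<subseteq> S"
    then have "\<alpha> ` S \<subseteq> S" "\<beta> ` S \<subseteq> S" by auto
    then have "(\<alpha> \<circ> \<beta>) ` S \<subseteq> S" by auto
    with \<open>\<alpha> ` S \<subseteq> S\<close> show "S = {} \<or> S = X" by (intro connD[OF assms(5) S(1)]) auto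
  qed
  then have "classes X (moves X {\<alpha>, \<beta>}) = {X}" using assms by (intro conn_classes) auto
  then show ?thesis using genus_inequality[OF assms(1,3,4)] by simp
qed

lemma right_factor_image:
  assumes "\<alpha> permutes X" "bij_betw \<alpha> C C" "(\<alpha> \<circ> \<beta>) ` C \<subseteq> C"
  shows "\<beta> ` C \<subseteq> C"
proof clarify
  fix x assume x: "x \<in> C"
  then have "\<alpha> (\<beta> x) \<in> \<alpha> ` C" using assms(2,3) by (auto simp: bij_betw_def)
  then obtain y where y: "y \<in> C" "\<alpha> y = \<alpha> (\<beta> x)" by force
  then have "y = \<beta> x" using assms(1) by (metis permutes_def)
  then show "\<beta> x \<in> C" using y by simp
qed

text \<open>One joint orbit fewer than cycles of \<open>\<sigma>\<close> means that
  \<open>\<alpha>\<close> fuses exactly two of them. As \<open>\<alpha>\<close> leaves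
  \<open>L\<close> at some \<open>x\<close>, these are the cycles of \<open>x\<close> and of
  \<open>\<alpha> x\<close>, one on each side.\<close>

lemma merged_cycles:
  assumes "finite X" "X = L \<union> R" "L \<inter> R = {}" "bij_betw \<sigma> L L" "bij_betw \<sigma> R R" "bij_betw \<alpha> X X"
    and card: "card (classes X (moves X {\<alpha>, \<sigma>})) + 1 = nc X \<sigma>" and "\<not> \<alpha> ` L \<subseteq> L"
  shows "\<exists>A\<in>perm_cycles L \<sigma>. \<exists>B\<in>perm_cycles R \<sigma>. conn (A \<union> B) {\<alpha>, \<sigma>} \<and> \<alpha> ` (A \<union> B) \<subseteq> A \<union> B"
proof -
  have \<sigma>: "bij_betw \<sigma> X X" using assms(2,3,4,5) bij_betw_combine by metis
  let ?r = "moves X {\<sigma>}" and ?s = "moves X {\<alpha>, \<sigma>}"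
  have bij: "bij_betw f X X" if "f \<in> {\<alpha>, \<sigma>}" for f using that assms(6) \<sigma> by auto
  have sub: "?r \<subseteq> eqcl ?s" by (auto simp: moves_def intro: eqcl_base)
  have cyc: "perm_cycles X \<sigma> = classes X ?r" using perm_cycles_eq_classes[OF assms(1) \<sigma>] .
  define g where "g C = eqcl ?s `` C" for C
  have orb: "orbit \<sigma> x = eqcl ?r `` {x}" if "x \<in> X" for x using orbit_eq_class[OF assms(1) \<sigma> that] .
  have g: "g (orbit \<sigma> x) = eqcl ?s `` {x}" if x: "x \<in> X" for x
  proof -
    have "g (eqcl ?r `` {x}) \<subseteq> eqcl ?s `` {x}"
      using subsetD[OF eqcl_least[OF sub]] eqcl_trans[of x _ ?s] by (auto simp: g_def)
    moreover have "eqcl ?s `` {x} \<subseteq> g (eqcl ?r `` {x})" by (auto simp: g_def)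
    ultimately show ?thesis using orb[OF x] by simp
  qed
  have im: "classes X ?s = g ` perm_cycles X \<sigma>"
    unfolding classes_def perm_cycles_def image_image using g by (intro image_cong) auto
  obtain x where x: "x \<in> L" "\<alpha> x \<notin> L" using assms(8) by blast
  then have xX: "x \<in> X" "\<alpha> x \<in> X" "\<alpha> x \<in> R" using assms(2,6) by (auto simp: bij_betw_def)
  define A where "A = orbit \<sigma> x"
  define B where "B = orbit \<sigma> (\<alpha> x)"
  have A: "A \<in> perm_cycles L \<sigma>" "A \<in> perm_cycles X \<sigma>" using x xX by (auto simp: A_def perm_cycles_def)
  have B: "B \<in> perm_cycles R \<sigma>" "B \<in> perm_cycles X \<sigma>" using x xX by (auto simp: B_def perm_cycles_def)
  have "A \<noteq> B" using A B perm_cycles_disjoint[OF assms(4,5,3)] by auto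
  have "(x, \<alpha> x) \<in> eqcl ?s" using xX by (intro eqcl_base) (auto simp: moves_def)
  then have gAB: "g A = g B" using g xX eqcl_class_eq by (simp add: A_def B_def)
  have im': "g ` (perm_cycles X \<sigma> - {B}) = classes X ?s"
  proof
    show "classes X ?s \<subseteq> g ` (perm_cycles X \<sigma> - {B})"
    proof
      fix D assume "D \<in> classes X ?s"
      then obtain C where C: "C \<in> perm_cycles X \<sigma>" "D = g C" unfolding im by blast
      show "D \<in> g ` (perm_cycles X \<sigma> - {B})"
        using C gAB A(2) \<open>A \<noteq> B\<close> by (cases "C = B") auto
    qed
  qed (use im in auto)
  have fin: "finite (perm_cycles X \<sigma>)" using assms(1) by simp
  have inj: "inj_on g (perm_cycles X \<sigma> - {B})"
    using im' card B(2) fin by (intro eq_card_imp_inj_on) auto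
  have gsub: "g A \<subseteq> A \<union> B"
  proof
    fix y assume "y \<in> g A"
    then have y: "(x, y) \<in> eqcl ?s" using g[OF xX(1)] by (auto simp: A_def)
    then have yX: "y \<in> X" using eqcl_class_in[OF assms(1) xX(1) bij] by blast
    then have D: "orbit \<sigma> y \<in> perm_cycles X \<sigma>" "y \<in> orbit \<sigma> y"
      using self_in_orbit[OF assms(1) \<sigma>] by (auto simp: perm_cycles_def)
    have "g (orbit \<sigma> y) = g A" using g[OF yX] g[OF xX(1)] eqcl_class_eq[OF y] by (simp add: A_def)
    then have "orbit \<sigma> y = B \<or> orbit \<sigma> y = A" using inj D(1) A(2) \<open>A \<noteq> B\<close> by (auto dest: inj_onD)
    then show "y \<in> A \<union> B" using D(2) by auto
  qed
  have "A \<subseteq> g A" "B \<subseteq> g B" by (auto simp: g_def)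
  then have Z: "A \<union> B = eqcl ?s `` {x}" using gsub gAB g[OF xX(1)] by (auto simp: A_def)
  have ZX: "A \<union> B \<subseteq> X" unfolding Z using eqcl_class_in[OF assms(1) xX(1) bij] .
  have "conn (A \<union> B) {\<alpha>, \<sigma>}" by (rule class_conn[OF assms(1) bij Z ZX])
  moreover have "\<alpha> ` (A \<union> B) \<subseteq> A \<union> B" by (rule eqcl_class_invariant[OF _ Z ZX]) simp
  ultimately show ?thesis using A(1) B(1) by blast
qed

text \<open>For \<open>Z\<close> the union of two cycles of \<open>\<sigma>\<close>: annular on \<open>Z\<close>, planar on the rest.\<close>

definition glued :: "'x set \<Rightarrow> ('x \<Rightarrow> 'x) \<Rightarrow> 'x set \<Rightarrow> ('x \<Rightarrow> 'x) set" where
  "glued X \<sigma> Z = {\<alpha>. \<alpha> permutes X \<and> bij_betw \<alpha> Z Z \<and> conn Z {\<alpha>, \<sigma>}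
     \<and> nc Z \<alpha> + nc Z (inv \<alpha> \<circ> \<sigma>) = card Z
     \<and> nc (X - Z) \<alpha> + nc (X - Z) (inv \<alpha> \<circ> \<sigma>) = card (X - Z) + nc (X - Z) \<sigma>}"

lemma conn_cong:
  assumes "\<And>x. x \<in> X \<Longrightarrow> f x = f' x"
  shows "conn X {f, g} \<longleftrightarrow> conn X {f', g}"
proof -
  have "f ` S = f' ` S" if "S \<subseteq> X" for S using assms that by (intro image_cong) auto
  then show ?thesis by (auto simp: conn_def)
qed

lemma bij_betw_glued:
  assumes "finite X" "Z \<subseteq> X" "bij_betw \<sigma> X X" "bij_betw \<sigma> Z Z"
  shows "bij_betw (\<lambda>(a, b). a \<circ> b) (ann Z \<sigma> \<times> geo (X - Z) \<sigma>) (glued X \<sigma> Z)"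
proof -
  have d: "Z \<inter> (X - Z) = {}" and u: "Z \<union> (X - Z) = X" using assms(2) by auto
  have \<sigma>': "bij_betw \<sigma> (X - Z) (X - Z)" using perm_cycles_Diff[OF assms(1,3,2,4)] by simp
  let ?P = "\<lambda>p. case p of (a, b) \<Rightarrow> a \<in> ann Z \<sigma> \<and> b \<in> geo (X - Z) \<sigma>"
  let ?Q = "\<lambda>\<alpha>. conn Z {\<alpha>, \<sigma>} \<and> nc Z \<alpha> + nc Z (inv \<alpha> \<circ> \<sigma>) = card Z
     \<and> nc (X - Z) \<alpha> + nc (X - Z) (inv \<alpha> \<circ> \<sigma>) = card (X - Z) + nc (X - Z) \<sigma>"
  have "bij_betw (\<lambda>(a, b). a \<circ> b) {p \<in> {a. a permutes Z} \<times> {b. b permutes (X - Z)}. ?P p}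
      {\<alpha> \<in> {c. c permutes Z \<union> (X - Z) \<and> bij_betw c Z Z}. ?Q \<alpha>}"
  proof (rule bij_betw_Collect[OF bij_betw_permutes_Un[OF d]])
    fix p assume "p \<in> {a. a permutes Z} \<times> {b. b permutes (X - Z)}"
    then obtain a b where p: "p = (a, b)" "a permutes Z" "b permutes (X - Z)" by auto
    have "conn Z {a \<circ> b, \<sigma>} \<longleftrightarrow> conn Z {a, \<sigma>}"
      by (rule conn_cong) (rule comp_disjoint_eqs(1)[OF d p(2,3)])
    then show "?Q (case p of (a, b) \<Rightarrow> a \<circ> b) \<longleftrightarrow> ?P p"
      using perm_cycles_comp_disjoint[OF d p(2,3) assms(4) \<sigma>'] p by (auto simp: ann_def geo_def)
  qed
  moreover have "{p \<in> {a. a permutes Z} \<times> {b. b permutes (X - Z)}. ?P p} = ann Z \<sigma> \<times> geo (X - Z) \<sigma>"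
    by (auto simp: ann_def geo_def)
  moreover have "{\<alpha> \<in> {c. c permutes Z \<union> (X - Z) \<and> bij_betw c Z Z}. ?Q \<alpha>} = glued X \<sigma> Z"
    unfolding u by (auto simp: glued_def)
  ultimately show ?thesis by simp
qed

text \<open>\<open>L\<close> and \<open>R\<close> are the two circles of the annulus.
  \<open>X\<close> is a parameter with an equation, so that \<open>{1..p+q}\<close> can be inserted
  for it directly.\<close>

locale two_cycles =
  fixes L R X :: "'x set" and \<gamma> :: "'x \<Rightarrow> 'x"
  assumes finite_X: "finite X" and X: "X = L \<union> R" and LR: "L \<inter> R = {}"
    and ne: "L \<noteq> {}" "R \<noteq> {}"
    and bij_L: "bij_betw \<gamma> L L" and bij_R: "bij_betw \<gamma> R R"
    and cycle_L: "perm_cycles L \<gamma> = {L}" and cycle_R: "perm_cycles R \<gamma> = {R}"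
begin

lemma bij_X: "bij_betw \<gamma> X X"
  unfolding X using bij_betw_combine[OF bij_L bij_R LR] .

lemma fin: "finite L" "finite R" using finite_X X by auto

lemma nc_\<gamma>: "nc X \<gamma> = 2"
  using nc_Un[OF fin bij_L bij_R LR] cycle_L cycle_R X by simp

lemma invariant_L_or_R:
  assumes "S \<subseteq> X" "\<gamma> ` S \<subseteq> S" "S \<noteq> {}" "S \<noteq> X"
  shows "S = L \<or> S = R"
proof -
  have *: "T \<inter> C \<in> {{}, C}" if "perm_cycles C \<gamma> = {C}" "\<gamma> ` T \<subseteq> T" "T \<subseteq> X" for T C
  proof (cases "T \<inter> C = {}")
    case False
    then obtain x where x: "x \<in> T" "x \<in> C" by blast
    then have "orbit \<gamma> x = C" using that(1) by (auto simp: perm_cycles_def)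
    moreover have "y \<in> T" if "y \<in> orbit \<gamma> x" for y using that x \<open>\<gamma> ` T \<subseteq> T\<close> by induction auto
    ultimately show ?thesis by auto
  qed simp
  have "S \<inter> L \<in> {{}, L}" "S \<inter> R \<in> {{}, R}" using * cycle_L cycle_R assms by blast+
  moreover have "S = (S \<inter> L) \<union> (S \<inter> R)" using assms(1) X by blast
  ultimately show ?thesis using assms(3,4) X by auto
qed

lemma geo_invariant_LR:
  assumes "\<sigma> \<in> geo X \<gamma>"
  shows "bij_betw \<sigma> L L" "bij_betw \<sigma> R R" "bij_betw \<sigma> X X" "\<sigma> permutes X"
  using geo_invariant[OF finite_X bij_X assms _ bij_L] geo_invariant[OF finite_X bij_X assms _ bij_R] X assms
  by (auto simp: geo_def permutes_imp_bij)

text \<open>\<open>\<alpha>\<close> lies below \<open>\<alpha> \<circ> \<beta>\<close>, which lies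
  below \<open>\<gamma>\<close>. Both therefore preserve the circles, and then so does
  \<open>\<beta>\<close>.\<close>

lemma tri_invariant_LR:
  assumes "(\<alpha>, \<beta>) \<in> tri X \<gamma>"
  shows "\<alpha> \<in> geo X \<gamma>" "bij_betw \<alpha> L L" "bij_betw \<alpha> R R" "bij_betw \<beta> L L" "bij_betw \<beta> R R"
    "\<alpha> permutes X" "\<beta> permutes X"
proof -
  have p: "\<alpha> permutes X" "\<beta> permutes X" using assms by (auto simp: tri_def)
  then show "\<alpha> permutes X" "\<beta> permutes X" .
  have \<sigma>: "\<alpha> \<circ> \<beta> \<in> geo X \<gamma>" "\<alpha> \<in> geo X (\<alpha> \<circ> \<beta>)"
    using tri_iff[OF finite_X bij_X p] assms by auto
  then show \<alpha>: "\<alpha> \<in> geo X \<gamma>" using geo_trans[OF finite_X _ _ bij_X] by blast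
  note a = geo_invariant_LR[OF \<alpha>] and s = geo_invariant_LR[OF \<sigma>(1)]
  show "bij_betw \<alpha> L L" "bij_betw \<alpha> R R" using a by auto
  have b: "bij_betw \<beta> C C" if C: "bij_betw \<alpha> C C" "bij_betw (\<alpha> \<circ> \<beta>) C C" "C \<subseteq> X" for C
  proof -
    have "\<beta> ` C \<subseteq> C"
      by (rule right_factor_image[OF p(1) C(1)]) (use C(2) in \<open>auto simp: bij_betw_def\<close>)
    moreover have "finite C" using C(3) finite_X finite_subset by blast
    ultimately show ?thesis
      using bij_betw_invariant[OF _ C(3) permutes_imp_bij[OF p(2)]] by blast
  qed
  show "bij_betw \<beta> L L" "bij_betw \<beta> R R" using b a s X by auto
qed

context
  fixes \<sigma> A B
  assumes \<sigma>: "bij_betw \<sigma> L L" "bij_betw \<sigma> R R" and A: "A \<in> perm_cycles L \<sigma>" and B: "B \<in> perm_cycles R \<sigma>"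
begin

lemma AB_facts:
  shows "bij_betw \<sigma> X X" "A \<subseteq> L" "B \<subseteq> R" "A \<noteq> {}" "B \<noteq> {}" "A \<inter> B = {}" "A \<union> B \<subseteq> X"
    "bij_betw \<sigma> A A" "bij_betw \<sigma> B B" "bij_betw \<sigma> (A \<union> B) (A \<union> B)" "nc (A \<union> B) \<sigma> = 2"
    "perm_cycles (A \<union> B) \<sigma> = {A, B}" "(A \<union> B) \<inter> L = A" "(A \<union> B) \<inter> R = B"
    "bij_betw \<sigma> (X - (A \<union> B)) (X - (A \<union> B))" "perm_cycles (X - (A \<union> B)) \<sigma> = perm_cycles X \<sigma> - {A, B}"
    "finite A" "finite B" "A \<noteq> B"
proof -
  show b: "bij_betw \<sigma> X X" unfolding X using bij_betw_combine[OF \<sigma> LR] .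
  show AL: "A \<subseteq> L" "B \<subseteq> R" using perm_cycles_subset \<sigma> A B by auto
  show n: "A \<noteq> {}" "B \<noteq> {}" using perm_cycles_nonempty A B by auto
  show d: "A \<inter> B = {}" using AL LR by auto
  then show "A \<noteq> B" using n by auto
  show ABX: "A \<union> B \<subseteq> X" using AL X by auto
  note cA = cycle_perm_cycles[OF fin(1) \<sigma>(1) A] and cB = cycle_perm_cycles[OF fin(2) \<sigma>(2) B]
  show bA: "bij_betw \<sigma> A A" "bij_betw \<sigma> B B" using cA cB by auto
  show bAB: "bij_betw \<sigma> (A \<union> B) (A \<union> B)" using bij_betw_combine[OF bA d] .
  show "perm_cycles (A \<union> B) \<sigma> = {A, B}" using cA cB by (auto simp: perm_cycles_Un)
  then show "nc (A \<union> B) \<sigma> = 2" using \<open>A \<noteq> B\<close> by simp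
  show "(A \<union> B) \<inter> L = A" "(A \<union> B) \<inter> R = B" using AL LR by auto
  show "bij_betw \<sigma> (X - (A \<union> B)) (X - (A \<union> B))" "perm_cycles (X - (A \<union> B)) \<sigma> = perm_cycles X \<sigma> - {A, B}"
    using perm_cycles_Diff[OF finite_X b ABX bAB] \<open>perm_cycles (A \<union> B) \<sigma> = {A, B}\<close> by auto
  show "finite A" "finite B" using AL fin finite_subset by blast+
qed

lemma glued_cycle:
  assumes "\<alpha> \<in> glued X \<sigma> (A \<union> B)" "C \<in> perm_cycles X \<sigma>" "C \<noteq> A" "C \<noteq> B"
  shows "\<alpha> ` C \<subseteq> C"
proof -
  note F = AB_facts
  let ?Z = "A \<union> B"
  have "\<alpha> \<in> (\<lambda>(a, b). a \<circ> b) ` (ann ?Z \<sigma> \<times> geo (X - ?Z) \<sigma>)"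
    using assms(1) bij_betw_imp_surj_on[OF bij_betw_glued[OF finite_X F(7,1,10)]] by simp
  then obtain a b where ab: "a \<in> ann ?Z \<sigma>" "b \<in> geo (X - ?Z) \<sigma>" "\<alpha> = a \<circ> b" by auto
  have C: "C \<in> perm_cycles (X - ?Z) \<sigma>" using assms F(16) by simp
  then have CY: "C \<subseteq> X - ?Z" using perm_cycles_subset[OF F(15)] by auto
  have "b ` C = C" using geo_cycle[OF _ F(15) ab(2) C] finite_X by simp
  moreover have "\<alpha> x = b x" if "x \<in> C" for x
    using comp_disjoint_eqs(2)[of ?Z "X - ?Z" a b x] ab that CY by (auto simp: ann_def geo_def)
  ultimately show ?thesis by auto
qed

text \<open>Connectedness of \<open>\<alpha>\<close> and \<open>\<sigma>\<close> on
  \<open>A \<union> B\<close> excludes that \<open>\<alpha>\<close> preserves one of the two cycles.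
  Together with \<open>glued_cycle\<close> this recovers \<open>A\<close> and \<open>B\<close> from
  \<open>\<alpha>\<close> as the only cycles of \<open>\<sigma>\<close> that it does not
  preserve.\<close>

lemma glued_not_invariant:
  assumes "\<alpha> \<in> glued X \<sigma> (A \<union> B)"
  shows "\<not> \<alpha> ` A \<subseteq> A" "\<not> \<alpha> ` B \<subseteq> B"
proof -
  note F = AB_facts
  have c: "conn (A \<union> B) {\<alpha>, \<sigma>}" using assms by (simp add: glued_def)
  have "\<sigma> ` A \<subseteq> A" "\<sigma> ` B \<subseteq> B" using F(8,9) by (auto simp: bij_betw_def)
  then have "\<alpha> ` A \<subseteq> A \<Longrightarrow> A = {} \<or> A = A \<union> B" "\<alpha> ` B \<subseteq> B \<Longrightarrow> B = {} \<or> B = A \<union> B"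
    by (metis c connD insertE singletonD sup_ge1, metis c connD insertE singletonD sup_ge2)
  then show "\<not> \<alpha> ` A \<subseteq> A" "\<not> \<alpha> ` B \<subseteq> B"
    using F(4,5,6) by blast+
qed

lemma nc_glue:
  assumes "bij_betw f (A \<union> B) (A \<union> B)" "bij_betw f X X"
  shows "nc X f = nc (A \<union> B) f + nc (X - (A \<union> B)) f"
proof -
  note F = AB_facts
  have "bij_betw f (X - (A \<union> B)) (X - (A \<union> B))" using perm_cycles_Diff[OF finite_X assms(2) F(7) assms(1)] by simp
  moreover have "A \<union> B \<union> (X - (A \<union> B)) = X" using F(7) by auto
  ultimately show ?thesis using nc_Un[of "A \<union> B" "X - (A \<union> B)" f] assms(1) F(17,18) finite_X by simp
qed

end

definition glued_all :: "('x \<Rightarrow> 'x) \<Rightarrow> ('x \<Rightarrow> 'x) set" where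
  "glued_all \<sigma> = (\<Union>(A, B)\<in>perm_cycles L \<sigma> \<times> perm_cycles R \<sigma>. glued X \<sigma> (A \<union> B))"

lemma finite_glued: "finite (glued X \<sigma> Z)"
  by (rule finite_subset[OF _ finite_permutations[OF finite_X]]) (auto simp: glued_def)

text \<open>The union in \<open>glued_all\<close> is disjoint, since \<open>\<alpha>\<close>
  determines the pair \<open>(A, B)\<close>; each piece factors into an annular and a planar
  part.\<close>

lemma sum_glued_all:
  assumes \<sigma>: "bij_betw \<sigma> L L" "bij_betw \<sigma> R R"
  shows "(\<Sum>\<alpha>\<in>glued_all \<sigma>. F \<alpha>) = (\<Sum>A\<in>perm_cycles L \<sigma>. \<Sum>B\<in>perm_cycles R \<sigma>.
     \<Sum>a\<in>ann (A \<union> B) \<sigma>. \<Sum>b\<in>geo (X - (A \<union> B)) \<sigma>. F (a \<circ> b))"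
proof -
  let ?I = "perm_cycles L \<sigma> \<times> perm_cycles R \<sigma>"
  have disj: "glued X \<sigma> (A \<union> B) \<inter> glued X \<sigma> (A' \<union> B') = {}"
    if AB: "A \<in> perm_cycles L \<sigma>" "B \<in> perm_cycles R \<sigma>" "A' \<in> perm_cycles L \<sigma>" "B' \<in> perm_cycles R \<sigma>" "(A, B) \<noteq> (A', B')" for A B A' B'
  proof (rule ccontr)
    assume "glued X \<sigma> (A \<union> B) \<inter> glued X \<sigma> (A' \<union> B') \<noteq> {}"
    then obtain \<alpha> where \<alpha>: "\<alpha> \<in> glued X \<sigma> (A \<union> B)" "\<alpha> \<in> glued X \<sigma> (A' \<union> B')" by blast
    have cX: "A \<in> perm_cycles X \<sigma>" "B \<in> perm_cycles X \<sigma>" using AB X by (auto simp: perm_cycles_Un)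
    have "A \<noteq> B'" "B \<noteq> A'" using AB perm_cycles_disjoint[OF \<sigma> LR] by auto
    then show False
      using AB(5) glued_cycle[OF \<sigma> AB(3,4) \<alpha>(2) cX(1)] glued_cycle[OF \<sigma> AB(3,4) \<alpha>(2) cX(2)]
        glued_not_invariant[OF \<sigma> AB(1,2) \<alpha>(1)] by auto
  qed
  have "(\<Sum>\<alpha>\<in>glued_all \<sigma>. F \<alpha>) = (\<Sum>p\<in>?I. \<Sum>\<alpha>\<in>(case p of (A, B) \<Rightarrow> glued X \<sigma> (A \<union> B)). F \<alpha>)"
    unfolding glued_all_def using fin finite_glued disj by (intro sum.UNION_disjoint) auto
  also have "\<dots> = (\<Sum>A\<in>perm_cycles L \<sigma>. \<Sum>B\<in>perm_cycles R \<sigma>. \<Sum>\<alpha>\<in>glued X \<sigma> (A \<union> B). F \<alpha>)"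
    by (simp add: sum.cartesian_product split_def)
  also have "\<dots> = (\<Sum>A\<in>perm_cycles L \<sigma>. \<Sum>B\<in>perm_cycles R \<sigma>.
     \<Sum>a\<in>ann (A \<union> B) \<sigma>. \<Sum>b\<in>geo (X - (A \<union> B)) \<sigma>. F (a \<circ> b))"
  proof (rule sum.cong[OF refl], rule sum.cong[OF refl])
    fix A B assume "A \<in> perm_cycles L \<sigma>" "B \<in> perm_cycles R \<sigma>"
    note F = AB_facts[OF \<sigma> this]
    have "(\<Sum>\<alpha>\<in>glued X \<sigma> (A \<union> B). F \<alpha>) = (\<Sum>p\<in>ann (A \<union> B) \<sigma> \<times> geo (X - (A \<union> B)) \<sigma>. F (case p of (a, b) \<Rightarrow> a \<circ> b))"
      by (rule sum.reindex_bij_betw[OF bij_betw_glued[OF finite_X F(7,1,10)], symmetric])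
    then show "(\<Sum>\<alpha>\<in>glued X \<sigma> (A \<union> B). F \<alpha>) = (\<Sum>a\<in>ann (A \<union> B) \<sigma>. \<Sum>b\<in>geo (X - (A \<union> B)) \<sigma>. F (a \<circ> b))"
      by (simp add: sum.cartesian_product split_def)
  qed
  finally show ?thesis .
qed

text \<open>If \<open>\<sigma> = \<alpha> \<circ> \<beta>\<close> connects the circles, then
  \<open>nc X \<sigma> + nc X (inv \<sigma> \<circ> \<gamma>)\<close> is at most
  \<open>card X\<close>, and the triangle inequality bounds
  \<open>nc X \<alpha> + nc X \<beta>\<close>. The two bounds sum to the equation in
  \<open>tri2\<close>, so both are attained; in particular \<open>\<alpha>\<close> is planar
  relative to \<open>\<sigma>\<close>.\<close>

lemma tri2_conn:
  assumes "\<alpha> permutes X" "\<beta> permutes X" "conn X {\<alpha> \<circ> \<beta>, \<gamma>}"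
  shows "(\<alpha>, \<beta>) \<in> tri2 X \<gamma> \<longleftrightarrow> \<alpha> \<circ> \<beta> \<in> ann X \<gamma> \<and> \<alpha> \<in> geo X (\<alpha> \<circ> \<beta>)"
proof -
  let ?\<sigma> = "\<alpha> \<circ> \<beta>"
  have p: "?\<sigma> permutes X" using assms permutes_compose by blast
  have c: "conn X {\<alpha>, \<beta>, \<gamma>}"
  proof (rule connI)
    fix S assume S: "S \<subseteq> X" "\<And>f. f \<in> {\<alpha>, \<beta>, \<gamma>} \<Longrightarrow> f ` S \<subseteq> S"
    then have "\<alpha> ` S \<subseteq> S" "\<beta> ` S \<subseteq> S" "\<gamma> ` S \<subseteq> S" by auto
    moreover have "(\<alpha> \<circ> \<beta>) ` S \<subseteq> S" using calculation by (auto simp: image_subset_iff)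
    ultimately show "S = {} \<or> S = X" by (intro connD[OF assms(3) S(1)]) auto
  qed
  have "X \<noteq> {}" using X ne by auto
  then have "card (classes X (moves X {?\<sigma>, \<gamma>})) = 1"
    using conn_classes[OF finite_X _ _ assms(3)] bij_X permutes_imp_bij[OF p] by force
  then have "nc X ?\<sigma> + nc X (inv ?\<sigma> \<circ> \<gamma>) \<le> card X"
    using genus_inv[OF finite_X p bij_X] nc_\<gamma> by simp
  moreover have "nc X \<alpha> + nc X \<beta> \<le> card X + nc X ?\<sigma>"
    using nc_triangle(1)[OF finite_X] assms permutes_imp_bij by blast
  ultimately show ?thesis
    using c p assms by (auto simp: tri2_def ann_def geo_def inv_comp_permutes[OF assms(1,2)] inv_comp_comp)
qed

text \<open>If \<open>\<sigma> = \<alpha> \<circ> \<beta>\<close> does not connect the circles, its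
  own bound is \<open>card X + 2\<close>, so the deficit of two is due to \<open>\<alpha>\<close>
  and \<open>\<beta>\<close>: they fuse exactly one cycle of \<open>\<sigma>\<close> on
  \<open>L\<close> with one on \<open>R\<close>. Conversely, such a fusion connects the
  circles.\<close>

lemma tri2_not_conn:
  assumes p: "\<alpha> permutes X" "\<beta> permutes X"
  shows "(\<alpha>, \<beta>) \<in> tri2 X \<gamma> \<and> \<not> conn X {\<alpha> \<circ> \<beta>, \<gamma>} \<longleftrightarrow> \<alpha> \<circ> \<beta> \<in> geo X \<gamma> \<and> \<alpha> \<in> glued_all (\<alpha> \<circ> \<beta>)"
proof -
  define \<sigma> where "\<sigma> = \<alpha> \<circ> \<beta>"
  have q: "\<sigma> permutes X" unfolding \<sigma>_def using p permutes_compose by blast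
  have b: "bij_betw \<alpha> X X" "bij_betw \<beta> X X" "bij_betw \<sigma> X X" using p q permutes_imp_bij by auto
  have \<beta>: "inv \<alpha> \<circ> \<sigma> = \<beta>" unfolding \<sigma>_def by (rule inv_comp_comp[OF p(1)])
  have \<delta>: "inv \<beta> \<circ> inv \<alpha> \<circ> \<gamma> = inv \<sigma> \<circ> \<gamma>" unfolding \<sigma>_def by (simp add: inv_comp_permutes[OF p])
  show ?thesis unfolding \<sigma>_def[symmetric]
  proof
    assume "(\<alpha>, \<beta>) \<in> tri2 X \<gamma> \<and> \<not> conn X {\<sigma>, \<gamma>}"
    then have conn3: "conn X {\<alpha>, \<beta>, \<gamma>}" and num: "nc X \<alpha> + nc X \<beta> + nc X (inv \<sigma> \<circ> \<gamma>) = 2 * card X"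
      and "\<not> conn X {\<sigma>, \<gamma>}" by (auto simp: tri2_def \<delta>)
    then obtain S where S: "S \<subseteq> X" "\<sigma> ` S \<subseteq> S" "\<gamma> ` S \<subseteq> S" "S \<noteq> {}" "S \<noteq> X" by (auto simp: conn_def)
    then have SLR: "S = L \<or> S = R" by (intro invariant_L_or_R)
    have "bij_betw \<sigma> S S" using bij_betw_invariant[OF _ S(1) b(3) S(2)] finite_X finite_subset S(1) by blast
    then have "bij_betw \<sigma> S S" "bij_betw \<sigma> (X - S) (X - S)" using perm_cycles_Diff[OF finite_X b(3) S(1)] by auto
    moreover have "X - L = R" "X - R = L" using X LR by auto
    ultimately have \<sigma>LR: "bij_betw \<sigma> L L" "bij_betw \<sigma> R R" using SLR by auto
    let ?c = "card (classes X (moves X {\<alpha>, \<sigma>}))"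
    have tri: "nc X \<sigma> + nc X (inv \<sigma> \<circ> \<gamma>) \<le> card X + 2" using nc_inv_triangle[OF finite_X q bij_X] nc_\<gamma> by simp
    have gen: "nc X \<alpha> + nc X \<beta> + nc X \<sigma> \<le> card X + 2 * ?c" using genus_inv[OF finite_X p(1) b(3)] \<beta> by simp
    have sub: "moves X {\<sigma>} \<subseteq> eqcl (moves X {\<alpha>, \<sigma>})" by (auto simp: moves_def intro: eqcl_base)
    have cyc: "perm_cycles X \<sigma> = classes X (moves X {\<sigma>})" by (rule perm_cycles_eq_classes[OF finite_X b(3)])
    have le: "?c \<le> nc X \<sigma>" unfolding cyc by (rule card_classes_mono[OF finite_X sub])
    \<comment> \<open>If \<open>\<alpha>\<close> preserved \<open>L\<close>, so would
      \<open>\<beta>\<close>, because \<open>\<sigma>\<close> does; this contradicts the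
      connectedness of the three permutations.\<close>
    have \<alpha>L: "\<not> \<alpha> ` L \<subseteq> L"
    proof
      assume *: "\<alpha> ` L \<subseteq> L"
      then have \<alpha>L: "bij_betw \<alpha> L L" using bij_betw_invariant[OF fin(1) _ b(1)] X by auto
      have "\<beta> ` L \<subseteq> L"
        by (rule right_factor_image[OF p(1) \<alpha>L]) (use \<sigma>LR(1) in \<open>auto simp: \<sigma>_def bij_betw_def\<close>)
      moreover have "\<gamma> ` L \<subseteq> L" using bij_L by (auto simp: bij_betw_def)
      ultimately have "L = {} \<or> L = X" using * X by (intro connD[OF conn3]) auto
      then show False using ne X LR by auto
    qed
    \<comment> \<open>With equality every cycle of \<open>\<sigma>\<close> would be preserved by
      \<open>\<alpha>\<close>, and hence \<open>L\<close>.\<close>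
    have "?c \<noteq> nc X \<sigma>"
    proof
      assume eq: "?c = nc X \<sigma>"
      have "\<alpha> x \<in> L" if x: "x \<in> L" for x
      proof -
        have xX: "x \<in> X" "\<alpha> x \<in> X" using x X b(1) by (auto simp: bij_betw_def)
        then have "(x, \<alpha> x) \<in> eqcl (moves X {\<alpha>, \<sigma>})" by (auto simp: moves_def intro: eqcl_base)
        then have "(x, \<alpha> x) \<in> eqcl (moves X {\<sigma>})"
          using card_classes_mono(2)[OF finite_X sub _ xX] eq cyc by simp
        moreover have "eqcl (moves X {\<sigma>}) `` {x} \<subseteq> L"
          using x fin X b(3) \<sigma>LR(1) by (intro moves_class_subset) (auto simp: bij_betw_def)
        ultimately show ?thesis by auto
      qed
      then show False using \<alpha>L by auto
    qed
    \<comment> \<open>The bounds \<open>tri\<close> and \<open>gen\<close> leave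
      \<open>nc X \<sigma> \<le> ?c + 1\<close>. Since \<open>?c\<close> is smaller than
      \<open>nc X \<sigma>\<close>, both bounds are attained.\<close>
    then have c: "?c + 1 = nc X \<sigma>" and \<sigma>geo: "nc X \<sigma> + nc X (inv \<sigma> \<circ> \<gamma>) = card X + 2"
      and n\<alpha>: "nc X \<alpha> + nc X \<beta> + 2 = card X + nc X \<sigma>"
      using le gen tri num by linarith+
    have g: "\<sigma> \<in> geo X \<gamma>" using q \<sigma>geo nc_\<gamma> by (simp add: geo_def)
    obtain A B where AB: "A \<in> perm_cycles L \<sigma>" "B \<in> perm_cycles R \<sigma>" "conn (A \<union> B) {\<alpha>, \<sigma>}" "\<alpha> ` (A \<union> B) \<subseteq> A \<union> B"
      using merged_cycles[OF finite_X X LR \<sigma>LR b(1) c \<alpha>L] by blast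
    note F = AB_facts[OF \<sigma>LR AB(1,2)]
    let ?Z = "A \<union> B" and ?Y = "X - (A \<union> B)"
    have fZ: "finite ?Z" "finite ?Y" "?Z \<noteq> {}" using F finite_X by auto
    have \<alpha>Z: "bij_betw \<alpha> ?Z ?Z" using bij_betw_invariant[OF fZ(1) F(7) b(1) AB(4)] .
    have \<beta>Z: "bij_betw \<beta> ?Z ?Z"
    proof -
      have "\<beta> ` ?Z \<subseteq> ?Z"
        by (rule right_factor_image[OF p(1) \<alpha>Z]) (use F(10) in \<open>simp add: \<sigma>_def bij_betw_def\<close>)
      then show ?thesis using bij_betw_invariant[OF fZ(1) F(7) b(2)] by blast
    qed
    have \<alpha>Y: "bij_betw \<alpha> ?Y ?Y" "bij_betw \<beta> ?Y ?Y"
      using perm_cycles_Diff[OF finite_X b(1) F(7) \<alpha>Z] perm_cycles_Diff[OF finite_X b(2) F(7) \<beta>Z] by auto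
    \<comment> \<open>On \<open>?Z\<close> the bound is the annular one, because
      \<open>\<sigma>\<close> has two cycles there and is connected by \<open>\<alpha>\<close>; on
      \<open>?Y\<close> it is the planar one. Their sum is the known total, so both are
      attained.\<close>
    have "nc ?Z \<alpha> + nc ?Z \<beta> \<le> card ?Z"
      using genus_conn[OF fZ(1,3) \<alpha>Z \<beta>Z] AB(3) F(11) by (simp add: \<sigma>_def)
    moreover have "nc ?Y \<alpha> + nc ?Y \<beta> \<le> card ?Y + nc ?Y \<sigma>"
      using nc_triangle(1)[OF fZ(2) \<alpha>Y] by (simp add: \<sigma>_def)
    moreover have "card X = card ?Z + card ?Y"
      using F(7) fZ finite_X by (metis card_Diff_subset card_mono le_add_diff_inverse)
    ultimately have "nc ?Z \<alpha> + nc ?Z \<beta> = card ?Z" "nc ?Y \<alpha> + nc ?Y \<beta> = card ?Y + nc ?Y \<sigma>"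
      using nc_glue[OF \<sigma>LR AB(1,2) \<alpha>Z b(1)] nc_glue[OF \<sigma>LR AB(1,2) \<beta>Z b(2)] nc_glue[OF \<sigma>LR AB(1,2) F(10) b(3)] n\<alpha> F(11)
      by linarith+
    then have "\<alpha> \<in> glued X \<sigma> ?Z" using p(1) \<alpha>Z AB(3) \<beta> by (simp add: glued_def)
    then show "\<sigma> \<in> geo X \<gamma> \<and> \<alpha> \<in> glued_all \<sigma>" using g AB(1,2) by (auto simp: glued_all_def)
  next
    assume *: "\<sigma> \<in> geo X \<gamma> \<and> \<alpha> \<in> glued_all \<sigma>"
    then obtain A B where AB: "A \<in> perm_cycles L \<sigma>" "B \<in> perm_cycles R \<sigma>" and gl: "\<alpha> \<in> glued X \<sigma> (A \<union> B)"
      by (auto simp: glued_all_def)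
    note \<sigma>LR = geo_invariant_LR[OF conjunct1[OF *]]
    note F = AB_facts[OF \<sigma>LR(1,2) AB]
    let ?Z = "A \<union> B" and ?Y = "X - (A \<union> B)"
    have \<alpha>Z: "bij_betw \<alpha> ?Z ?Z" using gl by (simp add: glued_def)
    have \<beta>Z: "bij_betw \<beta> ?Z ?Z"
    proof -
      have "\<beta> ` ?Z \<subseteq> ?Z"
        by (rule right_factor_image[OF p(1) \<alpha>Z]) (use F(10) in \<open>simp add: \<sigma>_def bij_betw_def\<close>)
      then show ?thesis using bij_betw_invariant[OF _ F(7) b(2)] F(17,18) by blast
    qed
    have "card X = card ?Z + card ?Y"
      using F(7,17,18) finite_X by (metis card_Diff_subset card_mono finite_UnI le_add_diff_inverse)
    then have "nc X \<alpha> + nc X \<beta> + 2 = card X + nc X \<sigma>"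
      using nc_glue[OF \<sigma>LR(1,2) AB \<alpha>Z b(1)] nc_glue[OF \<sigma>LR(1,2) AB \<beta>Z b(2)] nc_glue[OF \<sigma>LR(1,2) AB F(10) b(3)] gl F(11)
      unfolding glued_def by (simp add: \<beta>)
    then have num: "nc X \<alpha> + nc X \<beta> + nc X (inv \<sigma> \<circ> \<gamma>) = 2 * card X"
      using * nc_\<gamma> by (simp add: geo_def)
    \<comment> \<open>A proper invariant set is one of the circles and meets \<open>?Z\<close> in
      \<open>A\<close> or in \<open>B\<close>, which \<open>\<alpha>\<close> does not
      preserve.\<close>
    have "conn X {\<alpha>, \<beta>, \<gamma>}"
    proof (rule connI)
      fix S assume S: "S \<subseteq> X" "\<And>f. f \<in> {\<alpha>, \<beta>, \<gamma>} \<Longrightarrow> f ` S \<subseteq> S"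
      show "S = {} \<or> S = X"
      proof (rule ccontr)
        assume "\<not> (S = {} \<or> S = X)"
        then have "S = L \<or> S = R" using S by (intro invariant_L_or_R) auto
        moreover have "\<alpha> ` S \<subseteq> S" "\<alpha> ` ?Z \<subseteq> ?Z" using S \<alpha>Z by (auto simp: bij_betw_def)
        then have "\<alpha> ` (?Z \<inter> S) \<subseteq> ?Z \<inter> S" by blast
        ultimately show False using glued_not_invariant[OF \<sigma>LR(1,2) AB gl] F(13,14) by metis
      qed
    qed
    moreover have "\<not> conn X {\<sigma>, \<gamma>}"
    proof
      assume "conn X {\<sigma>, \<gamma>}"
      then have "L = {} \<or> L = X" using \<sigma>LR bij_L X by (intro connD[of X "{\<sigma>, \<gamma>}"]) (auto simp: bij_betw_def)
      then show False using ne X LR by auto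
    qed
    ultimately show "(\<alpha>, \<beta>) \<in> tri2 X \<gamma> \<and> \<not> conn X {\<sigma>, \<gamma>}" using p num by (simp add: tri2_def \<delta>)
  qed
qed

lemma sum_tri2:
  "(\<Sum>(\<alpha>, \<beta>)\<in>tri2 X \<gamma>. F \<alpha> \<beta>) =
    (\<Sum>\<sigma>\<in>ann X \<gamma>. \<Sum>\<alpha>\<in>geo X \<sigma>. F \<alpha> (inv \<alpha> \<circ> \<sigma>)) +
    (\<Sum>\<sigma>\<in>geo X \<gamma>. \<Sum>A\<in>perm_cycles L \<sigma>. \<Sum>B\<in>perm_cycles R \<sigma>.
       \<Sum>a\<in>ann (A \<union> B) \<sigma>. \<Sum>b\<in>geo (X - (A \<union> B)) \<sigma>. F (a \<circ> b) (inv (a \<circ> b) \<circ> \<sigma>))"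
proof -
  let ?C = "\<lambda>p. case p of (\<alpha>, \<beta>) \<Rightarrow> conn X {\<alpha> \<circ> \<beta>, \<gamma>}"
  have fin2: "finite (tri2 X \<gamma>)"
    by (rule finite_subset[of _ "{\<alpha>. \<alpha> permutes X} \<times> {\<beta>. \<beta> permutes X}"])
      (auto simp: tri2_def finite_permutations finite_X)
  have "(\<Sum>p\<in>tri2 X \<gamma>. case p of (\<alpha>, \<beta>) \<Rightarrow> F \<alpha> \<beta>) =
      (\<Sum>p\<in>{p\<in>tri2 X \<gamma>. ?C p}. case p of (\<alpha>, \<beta>) \<Rightarrow> F \<alpha> \<beta>) + (\<Sum>p\<in>{p\<in>tri2 X \<gamma>. \<not> ?C p}. case p of (\<alpha>, \<beta>) \<Rightarrow> F \<alpha> \<beta>)"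
    using fin2 by (subst sum.union_disjoint[symmetric]) (auto intro: sum.cong)
  also have "{p\<in>tri2 X \<gamma>. ?C p} = {p. fst p permutes X \<and> snd p permutes X \<and> (p \<in> tri2 X \<gamma> \<and> ?C p)}"
    by (auto simp: tri2_def)
  also have "(\<Sum>(\<alpha>, \<beta>)\<in>\<dots>. F \<alpha> \<beta>) = (\<Sum>\<sigma>\<in>ann X \<gamma>. \<Sum>\<alpha>\<in>geo X \<sigma>. F \<alpha> (inv \<alpha> \<circ> \<sigma>))"
  proof (rule sum_factorizations[OF finite_X])
    fix \<alpha> \<beta> assume p: "\<alpha> permutes X" "\<beta> permutes X"
    show "((\<alpha>, \<beta>) \<in> tri2 X \<gamma> \<and> (case (\<alpha>, \<beta>) of (\<alpha>, \<beta>) \<Rightarrow> conn X {\<alpha> \<circ> \<beta>, \<gamma>})) \<longleftrightarrow> \<alpha> \<circ> \<beta> \<in> ann X \<gamma> \<and> \<alpha> \<in> geo X (\<alpha> \<circ> \<beta>)"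
      using tri2_conn[OF p] by (auto simp: ann_def)
  qed (auto simp: ann_def geo_def)
  also have "{p\<in>tri2 X \<gamma>. \<not> ?C p} = {p. fst p permutes X \<and> snd p permutes X \<and> (p \<in> tri2 X \<gamma> \<and> \<not> ?C p)}"
    by (auto simp: tri2_def)
  also have "(\<Sum>(\<alpha>, \<beta>)\<in>\<dots>. F \<alpha> \<beta>) = (\<Sum>\<sigma>\<in>geo X \<gamma>. \<Sum>\<alpha>\<in>glued_all \<sigma>. F \<alpha> (inv \<alpha> \<circ> \<sigma>))"
  proof (rule sum_factorizations[OF finite_X])
    fix \<alpha> \<beta> assume p: "\<alpha> permutes X" "\<beta> permutes X"
    show "((\<alpha>, \<beta>) \<in> tri2 X \<gamma> \<and> \<not> (case (\<alpha>, \<beta>) of (\<alpha>, \<beta>) \<Rightarrow> conn X {\<alpha> \<circ> \<beta>, \<gamma>})) \<longleftrightarrow> \<alpha> \<circ> \<beta> \<in> geo X \<gamma> \<and> \<alpha> \<in> glued_all (\<alpha> \<circ> \<beta>)"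
      using tri2_not_conn[OF p] by simp
  qed (auto simp: geo_def glued_all_def glued_def)
  also have "\<dots> = (\<Sum>\<sigma>\<in>geo X \<gamma>. \<Sum>A\<in>perm_cycles L \<sigma>. \<Sum>B\<in>perm_cycles R \<sigma>.
       \<Sum>a\<in>ann (A \<union> B) \<sigma>. \<Sum>b\<in>geo (X - (A \<union> B)) \<sigma>. F (a \<circ> b) (inv (a \<circ> b) \<circ> \<sigma>))"
    by (intro sum.cong refl sum_glued_all geo_invariant_LR)
  finally show ?thesis .
qed

end

section \<open>Second order convolution\<close>

definition conv_ann :: "(nat \<Rightarrow> complex) \<Rightarrow> (nat \<Rightarrow> complex) \<Rightarrow> 'x set \<Rightarrow> ('x \<Rightarrow> 'x) \<Rightarrow> complex" where
  "conv_ann f g X \<sigma> = (\<Sum>\<alpha>\<in>ann X \<sigma>. wt f (perm_cycles X \<alpha>) * wt g (perm_cycles X (inv \<alpha> \<circ> \<sigma>)))"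

text \<open>The contribution of one planar permutation to the \<open>S_NC'\<close> part of the
  second order moment: one cycle on each circle is chosen to be merged and carries
  \<open>f2\<close>, the others carry \<open>f\<close>.\<close>

definition pair_wt ::
  "(nat \<Rightarrow> complex) \<Rightarrow> (nat \<Rightarrow> nat \<Rightarrow> complex) \<Rightarrow> 'x set \<Rightarrow> 'x set \<Rightarrow> 'x set \<Rightarrow> ('x \<Rightarrow> 'x) \<Rightarrow> complex" where
  "pair_wt f f2 X L R \<alpha> = (\<Sum>U\<in>perm_cycles L \<alpha>. \<Sum>V\<in>perm_cycles R \<alpha>.
     f2 (card U) (card V) * wt f (perm_cycles X \<alpha> - {U, V}))"

text \<open>Here the merged pair lies in \<open>\<alpha>\<close>, in \<open>conv_right\<close> it
  lies in the complement; these give the second and the third sum of the theorem.\<close>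

definition conv_left where
  "conv_left f f2 g X L R \<sigma> = (\<Sum>\<alpha>\<in>geo X \<sigma>. pair_wt f f2 X L R \<alpha> * wt g (perm_cycles X (inv \<alpha> \<circ> \<sigma>)))"

definition conv_right where
  "conv_right f g g2 X L R \<sigma> = (\<Sum>\<alpha>\<in>geo X \<sigma>. wt f (perm_cycles X \<alpha>) * pair_wt g g2 X L R (inv \<alpha> \<circ> \<sigma>))"

definition conv2 where
  "conv2 f f2 g g2 X L R \<sigma> = conv_ann f g X \<sigma> + conv_left f f2 g X L R \<sigma> + conv_right f g g2 X L R \<sigma>"

text \<open>The claimed value of the second order cumulant of a product, in terms of permutations of
  the two circles.\<close>

definition prod_kappa2 where
  "prod_kappa2 f f2 g g2 n m = conv2 f f2 g g2 {1..n+m} {1..n} {n+1..n+m} (annular_gamma n m)"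

lemma conn_relabel:
  assumes "inj_on h X" "f ` X \<subseteq> X" "g ` X \<subseteq> X"
    "\<And>x. x \<in> X \<Longrightarrow> f' (h x) = h (f x)" "\<And>x. x \<in> X \<Longrightarrow> g' (h x) = h (g x)"
  shows "conn (h ` X) {f', g'} \<longleftrightarrow> conn X {f, g}"
proof
  assume c: "conn (h ` X) {f', g'}"
  show "conn X {f, g}"
  proof (rule connI)
    fix S assume S: "S \<subseteq> X" "\<And>k. k \<in> {f, g} \<Longrightarrow> k ` S \<subseteq> S"
    have "f ` S \<subseteq> S" "g ` S \<subseteq> S" using S(2) by auto
    moreover have "f' ` h ` S = h ` f ` S" "g' ` h ` S = h ` g ` S"
      unfolding image_image using assms(4,5) S(1) by (intro image_cong; blast)+
    ultimately have "f' ` h ` S \<subseteq> h ` S" "g' ` h ` S \<subseteq> h ` S" by (simp_all add: image_mono)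
    then have "h ` S = {} \<or> h ` S = h ` X" using S(1) by (intro connD[OF c]) auto
    then show "S = {} \<or> S = X" using inj_on_image_eq_iff[OF assms(1) S(1) subset_refl] by simp
  qed
next
  assume c: "conn X {f, g}"
  show "conn (h ` X) {f', g'}"
  proof (rule connI)
    fix S assume S: "S \<subseteq> h ` X" "\<And>k. k \<in> {f', g'} \<Longrightarrow> k ` S \<subseteq> S"
    define T where "T = {x\<in>X. h x \<in> S}"
    have hT: "h ` T = S" using S(1) by (auto simp: T_def)
    have "f' ` S \<subseteq> S" "g' ` S \<subseteq> S" using S(2) by auto
    then have "f x \<in> T" "g x \<in> T" if "x \<in> T" for x
      using that assms(2,3) assms(4,5)[of x, symmetric] by (auto simp: T_def)
    then have "f ` T \<subseteq> T" "g ` T \<subseteq> T" by auto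
    then have "T = {} \<or> T = X" by (intro connD[OF c]) (auto simp: T_def)
    then show "S = {} \<or> S = h ` X" using hT by auto
  qed
qed

lemma ann_relabel:
  assumes "inj_on h X" "bij_betw \<sigma> X X" "\<And>x. x \<in> X \<Longrightarrow> \<tau> (h x) = h (\<sigma> x)"
  shows "bij_betw (map_permutation X h) (ann X \<sigma>) (ann (h ` X) \<tau>)"
proof -
  let ?P = "\<lambda>\<alpha>. conn X {\<alpha>, \<sigma>} \<and> nc X \<alpha> + nc X (inv \<alpha> \<circ> \<sigma>) = card X"
  let ?Q = "\<lambda>\<beta>. conn (h ` X) {\<beta>, \<tau>} \<and> nc (h ` X) \<beta> + nc (h ` X) (inv \<beta> \<circ> \<tau>) = card (h ` X)"
  have "bij_betw (map_permutation X h) {\<alpha> \<in> {\<alpha>. \<alpha> permutes X}. ?P \<alpha>} {\<beta> \<in> {\<beta>. \<beta> permutes h ` X}. ?Q \<beta>}"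
  proof (rule bij_betw_Collect[OF bij_betw_map_permutation[OF assms(1)]])
    fix \<alpha> assume "\<alpha> \<in> {\<alpha>. \<alpha> permutes X}"
    then have \<alpha>: "\<alpha> permutes X" by simp
    have "nc (h ` X) (map_permutation X h \<alpha>) = nc X \<alpha>"
      using assms \<alpha> by (intro wt_relabel) (auto simp: permutes_imp_bij map_permutation_apply)
    moreover have "nc (h ` X) (inv (map_permutation X h \<alpha>) \<circ> \<tau>) = nc X (inv \<alpha> \<circ> \<sigma>)"
      by (intro wt_relabel bij_betw_inv_comp \<alpha> assms inv_comp_relabel)
    moreover have "card (h ` X) = card X" using assms(1) by (rule card_image)
    moreover have "conn (h ` X) {map_permutation X h \<alpha>, \<tau>} \<longleftrightarrow> conn X {\<alpha>, \<sigma>}"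
      using assms \<alpha> by (intro conn_relabel) (auto simp: map_permutation_apply permutes_in_image bij_betw_def)
    ultimately show "?Q (map_permutation X h \<alpha>) \<longleftrightarrow> ?P \<alpha>" by simp
  qed
  moreover have "{\<alpha> \<in> {\<alpha>. \<alpha> permutes X}. ?P \<alpha>} = ann X \<sigma>"
    "{\<beta> \<in> {\<beta>. \<beta> permutes h ` X}. ?Q \<beta>} = ann (h ` X) \<tau>" by (simp_all add: ann_def)
  ultimately show ?thesis by simp
qed

lemma pair_wt_relabel:
  assumes "inj_on h X" "bij_betw \<alpha> X X" "L \<subseteq> X" "R \<subseteq> X" "bij_betw \<alpha> L L" "bij_betw \<alpha> R R"
    "\<And>x. x \<in> X \<Longrightarrow> \<beta> (h x) = h (\<alpha> x)"
  shows "pair_wt f f2 (h ` X) (h ` L) (h ` R) \<beta> = pair_wt f f2 X L R \<alpha>"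
proof -
  have cyc: "perm_cycles (h ` C) \<beta> = (`) h ` perm_cycles C \<alpha>" if "C \<subseteq> X" "bij_betw \<alpha> C C" for C
    using that assms(7) by (intro perm_cycles_relabel) (auto simp: bij_betw_def)
  have inj: "inj_on ((`) h) (perm_cycles C \<alpha>)" if "C \<subseteq> X" "bij_betw \<alpha> C C" for C
    using that assms(1) by (intro inj_on_image_cycles) (auto intro: inj_on_subset)
  have card: "card (h ` C) = card C" if "C \<subseteq> X" for C
    using that assms(1) by (meson card_image inj_on_subset)
  have "f2 (card (h ` U)) (card (h ` V)) * wt f (perm_cycles (h ` X) \<beta> - {h ` U, h ` V})
      = f2 (card U) (card V) * wt f (perm_cycles X \<alpha> - {U, V})"
    if UV: "U \<in> perm_cycles L \<alpha>" "V \<in> perm_cycles R \<alpha>" for U V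
  proof -
    have UX: "U \<subseteq> X" "V \<subseteq> X" using UV perm_cycles_subset assms(3-6) by blast+
    have in_X: "U \<in> perm_cycles X \<alpha>" "V \<in> perm_cycles X \<alpha>" using UV assms(3,4) by (auto simp: perm_cycles_def)
    have "perm_cycles (h ` X) \<beta> - {h ` U, h ` V} = (`) h ` perm_cycles X \<alpha> - (`) h ` {U, V}"
      using cyc[OF subset_refl assms(2)] by simp
    also have "\<dots> = (`) h ` (perm_cycles X \<alpha> - {U, V})"
      by (rule inj_on_image_set_diff[OF inj[OF subset_refl assms(2)], symmetric]) (use in_X in auto)
    finally have e: "perm_cycles (h ` X) \<beta> - {h ` U, h ` V} = (`) h ` (perm_cycles X \<alpha> - {U, V})" .
    have i: "inj_on ((`) h) (perm_cycles X \<alpha> - {U, V})"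
      using inj[OF subset_refl assms(2)] by (rule inj_on_subset) auto
    have "wt f (perm_cycles (h ` X) \<beta> - {h ` U, h ` V}) = wt f (perm_cycles X \<alpha> - {U, V})"
      unfolding wt_def e prod.reindex[OF i] using card perm_cycles_subset[OF assms(2)]
      by (intro prod.cong) auto
    then show ?thesis using card UX by simp
  qed
  then show ?thesis
    unfolding pair_wt_def cyc[OF assms(3,5)] cyc[OF assms(4,6)]
    by (simp add: sum.reindex[OF inj[OF assms(3,5)]] sum.reindex[OF inj[OF assms(4,6)]])
qed

lemma bij_betw_inv_comp_invariant:
  assumes "\<alpha> permutes X" "bij_betw \<alpha> C C" "bij_betw \<sigma> C C"
  shows "bij_betw (inv \<alpha> \<circ> \<sigma>) C C"
proof -
  have "bij_betw (inv \<alpha>) C C"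
    using assms(2) bij_betw_inv_into_subset[OF permutes_bij[OF assms(1)], of C C] by (simp add: bij_betw_def)
  then show ?thesis using assms(3) by (rule bij_betw_comp)
qed

lemma conv2_relabel:
  assumes "finite X" "inj_on h X" "bij_betw \<sigma> X X" "\<And>x. x \<in> X \<Longrightarrow> \<tau> (h x) = h (\<sigma> x)"
    "L \<subseteq> X" "R \<subseteq> X" "bij_betw \<sigma> L L" "bij_betw \<sigma> R R"
  shows "conv2 f f2 g g2 (h ` X) (h ` L) (h ` R) \<tau> = conv2 f f2 g g2 X L R \<sigma>"
proof -
  let ?m = "map_permutation X h"
  have w: "wt k (perm_cycles (h ` X) (?m \<alpha>)) = wt k (perm_cycles X \<alpha>)"
    "wt k (perm_cycles (h ` X) (inv (?m \<alpha>) \<circ> \<tau>)) = wt k (perm_cycles X (inv \<alpha> \<circ> \<sigma>))"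
    if \<alpha>: "\<alpha> permutes X" for \<alpha> k
  proof -
    show "wt k (perm_cycles (h ` X) (?m \<alpha>)) = wt k (perm_cycles X \<alpha>)"
      using assms \<alpha> by (intro wt_relabel) (auto simp: permutes_imp_bij map_permutation_apply)
    show "wt k (perm_cycles (h ` X) (inv (?m \<alpha>) \<circ> \<tau>)) = wt k (perm_cycles X (inv \<alpha> \<circ> \<sigma>))"
      by (intro wt_relabel bij_betw_inv_comp \<alpha> assms inv_comp_relabel)
  qed
  have p: "pair_wt k k2 (h ` X) (h ` L) (h ` R) (?m \<alpha>) = pair_wt k k2 X L R \<alpha>"
    "pair_wt k k2 (h ` X) (h ` L) (h ` R) (inv (?m \<alpha>) \<circ> \<tau>) = pair_wt k k2 X L R (inv \<alpha> \<circ> \<sigma>)"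
    if "\<alpha> \<in> geo X \<sigma>" for \<alpha> k k2
  proof -
    have \<alpha>: "\<alpha> permutes X" using that by (simp add: geo_def)
    have LR: "bij_betw \<alpha> L L" "bij_betw \<alpha> R R"
      using geo_invariant[OF assms(1,3) that] assms(5-8) by auto
    show "pair_wt k k2 (h ` X) (h ` L) (h ` R) (?m \<alpha>) = pair_wt k k2 X L R \<alpha>"
      using assms \<alpha> LR by (intro pair_wt_relabel) (auto simp: permutes_imp_bij map_permutation_apply)
    show "pair_wt k k2 (h ` X) (h ` L) (h ` R) (inv (?m \<alpha>) \<circ> \<tau>) = pair_wt k k2 X L R (inv \<alpha> \<circ> \<sigma>)"
      by (intro pair_wt_relabel bij_betw_inv_comp \<alpha> assms inv_comp_relabel bij_betw_inv_comp_invariant[OF \<alpha>] LR)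
  qed
  have gp: "\<alpha> permutes X" if "\<alpha> \<in> geo X \<sigma>" for \<alpha> using that by (simp add: geo_def)
  have "conv_ann f g (h ` X) \<tau> = conv_ann f g X \<sigma>"
    unfolding conv_ann_def
    by (subst sum.reindex_bij_betw[OF ann_relabel[OF assms(2-4)], symmetric]) (simp_all add: w ann_def)
  moreover have "conv_left f f2 g (h ` X) (h ` L) (h ` R) \<tau> = conv_left f f2 g X L R \<sigma>"
    unfolding conv_left_def
    by (subst sum.reindex_bij_betw[OF geo_relabel[OF assms(2-4)], symmetric]) (simp_all add: w p gp)
  moreover have "conv_right f g g2 (h ` X) (h ` L) (h ` R) \<tau> = conv_right f g g2 X L R \<sigma>"
    unfolding conv_right_def
    by (subst sum.reindex_bij_betw[OF geo_relabel[OF assms(2-4)], symmetric]) (simp_all add: w p gp)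
  ultimately show ?thesis by (simp add: conv2_def)
qed

lemma annular_gamma_eq:
  "x \<in> {1..p} \<Longrightarrow> annular_gamma p q x = gamma {1..p} x"
  "x \<in> {p+1..p+q} \<Longrightarrow> annular_gamma p q x = gamma {p+1..p+q} x"
  unfolding annular_gamma_def
  by (rule comp_disjoint_eqs(1)[of "{1..p}" "{p+1..p+q}"] comp_disjoint_eqs(2)[of "{1..p}" "{p+1..p+q}"];
      auto intro: gamma_permutes)+

lemma two_cycles_annular:
  assumes "p \<ge> 1" "q \<ge> 1"
  shows "two_cycles {1..p} {p+1..p+q} {1..p+q} (annular_gamma p q)"
proof
  have g: "bij_betw (gamma C) C C" if "finite C" for C using gamma_permutes[OF that] by (rule permutes_imp_bij)
  show L: "bij_betw (annular_gamma p q) {1..p} {1..p}"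
    using g[of "{1..p}"] bij_betw_cong[of "{1..p}" "annular_gamma p q" "gamma {1..p}"] annular_gamma_eq(1) by auto
  show R: "bij_betw (annular_gamma p q) {p+1..p+q} {p+1..p+q}"
    using g[of "{p+1..p+q}"] bij_betw_cong[of "{p+1..p+q}" "annular_gamma p q" "gamma {p+1..p+q}"] annular_gamma_eq(2) by auto
  show "perm_cycles {1..p} (annular_gamma p q) = {{1..p}}"
    using perm_cycles_cong[OF L annular_gamma_eq(1)] perm_cycles_gamma[of "{1..p}"] assms by auto
  show "perm_cycles {p+1..p+q} (annular_gamma p q) = {{p+1..p+q}}"
    using perm_cycles_cong[OF R annular_gamma_eq(2)] perm_cycles_gamma[of "{p+1..p+q}"] assms by auto
qed (use assms in auto)

text \<open>\<open>A\<close> is numbered by \<open>{1..p}\<close> and \<open>B\<close> by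
  \<open>{p+1..p+q}\<close> along their cycles. The two numberings combine to one that carries
  \<open>annular_gamma p q\<close> to \<open>\<sigma>\<close>, so only the two lengths
  matter.\<close>

lemma conv2_cyclic:
  assumes "finite A" "finite B" "A \<inter> B = {}" "bij_betw \<sigma> A A" "bij_betw \<sigma> B B"
    "A \<in> perm_cycles A \<sigma>" "B \<in> perm_cycles B \<sigma>"
  shows "conv2 f f2 g g2 (A \<union> B) A B \<sigma> = prod_kappa2 f f2 g g2 (card A) (card B)"
proof -
  define p where "p = card A"
  define q where "q = card B"
  obtain x y where x: "x \<in> A" "orbit \<sigma> x = A" and y: "y \<in> B" "orbit \<sigma> y = B"
    using assms(6,7) by (auto simp: perm_cycles_def)
  obtain h1 where h1: "bij_betw h1 {0+1..0+p} A" "\<forall>i\<in>{0+1..0+p}. \<sigma> (h1 i) = h1 (gamma {0+1..0+p} i)"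
    using cyclic_relabel[OF assms(1,4) x p_def[symmetric], of 0] by blast
  obtain h2 where h2: "bij_betw h2 {p+1..p+q} B" "\<forall>i\<in>{p+1..p+q}. \<sigma> (h2 i) = h2 (gamma {p+1..p+q} i)"
    using cyclic_relabel[OF assms(2,5) y q_def[symmetric], of p] by blast
  define h where "h i = (if i \<le> p then h1 i else h2 i)" for i
  have h_eq: "\<And>i. i \<in> {1..p} \<Longrightarrow> h i = h1 i" "\<And>i. i \<in> {p+1..p+q} \<Longrightarrow> h i = h2 i" by (auto simp: h_def)
  have hA: "bij_betw h {1..p} A" using h1(1) bij_betw_cong[of "{1..p}" h h1 A] h_eq(1) by auto
  have hB: "bij_betw h {p+1..p+q} B" using h2(1) bij_betw_cong[of "{p+1..p+q}" h h2 B] h_eq(2) by auto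
  have un: "{1..p} \<union> {p+1..p+q} = {1..p+q}" by auto
  have hAB: "bij_betw h {1..p+q} (A \<union> B)" using bij_betw_combine[OF hA hB assms(3)] un by simp
  have "p \<ge> 1" "q \<ge> 1" using x y assms by (auto simp: p_def q_def Suc_le_eq card_gt_0_iff)
  then interpret two_cycles "{1..p}" "{p+1..p+q}" "{1..p+q}" "annular_gamma p q" by (rule two_cycles_annular)
  have int: "\<sigma> (h i) = h (annular_gamma p q i)" if "i \<in> {1..p+q}" for i
  proof (cases "i \<le> p")
    case True
    then have i: "i \<in> {1..p}" using that by simp
    then have "annular_gamma p q i \<in> {1..p}" using bij_L by (auto simp: bij_betw_def)
    then show ?thesis using h1(2) i h_eq(1) annular_gamma_eq(1)[OF i] by simp
  next
    case False
    then have i: "i \<in> {p+1..p+q}" using that by simp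
    then have "annular_gamma p q i \<in> {p+1..p+q}" using bij_R by (auto simp: bij_betw_def)
    then show ?thesis using h2(2) i h_eq(2) annular_gamma_eq(2)[OF i] by simp
  qed
  have "conv2 f f2 g g2 (h ` {1..p+q}) (h ` {1..p}) (h ` {p+1..p+q}) \<sigma> =
      conv2 f f2 g g2 {1..p+q} {1..p} {p+1..p+q} (annular_gamma p q)"
    by (rule conv2_relabel) (use hAB int bij_X bij_L bij_R in \<open>auto simp: bij_betw_def\<close>)
  then show ?thesis
    using hA hB hAB by (simp add: prod_kappa2_def bij_betw_def p_def q_def)
qed

lemma pair_wt_cong:
  assumes "perm_cycles X \<alpha> = perm_cycles X \<beta>" "perm_cycles L \<alpha> = perm_cycles L \<beta>" "perm_cycles R \<alpha> = perm_cycles R \<beta>"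
  shows "pair_wt f f2 X L R \<alpha> = pair_wt f f2 X L R \<beta>"
  unfolding pair_wt_def assms ..

lemma pair_wt_Un:
  assumes "finite Z" "finite Y" "bij_betw \<alpha> Z Z" "bij_betw \<alpha> Y Y" "Z \<inter> Y = {}" "A \<subseteq> Z" "B \<subseteq> Z"
  shows "pair_wt f f2 (Z \<union> Y) A B \<alpha> = pair_wt f f2 Z A B \<alpha> * wt f (perm_cycles Y \<alpha>)"
proof -
  have d: "perm_cycles Z \<alpha> \<inter> perm_cycles Y \<alpha> = {}" by (rule perm_cycles_disjoint[OF assms(3-5)])
  have "wt f (perm_cycles (Z \<union> Y) \<alpha> - {U, V}) = wt f (perm_cycles Z \<alpha> - {U, V}) * wt f (perm_cycles Y \<alpha>)"
    if "U \<in> perm_cycles A \<alpha>" "V \<in> perm_cycles B \<alpha>" for U V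
  proof -
    have "U \<in> perm_cycles Z \<alpha>" "V \<in> perm_cycles Z \<alpha>" using that assms(6,7) by (auto simp: perm_cycles_def)
    then have "perm_cycles (Z \<union> Y) \<alpha> - {U, V} = (perm_cycles Z \<alpha> - {U, V}) \<union> perm_cycles Y \<alpha>"
      using d unfolding perm_cycles_Un by blast
    moreover have "(perm_cycles Z \<alpha> - {U, V}) \<inter> perm_cycles Y \<alpha> = {}" using d by blast
    ultimately show ?thesis using assms(1,2) by (simp add: wt_def prod.union_disjoint)
  qed
  then show ?thesis by (simp add: pair_wt_def sum_distrib_right mult.assoc)
qed

lemma sum_cycles_refine:
  assumes "finite L" "partition_on L P" "\<And>A. A \<in> P \<Longrightarrow> bij_betw \<alpha> A A"
  shows "(\<Sum>U\<in>perm_cycles L \<alpha>. F U) = (\<Sum>A\<in>P. \<Sum>U\<in>perm_cycles A \<alpha>. F U)"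
proof -
  have "perm_cycles L \<alpha> = (\<Union>A\<in>P. perm_cycles A \<alpha>)"
    unfolding partition_onD1[OF assms(2)] perm_cycles_def by blast
  moreover have "(\<Sum>U\<in>(\<Union>A\<in>P. perm_cycles A \<alpha>). F U) = (\<Sum>A\<in>P. \<Sum>U\<in>perm_cycles A \<alpha>. F U)"
  proof (rule sum.UNION_disjoint)
    show "finite P" using assms(1,2) finite_elements by blast
    show "\<forall>A\<in>P. finite (perm_cycles A \<alpha>)" using block_finite[OF assms(1,2)] by simp
    show "\<forall>A\<in>P. \<forall>B\<in>P. A \<noteq> B \<longrightarrow> perm_cycles A \<alpha> \<inter> perm_cycles B \<alpha> = {}"
      using perm_cycles_disjoint assms(3) partition_onD2[OF assms(2)] by (metis disjointD)
  qed
  ultimately show ?thesis by simp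
qed

section \<open>Associativity of the second order convolution\<close>

context two_cycles
begin

text \<open>Choosing a cycle of the finer \<open>\<alpha>\<close> on a circle amounts to choosing
  first the cycle of \<open>\<sigma>\<close> that contains it. Only the two sides vary in the sum;
  the whole set \<open>X\<close> stays fixed.\<close>

lemma pair_wt_refine:
  assumes "bij_betw \<sigma> L L" "bij_betw \<sigma> R R" "\<And>C. C \<in> perm_cycles X \<sigma> \<Longrightarrow> bij_betw \<alpha> C C"
  shows "(\<Sum>A\<in>perm_cycles L \<sigma>. \<Sum>B\<in>perm_cycles R \<sigma>. pair_wt f f2 X A B \<alpha>) = pair_wt f f2 X L R \<alpha>"
proof -
  let ?G = "\<lambda>U V. f2 (card U) (card V) * wt f (perm_cycles X \<alpha> - {U, V})"
  have sub: "perm_cycles L \<sigma> \<subseteq> perm_cycles X \<sigma>" "perm_cycles R \<sigma> \<subseteq> perm_cycles X \<sigma>"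
    unfolding X perm_cycles_Un by auto
  note pL = sum_cycles_refine[OF fin(1) partition_on_perm_cycles[OF fin(1) assms(1)], of \<alpha>]
    and pR = sum_cycles_refine[OF fin(2) partition_on_perm_cycles[OF fin(2) assms(2)], of \<alpha>]
  have "pair_wt f f2 X L R \<alpha> = (\<Sum>A\<in>perm_cycles L \<sigma>. \<Sum>U\<in>perm_cycles A \<alpha>. \<Sum>B\<in>perm_cycles R \<sigma>. \<Sum>V\<in>perm_cycles B \<alpha>. ?G U V)"
    unfolding pair_wt_def using sub assms(3) by (subst pL, blast, subst pR) auto
  also have "\<dots> = (\<Sum>A\<in>perm_cycles L \<sigma>. \<Sum>B\<in>perm_cycles R \<sigma>. pair_wt f f2 X A B \<alpha>)"
    unfolding pair_wt_def by (intro sum.cong refl sum.swap)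
  finally show ?thesis by simp
qed

text \<open>A second order factor on the two chosen cycles times the first order factors on the rest
  expands into a sum over permutations of \<open>X\<close>. In the annular part \<open>a\<close> and
  \<open>b\<close> stay separate, in the form delivered by \<open>sum_tri2\<close>.\<close>

lemma conv_glue:
  assumes \<sigma>: "bij_betw \<sigma> L L" "bij_betw \<sigma> R R" and AB: "A \<in> perm_cycles L \<sigma>" "B \<in> perm_cycles R \<sigma>"
  defines "Z \<equiv> A \<union> B" and "Y \<equiv> X - (A \<union> B)"
  shows "conv_ann f g Z \<sigma> * conv f g Y \<sigma> = (\<Sum>a\<in>ann Z \<sigma>. \<Sum>b\<in>geo Y \<sigma>.
      wt f (perm_cycles X (a \<circ> b)) * wt g (perm_cycles X (inv (a \<circ> b) \<circ> \<sigma>)))"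
    and "conv_left f f2 g Z A B \<sigma> * conv f g Y \<sigma> =
      (\<Sum>\<alpha>\<in>geo X \<sigma>. pair_wt f f2 X A B \<alpha> * wt g (perm_cycles X (inv \<alpha> \<circ> \<sigma>)))"
    and "conv_right f g g2 Z A B \<sigma> * conv f g Y \<sigma> =
      (\<Sum>\<alpha>\<in>geo X \<sigma>. wt f (perm_cycles X \<alpha>) * pair_wt g g2 X A B (inv \<alpha> \<circ> \<sigma>))"
proof -
  note F = AB_facts[OF \<sigma> AB, folded Z_def Y_def]
  have fZY: "finite Z" "finite Y" and ZY: "Z \<inter> Y = {}" "Z \<union> Y = X"
    using F(7,17,18) finite_X by (auto simp: Z_def Y_def)
  note w = wt_comp_disjoint[OF fZY ZY(1) F(10,15), unfolded ZY(2)]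
  show "conv_ann f g Z \<sigma> * conv f g Y \<sigma> = (\<Sum>a\<in>ann Z \<sigma>. \<Sum>b\<in>geo Y \<sigma>.
      wt f (perm_cycles X (a \<circ> b)) * wt g (perm_cycles X (inv (a \<circ> b) \<circ> \<sigma>)))"
    unfolding conv_ann_def conv_def sum_product
    by (intro sum.cong refl) (simp add: w ann_def geo_def mult_ac)
  have AZ: "A \<subseteq> Z" "B \<subseteq> Z" by (auto simp: Z_def)
  have pw: "pair_wt k k2 X A B (a \<circ> b) = pair_wt k k2 Z A B a * wt k (perm_cycles Y b)"
    "pair_wt k k2 X A B (inv (a \<circ> b) \<circ> \<sigma>) = pair_wt k k2 Z A B (inv a \<circ> \<sigma>) * wt k (perm_cycles Y (inv b \<circ> \<sigma>))"
    if "a \<in> geo Z \<sigma>" "b \<in> geo Y \<sigma>" for a b k k2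
  proof -
    have p: "a permutes Z" "b permutes Y" using that by (auto simp: geo_def)
    have aAB: "bij_betw a A A" "bij_betw a B B"
      using geo_invariant[OF fZY(1) F(10) that(1)] AZ F(8,9) by auto
    note e = comp_disjoint_eqs[OF ZY(1) p]
    note cy = perm_cycles_comp_disjoint[OF ZY(1) p F(10,15)]
    have bZ: "bij_betw (a \<circ> b) Z Z" "bij_betw (a \<circ> b) Y Y"
      using bij_betw_cong[of Z "a \<circ> b" a Z] bij_betw_cong[of Y "a \<circ> b" b Y] e permutes_imp_bij[OF p(1)] permutes_imp_bij[OF p(2)] by auto
    have \<sigma>Z: "x \<in> Z \<Longrightarrow> \<sigma> x \<in> Z" "x \<in> Y \<Longrightarrow> \<sigma> x \<in> Y" for x using F(10,15) by (auto simp: bij_betw_def)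
    have eq: "x \<in> Z \<Longrightarrow> (inv (a \<circ> b) \<circ> \<sigma>) x = (inv a \<circ> \<sigma>) x" "x \<in> Y \<Longrightarrow> (inv (a \<circ> b) \<circ> \<sigma>) x = (inv b \<circ> \<sigma>) x" for x
      using e(3,4) \<sigma>Z by auto
    have bZ': "bij_betw (inv (a \<circ> b) \<circ> \<sigma>) Z Z" "bij_betw (inv (a \<circ> b) \<circ> \<sigma>) Y Y"
      using bij_betw_cong[of Z "inv (a \<circ> b) \<circ> \<sigma>" "inv a \<circ> \<sigma>" Z] bij_betw_cong[of Y "inv (a \<circ> b) \<circ> \<sigma>" "inv b \<circ> \<sigma>" Y]
        eq bij_betw_inv_comp[OF p(1) F(10)] bij_betw_inv_comp[OF p(2) F(15)] by auto
    have "perm_cycles A (a \<circ> b) = perm_cycles A a" "perm_cycles B (a \<circ> b) = perm_cycles B a"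
      using perm_cycles_cong[OF aAB(1), of "a \<circ> b"] perm_cycles_cong[OF aAB(2), of "a \<circ> b"] e(1) AZ
      by (auto simp: subset_iff)
    then have "pair_wt k k2 Z A B (a \<circ> b) = pair_wt k k2 Z A B a" using cy by (intro pair_wt_cong)
    then show "pair_wt k k2 X A B (a \<circ> b) = pair_wt k k2 Z A B a * wt k (perm_cycles Y b)"
      using pair_wt_Un[OF fZY bZ ZY(1) AZ] cy ZY(2) by simp
    note iAB = bij_betw_inv_comp_invariant[OF p(1) aAB(1) F(8)] bij_betw_inv_comp_invariant[OF p(1) aAB(2) F(9)]
    have "perm_cycles A (inv (a \<circ> b) \<circ> \<sigma>) = perm_cycles A (inv a \<circ> \<sigma>)" "perm_cycles B (inv (a \<circ> b) \<circ> \<sigma>) = perm_cycles B (inv a \<circ> \<sigma>)"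
      using perm_cycles_cong[OF iAB(1), of "inv (a \<circ> b) \<circ> \<sigma>"] perm_cycles_cong[OF iAB(2), of "inv (a \<circ> b) \<circ> \<sigma>"] eq(1) AZ
      by (auto simp: subset_iff)
    then have "pair_wt k k2 Z A B (inv (a \<circ> b) \<circ> \<sigma>) = pair_wt k k2 Z A B (inv a \<circ> \<sigma>)" using cy by (intro pair_wt_cong)
    then show "pair_wt k k2 X A B (inv (a \<circ> b) \<circ> \<sigma>) = pair_wt k k2 Z A B (inv a \<circ> \<sigma>) * wt k (perm_cycles Y (inv b \<circ> \<sigma>))"
      using pair_wt_Un[OF fZY bZ' ZY(1) AZ] cy ZY(2) by simp
  qed
  note s = sum_geo_Un[OF fZY ZY(1) F(10,15), unfolded ZY(2)]
  show "conv_left f f2 g Z A B \<sigma> * conv f g Y \<sigma> =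
      (\<Sum>\<alpha>\<in>geo X \<sigma>. pair_wt f f2 X A B \<alpha> * wt g (perm_cycles X (inv \<alpha> \<circ> \<sigma>)))"
    unfolding conv_left_def conv_def sum_product s
  proof (intro sum.cong refl)
    fix a b assume ab: "a \<in> geo Z \<sigma>" "b \<in> geo Y \<sigma>"
    then have p: "a permutes Z" "b permutes Y" by (auto simp: geo_def)
    show "pair_wt f f2 Z A B a * wt g (perm_cycles Z (inv a \<circ> \<sigma>)) * (wt f (perm_cycles Y b) * wt g (perm_cycles Y (inv b \<circ> \<sigma>)))
      = pair_wt f f2 X A B (a \<circ> b) * wt g (perm_cycles X (inv (a \<circ> b) \<circ> \<sigma>))"
      unfolding pw(1)[OF ab] w(2)[OF p] by (simp add: mult_ac)
  qed
  show "conv_right f g g2 Z A B \<sigma> * conv f g Y \<sigma> =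
      (\<Sum>\<alpha>\<in>geo X \<sigma>. wt f (perm_cycles X \<alpha>) * pair_wt g g2 X A B (inv \<alpha> \<circ> \<sigma>))"
    unfolding conv_right_def conv_def sum_product s
  proof (intro sum.cong refl)
    fix a b assume ab: "a \<in> geo Z \<sigma>" "b \<in> geo Y \<sigma>"
    then have p: "a permutes Z" "b permutes Y" by (auto simp: geo_def)
    show "wt f (perm_cycles Z a) * pair_wt g g2 Z A B (inv a \<circ> \<sigma>) * (wt f (perm_cycles Y b) * wt g (perm_cycles Y (inv b \<circ> \<sigma>)))
      = wt f (perm_cycles X (a \<circ> b)) * pair_wt g g2 X A B (inv (a \<circ> b) \<circ> \<sigma>)"
      unfolding pw(2)[OF ab] w(1)[OF p] by (simp add: mult_ac)
  qed
qed

text \<open>Both sides run over the factorizations \<open>\<gamma> = \<alpha>\<beta>\<delta>\<close>, which the right-hand side groups by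
  \<open>\<sigma> = \<alpha>\<beta>\<close>.\<close>

theorem sum_assoc:
  "(\<Sum>(\<alpha>, \<beta>)\<in>tri2 X \<gamma>. wt f (perm_cycles X \<alpha>) * wt g (perm_cycles X \<beta>)) +
   (\<Sum>(\<alpha>, \<beta>)\<in>tri X \<gamma>. pair_wt f f2 X L R \<alpha> * wt g (perm_cycles X \<beta>) + wt f (perm_cycles X \<alpha>) * pair_wt g g2 X L R \<beta>) =
   (\<Sum>\<sigma>\<in>ann X \<gamma>. wt (prod_kappa f g) (perm_cycles X \<sigma>)) +
   (\<Sum>\<sigma>\<in>geo X \<gamma>. pair_wt (prod_kappa f g) (prod_kappa2 f f2 g g2) X L R \<sigma>)"
proof -
  let ?k = "prod_kappa f g" and ?k2 = "prod_kappa2 f f2 g g2"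
  \<comment> \<open>The second order cumulant of the product at \<open>(A, B)\<close> has three
    sources: an annular permutation on \<open>A \<union> B\<close>, a merged pair in
    \<open>\<alpha>\<close>, a merged pair in \<open>\<beta>\<close>. The other cycles of
    \<open>\<sigma>\<close> contribute a planar convolution.\<close>
  have merge: "?k2 (card A) (card B) * wt ?k (perm_cycles X \<sigma> - {A, B}) =
      (\<Sum>a\<in>ann (A \<union> B) \<sigma>. \<Sum>b\<in>geo (X - (A \<union> B)) \<sigma>. wt f (perm_cycles X (a \<circ> b)) * wt g (perm_cycles X (inv (a \<circ> b) \<circ> \<sigma>)))
      + (\<Sum>\<alpha>\<in>geo X \<sigma>. pair_wt f f2 X A B \<alpha> * wt g (perm_cycles X (inv \<alpha> \<circ> \<sigma>)))
      + (\<Sum>\<alpha>\<in>geo X \<sigma>. wt f (perm_cycles X \<alpha>) * pair_wt g g2 X A B (inv \<alpha> \<circ> \<sigma>))"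
    if \<sigma>: "\<sigma> \<in> geo X \<gamma>" and AB: "A \<in> perm_cycles L \<sigma>" "B \<in> perm_cycles R \<sigma>" for \<sigma> A B
  proof -
    note b = geo_invariant_LR[OF \<sigma>]
    note F = AB_facts[OF b(1,2) AB]
    have "A \<in> perm_cycles A \<sigma>" "B \<in> perm_cycles B \<sigma>"
      using cycle_perm_cycles(2)[OF fin(1) b(1) AB(1)] cycle_perm_cycles(2)[OF fin(2) b(2) AB(2)] by auto
    then have "?k2 (card A) (card B) = conv2 f f2 g g2 (A \<union> B) A B \<sigma>"
      using conv2_cyclic[OF F(17,18,6,8,9)] by simp
    moreover have "wt ?k (perm_cycles X \<sigma> - {A, B}) = conv f g (X - (A \<union> B)) \<sigma>"
      using conv_eq_wt[OF _ F(15), of f g] finite_X F(16) by simp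
    ultimately show ?thesis
      unfolding conv_glue[OF b(1,2) AB, symmetric] by (simp add: conv2_def distrib_right)
  qed
  have refine: "bij_betw \<alpha> C C" "bij_betw (inv \<alpha> \<circ> \<sigma>) C C"
    if "\<sigma> \<in> geo X \<gamma>" "\<alpha> \<in> geo X \<sigma>" "C \<in> perm_cycles X \<sigma>" for \<sigma> \<alpha> C
  proof -
    note b = geo_invariant_LR[OF that(1)]
    note C = cycle_perm_cycles(1)[OF finite_X b(3) that(3)]
    show "bij_betw \<alpha> C C"
      using geo_invariant[OF finite_X b(3) that(2) perm_cycles_subset[OF b(3) that(3)] C] .
    then show "bij_betw (inv \<alpha> \<circ> \<sigma>) C C"
      using that(2) C by (intro bij_betw_inv_comp_invariant[of _ X]) (auto simp: geo_def)
  qed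
  have "pair_wt ?k ?k2 X L R \<sigma> =
      (\<Sum>A\<in>perm_cycles L \<sigma>. \<Sum>B\<in>perm_cycles R \<sigma>. \<Sum>a\<in>ann (A \<union> B) \<sigma>. \<Sum>b\<in>geo (X - (A \<union> B)) \<sigma>.
         wt f (perm_cycles X (a \<circ> b)) * wt g (perm_cycles X (inv (a \<circ> b) \<circ> \<sigma>)))
      + (\<Sum>\<alpha>\<in>geo X \<sigma>. pair_wt f f2 X L R \<alpha> * wt g (perm_cycles X (inv \<alpha> \<circ> \<sigma>))
           + wt f (perm_cycles X \<alpha>) * pair_wt g g2 X L R (inv \<alpha> \<circ> \<sigma>))"
    if \<sigma>: "\<sigma> \<in> geo X \<gamma>" for \<sigma>
  proof -
    note b = geo_invariant_LR[OF \<sigma>]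
    \<comment> \<open>Once the sum over \<open>\<alpha>\<close> is outside, a pair of cycles of
      \<open>\<sigma>\<close> followed by a pair of cycles of \<open>\<alpha>\<close> inside it is
      just a pair of cycles of \<open>\<alpha>\<close>.\<close>
    have left: "(\<Sum>A\<in>perm_cycles L \<sigma>. \<Sum>B\<in>perm_cycles R \<sigma>. \<Sum>\<alpha>\<in>geo X \<sigma>. pair_wt f f2 X A B \<alpha> * wt g (perm_cycles X (inv \<alpha> \<circ> \<sigma>)))
        = (\<Sum>\<alpha>\<in>geo X \<sigma>. pair_wt f f2 X L R \<alpha> * wt g (perm_cycles X (inv \<alpha> \<circ> \<sigma>)))" (is "?l = ?r")
    proof -
      have "?l = (\<Sum>A\<in>perm_cycles L \<sigma>. \<Sum>\<alpha>\<in>geo X \<sigma>. \<Sum>B\<in>perm_cycles R \<sigma>. pair_wt f f2 X A B \<alpha> * wt g (perm_cycles X (inv \<alpha> \<circ> \<sigma>)))"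
        by (rule sum.cong[OF refl], rule sum.swap)
      also have "\<dots> = (\<Sum>\<alpha>\<in>geo X \<sigma>. \<Sum>A\<in>perm_cycles L \<sigma>. \<Sum>B\<in>perm_cycles R \<sigma>. pair_wt f f2 X A B \<alpha> * wt g (perm_cycles X (inv \<alpha> \<circ> \<sigma>)))"
        by (rule sum.swap)
      also have "\<dots> = ?r"
        by (intro sum.cong refl) (simp add: pair_wt_refine[OF b(1,2) refine(1)[OF \<sigma>], symmetric] sum_distrib_right)
      finally show ?thesis .
    qed
    have right: "(\<Sum>A\<in>perm_cycles L \<sigma>. \<Sum>B\<in>perm_cycles R \<sigma>. \<Sum>\<alpha>\<in>geo X \<sigma>. wt f (perm_cycles X \<alpha>) * pair_wt g g2 X A B (inv \<alpha> \<circ> \<sigma>))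
        = (\<Sum>\<alpha>\<in>geo X \<sigma>. wt f (perm_cycles X \<alpha>) * pair_wt g g2 X L R (inv \<alpha> \<circ> \<sigma>))" (is "?l = ?r")
    proof -
      have "?l = (\<Sum>A\<in>perm_cycles L \<sigma>. \<Sum>\<alpha>\<in>geo X \<sigma>. \<Sum>B\<in>perm_cycles R \<sigma>. wt f (perm_cycles X \<alpha>) * pair_wt g g2 X A B (inv \<alpha> \<circ> \<sigma>))"
        by (rule sum.cong[OF refl], rule sum.swap)
      also have "\<dots> = (\<Sum>\<alpha>\<in>geo X \<sigma>. \<Sum>A\<in>perm_cycles L \<sigma>. \<Sum>B\<in>perm_cycles R \<sigma>. wt f (perm_cycles X \<alpha>) * pair_wt g g2 X A B (inv \<alpha> \<circ> \<sigma>))"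
        by (rule sum.swap)
      also have "\<dots> = ?r"
        by (intro sum.cong refl) (simp add: pair_wt_refine[OF b(1,2) refine(2)[OF \<sigma>], symmetric] sum_distrib_left)
      finally show ?thesis .
    qed
    have "pair_wt ?k ?k2 X L R \<sigma> = (\<Sum>A\<in>perm_cycles L \<sigma>. \<Sum>B\<in>perm_cycles R \<sigma>.
      (\<Sum>a\<in>ann (A \<union> B) \<sigma>. \<Sum>b\<in>geo (X - (A \<union> B)) \<sigma>. wt f (perm_cycles X (a \<circ> b)) * wt g (perm_cycles X (inv (a \<circ> b) \<circ> \<sigma>)))
      + (\<Sum>\<alpha>\<in>geo X \<sigma>. pair_wt f f2 X A B \<alpha> * wt g (perm_cycles X (inv \<alpha> \<circ> \<sigma>)))
      + (\<Sum>\<alpha>\<in>geo X \<sigma>. wt f (perm_cycles X \<alpha>) * pair_wt g g2 X A B (inv \<alpha> \<circ> \<sigma>)))"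
      unfolding pair_wt_def[of ?k ?k2] by (rule sum.cong[OF refl], rule sum.cong[OF refl], rule merge[OF \<sigma>])
    then show ?thesis unfolding sum.distrib left right by (simp add: add.assoc)
  qed
  then have "(\<Sum>\<sigma>\<in>geo X \<gamma>. pair_wt ?k ?k2 X L R \<sigma>) =
      (\<Sum>\<sigma>\<in>geo X \<gamma>. \<Sum>A\<in>perm_cycles L \<sigma>. \<Sum>B\<in>perm_cycles R \<sigma>. \<Sum>a\<in>ann (A \<union> B) \<sigma>. \<Sum>b\<in>geo (X - (A \<union> B)) \<sigma>.
         wt f (perm_cycles X (a \<circ> b)) * wt g (perm_cycles X (inv (a \<circ> b) \<circ> \<sigma>)))
      + (\<Sum>(\<alpha>, \<beta>)\<in>tri X \<gamma>. pair_wt f f2 X L R \<alpha> * wt g (perm_cycles X \<beta>) + wt f (perm_cycles X \<alpha>) * pair_wt g g2 X L R \<beta>)"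
    unfolding sum_tri[OF finite_X bij_X] by (simp only: sum.distrib[symmetric]) simp
  moreover have "(\<Sum>\<sigma>\<in>ann X \<gamma>. \<Sum>\<alpha>\<in>geo X \<sigma>. wt f (perm_cycles X \<alpha>) * wt g (perm_cycles X (inv \<alpha> \<circ> \<sigma>)))
      = (\<Sum>\<sigma>\<in>ann X \<gamma>. wt ?k (perm_cycles X \<sigma>))"
    using conv_eq_wt[OF finite_X, of _ f g] by (intro sum.cong refl) (auto simp: ann_def conv_def permutes_imp_bij)
  ultimately show ?thesis unfolding sum_tri2 by (simp add: add.assoc)
qed

end

section \<open>Second order moments\<close>

lemma conn2D: "conn X {f, g} \<Longrightarrow> S \<subseteq> X \<Longrightarrow> f ` S \<subseteq> S \<Longrightarrow> g ` S \<subseteq> S \<Longrightarrow> S = {} \<or> S = X"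
  by (simp add: conn_def)

text \<open>A proper invariant set \<open>S\<close> gives the common upper bound
  \<open>{S, X - S}\<close> of the two partitions; conversely, each block of the join is invariant
  under both maps.\<close>

lemma partition_join_eq_iff:
  assumes "finite X" "X \<noteq> {}" "bij_betw f X X" "bij_betw g X X"
  shows "partition_join X (perm_cycles X f) (perm_cycles X g) = {X} \<longleftrightarrow> conn X {f, g}"
proof -
  let ?P = "perm_cycles X f" and ?Q = "perm_cycles X g"
  let ?J = "partition_join X ?P ?Q"
  have PQ: "partition_on X ?P" "partition_on X ?Q" using partition_on_perm_cycles assms by auto
  note J = partition_join_least[OF PQ assms(2)]
  have inv: "k ` W \<subseteq> W" if k: "bij_betw k X X" and r: "refines X (perm_cycles X k) T" and W: "W \<in> T" for k T W
  proof
    have T: "partition_on X T" using r by (simp add: refines_def)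
    fix y assume "y \<in> k ` W"
    then obtain x where x: "x \<in> W" "y = k x" by blast
    have xX: "x \<in> X" using x W partition_onD1[OF T] by blast
    then have "orbit k x \<in> perm_cycles X k" by (simp add: perm_cycles_def)
    then obtain W' where W': "W' \<in> T" "orbit k x \<subseteq> W'" using r by (auto simp: refines_def)
    have "x \<in> W'" "y \<in> W'" using W'(2) self_in_orbit[OF assms(1) k xX] orbit.base[of k x] x by auto
    then show "y \<in> W" using block_unique[OF T W'(1) W] x by blast
  qed
  show ?thesis
  proof
    assume eq: "?J = {X}"
    show "conn X {f, g}"
    proof (rule connI, rule ccontr)
      fix S assume S: "S \<subseteq> X" "\<And>k. k \<in> {f, g} \<Longrightarrow> k ` S \<subseteq> S" "\<not> (S = {} \<or> S = X)"
      have part: "partition_on X {S, X - S}"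
        using S by (auto simp: partition_on_def disjoint_def)
      have ref: "refines X (perm_cycles X k) {S, X - S}" if k: "bij_betw k X X" "k ` S \<subseteq> S" for k
      proof -
        have kS: "bij_betw k S S" using bij_betw_invariant[OF _ S(1) k] assms(1) S(1) finite_subset by blast
        have kXS: "bij_betw k (X - S) (X - S)" using perm_cycles_Diff[OF assms(1) k(1) S(1) kS] by simp
        have "C \<subseteq> S \<or> C \<subseteq> X - S" if "C \<in> perm_cycles X k" for C
        proof -
          have "perm_cycles X k = perm_cycles S k \<union> perm_cycles (X - S) k"
            using perm_cycles_Un[of S "X - S" k] S(1) by (simp add: Un_absorb1)
          then show ?thesis using that perm_cycles_subset[OF kS] perm_cycles_subset[OF kXS] by blast
        qed
        then show ?thesis using part partition_on_perm_cycles[OF assms(1) k(1)] by (auto simp: refines_def)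
      qed
      have "f ` S \<subseteq> S" "g ` S \<subseteq> S" using S(2) by auto
      then have "refines X ?J {S, X - S}" using J(3) ref assms(3,4) by blast
      then show False using eq S by (auto simp: refines_def)
    qed
  next
    assume c: "conn X {f, g}"
    have T: "partition_on X ?J" using J(1) by (simp add: refines_def)
    have "W = X" if W: "W \<in> ?J" for W
    proof -
      have "W \<subseteq> X" "W \<noteq> {}" using W T by (auto simp: partition_on_def)
      then show ?thesis using connD[OF c, of W] inv[OF assms(3) J(1) W] inv[OF assms(4) J(2) W] by auto
    qed
    moreover have "?J \<noteq> {}" using partition_onD1[OF T] assms(2) by auto
    ultimately show "?J = {X}" by blast
  qed
qed

lemma S_NC_eq_ann:
  assumes "p \<ge> 1" "q \<ge> 1"
  shows "S_NC p q = ann {1..p+q} (annular_gamma p q)"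
proof -
  interpret two_cycles "{1..p}" "{p+1..p+q}" "{1..p+q}" "annular_gamma p q"
    using assms by (rule two_cycles_annular)
  show ?thesis
    unfolding S_NC_def ann_def using partition_join_eq_iff[OF finite_X _ permutes_imp_bij bij_X] assms by auto
qed

lemma support_cycle:
  assumes "finite X" "\<pi> permutes X" "V \<in> perm_cycles X \<pi>" "x \<in> V"
  shows "set (support \<pi> x) = V" "distinct (support \<pi> x)"
proof -
  have p: "permutation \<pi>" using assms permutes_imp_permutation by blast
  have b: "bij_betw \<pi> X X" using assms(2) by (rule permutes_imp_bij)
  have "x \<in> X" using assms(3,4) perm_cycles_subset[OF b] by blast
  then have "orbit \<pi> x \<in> perm_cycles X \<pi>" "x \<in> orbit \<pi> x"
    using self_in_orbit[OF assms(1) b] by (auto simp: perm_cycles_def)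
  then have "orbit \<pi> x = V" using block_unique[OF partition_on_perm_cycles[OF assms(1) b]] assms(3,4) by metis
  then show "set (support \<pi> x) = V" unfolding support_set[OF p] orbit_altdef_permutation[OF p] by auto
  show "distinct (support \<pi> x)" by (rule cycle_of_permutation[OF p])
qed

context two_cycles
begin

lemma perm_cycles_LR: "perm_cycles X \<alpha> = perm_cycles L \<alpha> \<union> perm_cycles R \<alpha>"
  unfolding X by (rule perm_cycles_Un)

end

text \<open>A geodesic below \<open>annular_gamma\<close> is a pair of geodesics below the two long
  cycles, hence a pair of non-crossing partitions. \<open>F\<close> takes both partitions and both
  complements, so that \<open>S_NC'\<close> and the last two sums of the theorem are all
  covered.\<close>

lemma sum_NC_pair:
  assumes "p \<ge> 1" "q \<ge> 1"
  defines "L \<equiv> {1..p}" and "R \<equiv> {p+1..p+q}" and "X \<equiv> {1..p+q}" and "\<gamma> \<equiv> annular_gamma p q"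
  shows "(\<Sum>(P1, P2)\<in>NC L \<times> NC R. F P1 (kreweras L P1) P2 (kreweras R P2)) =
    (\<Sum>\<alpha>\<in>geo X \<gamma>. F (perm_cycles L \<alpha>) (perm_cycles L (inv \<alpha> \<circ> \<gamma>)) (perm_cycles R \<alpha>) (perm_cycles R (inv \<alpha> \<circ> \<gamma>)))"
proof -
  interpret two_cycles L R X \<gamma> unfolding L_def R_def X_def \<gamma>_def using assms by (intro two_cycles_annular)
  have geo_eq: "geo L \<gamma> = geo L (gamma L)" "geo R \<gamma> = geo R (gamma R)"
    using geo_cong[OF bij_L] geo_cong[OF bij_R] annular_gamma_eq by (auto simp: L_def R_def \<gamma>_def)
  have cyc: "perm_cycles L (inv a \<circ> gamma L) = perm_cycles L (inv a \<circ> \<gamma>)" if "a permutes L" for a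
    by (rule perm_cycles_cong[symmetric, OF bij_betw_inv_comp[OF that bij_L]]) (simp add: annular_gamma_eq(1) L_def \<gamma>_def)
  have cyc': "perm_cycles R (inv a \<circ> gamma R) = perm_cycles R (inv a \<circ> \<gamma>)" if "a permutes R" for a
    by (rule perm_cycles_cong[symmetric, OF bij_betw_inv_comp[OF that bij_R]]) (simp add: annular_gamma_eq(2) R_def \<gamma>_def)
  have "(\<Sum>(P1, P2)\<in>NC L \<times> NC R. F P1 (kreweras L P1) P2 (kreweras R P2)) =
      (\<Sum>P1\<in>NC L. \<Sum>P2\<in>NC R. F P1 (kreweras L P1) P2 (kreweras R P2))"
    by (simp add: sum.cartesian_product)
  also have "\<dots> = (\<Sum>P1\<in>NC L. \<Sum>b\<in>geo R (gamma R). F P1 (kreweras L P1) (perm_cycles R b) (perm_cycles R (inv b \<circ> gamma R)))"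
    by (intro sum.cong refl sum_NC fin)
  also have "\<dots> = (\<Sum>a\<in>geo L (gamma L). \<Sum>b\<in>geo R (gamma R).
      F (perm_cycles L a) (perm_cycles L (inv a \<circ> gamma L)) (perm_cycles R b) (perm_cycles R (inv b \<circ> gamma R)))"
    by (rule sum_NC[OF fin(1)])
  also have "\<dots> = (\<Sum>a\<in>geo L \<gamma>. \<Sum>b\<in>geo R \<gamma>. F (perm_cycles L (a \<circ> b)) (perm_cycles L (inv (a \<circ> b) \<circ> \<gamma>))
      (perm_cycles R (a \<circ> b)) (perm_cycles R (inv (a \<circ> b) \<circ> \<gamma>)))"
    unfolding geo_eq
  proof (intro sum.cong refl)
    fix a b assume "a \<in> geo L (gamma L)" "b \<in> geo R (gamma R)"
    then have p: "a permutes L" "b permutes R" by (auto simp: geo_def)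
    show "F (perm_cycles L a) (perm_cycles L (inv a \<circ> gamma L)) (perm_cycles R b) (perm_cycles R (inv b \<circ> gamma R)) =
      F (perm_cycles L (a \<circ> b)) (perm_cycles L (inv (a \<circ> b) \<circ> \<gamma>)) (perm_cycles R (a \<circ> b)) (perm_cycles R (inv (a \<circ> b) \<circ> \<gamma>))"
      unfolding perm_cycles_comp_disjoint[OF LR p bij_L bij_R] cyc[OF p(1)] cyc'[OF p(2)] ..
  qed
  also have "\<dots> = (\<Sum>\<alpha>\<in>geo X \<gamma>. F (perm_cycles L \<alpha>) (perm_cycles L (inv \<alpha> \<circ> \<gamma>)) (perm_cycles R \<alpha>) (perm_cycles R (inv \<alpha> \<circ> \<gamma>)))"
    unfolding X by (rule sum_geo_Un[OF fin LR bij_L bij_R, symmetric])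
  finally show ?thesis .
qed

text \<open>An element of \<open>S_NC'\<close> amounts to two non-crossing partitions with a chosen
  block in each. The partitions are recovered as the blocks inside either circle, the chosen blocks
  from \<open>P - \<U>\<close>.\<close>

lemma sum_S_NC':
  assumes "p \<ge> 1" "q \<ge> 1"
  shows "(\<Sum>(\<U>, P)\<in>S_NC' p q. let A = \<Union>(P - \<U>) \<inter> {1..p}; B = \<Union>(P - \<U>) \<inter> {p+1..p+q} in G A B P) =
    (\<Sum>\<alpha>\<in>geo {1..p+q} (annular_gamma p q). \<Sum>A\<in>perm_cycles {1..p} \<alpha>. \<Sum>B\<in>perm_cycles {p+1..p+q} \<alpha>.
       G A B (perm_cycles {1..p+q} \<alpha>))"
proof -
  let ?L = "{1..p}" and ?R = "{p+1..p+q}"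
  interpret two_cycles ?L ?R "{1..p+q}" "annular_gamma p q"
    using assms by (rule two_cycles_annular)
  let ?D = "SIGMA z:NC ?L \<times> NC ?R. fst z \<times> snd z"
  have P_eq: "(P1 \<union> P2) \<inter> Pow ?L = P1" "(P1 \<union> P2) \<inter> Pow ?R = P2" if "P1 \<in> NC ?L" "P2 \<in> NC ?R" for P1 P2
  proof -
    have "V \<subseteq> ?L \<and> V \<noteq> {}" if "V \<in> P1" for V using NC_block[OF _ \<open>P1 \<in> NC ?L\<close> that] by simp
    moreover have "V \<subseteq> ?R \<and> V \<noteq> {}" if "V \<in> P2" for V using NC_block[OF _ \<open>P2 \<in> NC ?R\<close> that] by simp
    ultimately show "(P1 \<union> P2) \<inter> Pow ?L = P1" "(P1 \<union> P2) \<inter> Pow ?R = P2" using LR by blast+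
  qed
  have "(\<Sum>(\<U>, P)\<in>S_NC' p q. let A = \<Union>(P - \<U>) \<inter> ?L; B = \<Union>(P - \<U>) \<inter> ?R in G A B P) =
      (\<Sum>((P1, P2), (A, B))\<in>?D. G A B (P1 \<union> P2))"
  proof (rule sum.reindex_bij_witness[where
        i = "\<lambda>((P1, P2), (A, B)). (insert (A \<union> B) (P1 \<union> P2 - {A, B}), P1 \<union> P2)" and
        j = "\<lambda>(\<U>, P). ((P \<inter> Pow ?L, P \<inter> Pow ?R), (\<Union>(P - \<U>) \<inter> ?L, \<Union>(P - \<U>) \<inter> ?R))"])
    fix z assume z: "z \<in> S_NC' p q"
    obtain \<U> P where zz: "z = (\<U>, P)" by (cases z)
    obtain P1 P2 A B where *: "P1 \<in> NC ?L" "P2 \<in> NC ?R" "A \<in> P1" "B \<in> P2"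
      "P = P1 \<union> P2" "\<U> = insert (A \<union> B) (P - {A, B})" "P - \<U> = {A, B}"
      "\<Union>(P - \<U>) \<inter> ?L = A" "\<Union>(P - \<U>) \<inter> ?R = B"
      using S_NC'_merged z zz by metis
    have j: "(case z of (\<U>, P) \<Rightarrow> ((P \<inter> Pow ?L, P \<inter> Pow ?R), (\<Union>(P - \<U>) \<inter> ?L, \<Union>(P - \<U>) \<inter> ?R))) = ((P1, P2), (A, B))"
      using zz *(8,9) P_eq[OF *(1,2)] *(5) by simp
    show "(\<lambda>((P1, P2), (A, B)). (insert (A \<union> B) (P1 \<union> P2 - {A, B}), P1 \<union> P2))
        (case z of (\<U>, P) \<Rightarrow> ((P \<inter> Pow ?L, P \<inter> Pow ?R), (\<Union>(P - \<U>) \<inter> ?L, \<Union>(P - \<U>) \<inter> ?R))) = z"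
      unfolding j using zz * by simp
    show "(case z of (\<U>, P) \<Rightarrow> ((P \<inter> Pow ?L, P \<inter> Pow ?R), (\<Union>(P - \<U>) \<inter> ?L, \<Union>(P - \<U>) \<inter> ?R))) \<in> ?D"
      unfolding j using * by simp
    show "(\<lambda>((P1, P2), (A, B)). G A B (P1 \<union> P2)) (case z of (\<U>, P) \<Rightarrow> ((P \<inter> Pow ?L, P \<inter> Pow ?R), (\<Union>(P - \<U>) \<inter> ?L, \<Union>(P - \<U>) \<inter> ?R))) =
        (case z of (\<U>, P) \<Rightarrow> let A = \<Union>(P - \<U>) \<inter> ?L; B = \<Union>(P - \<U>) \<inter> ?R in G A B P)"
      unfolding j using zz * by simp
  next
    fix w assume "w \<in> ?D"
    then obtain P1 P2 A B where w: "w = ((P1, P2), (A, B))" "P1 \<in> NC ?L" "P2 \<in> NC ?R" "A \<in> P1" "B \<in> P2"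
      by auto
    let ?\<U> = "insert (A \<union> B) (P1 \<union> P2 - {A, B})" and ?P = "P1 \<union> P2"
    have mem: "(?\<U>, ?P) \<in> S_NC' p q" unfolding S_NC'_def using w(2-5) by blast
    show "(\<lambda>((P1, P2), (A, B)). (insert (A \<union> B) (P1 \<union> P2 - {A, B}), P1 \<union> P2)) w \<in> S_NC' p q"
      using mem w(1) by simp
    have AB: "A \<subseteq> ?L" "B \<subseteq> ?R" "A \<noteq> {}" "B \<noteq> {}"
      using NC_block[OF _ w(2,4)] NC_block[OF _ w(3,5)] by auto
    have "A \<union> B \<notin> ?P"
    proof
      assume "A \<union> B \<in> ?P"
      then have "A \<union> B \<subseteq> ?L \<or> A \<union> B \<subseteq> ?R" using NC_block[OF _ w(2)] NC_block[OF _ w(3)] by blast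
      then show False using AB LR by blast
    qed
    then have "?P - ?\<U> = {A, B}" using w(4,5) by auto
    then have "\<Union>(?P - ?\<U>) = A \<union> B" by simp
    moreover have "(A \<union> B) \<inter> ?L = A" "(A \<union> B) \<inter> ?R = B" using AB(1,2) LR by blast+
    ultimately have "\<Union>(?P - ?\<U>) \<inter> ?L = A" "\<Union>(?P - ?\<U>) \<inter> ?R = B" by (simp_all only:)
    then show "(case (\<lambda>((P1, P2), (A, B)). (insert (A \<union> B) (P1 \<union> P2 - {A, B}), P1 \<union> P2)) w of
        (\<U>, P) \<Rightarrow> ((P \<inter> Pow ?L, P \<inter> Pow ?R), (\<Union>(P - \<U>) \<inter> ?L, \<Union>(P - \<U>) \<inter> ?R))) = w"
      using w(1) P_eq[OF w(2,3)] by simp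
  qed
  also have "\<dots> = (\<Sum>z\<in>NC ?L \<times> NC ?R. \<Sum>y\<in>fst z \<times> snd z. case z of (P1, P2) \<Rightarrow> case y of (A, B) \<Rightarrow> G A B (P1 \<union> P2))"
  proof -
    have f: "finite P" if "P \<in> NC ?L \<or> P \<in> NC ?R" for P
      using that finite_elements[OF fin(1) NC_D(1)] finite_elements[OF fin(2) NC_D(1)] by blast
    have "(\<Sum>z\<in>NC ?L \<times> NC ?R. \<Sum>y\<in>fst z \<times> snd z. case z of (P1, P2) \<Rightarrow> case y of (A, B) \<Rightarrow> G A B (P1 \<union> P2)) =
      (\<Sum>(z, y)\<in>?D. case z of (P1, P2) \<Rightarrow> case y of (A, B) \<Rightarrow> G A B (P1 \<union> P2))"
      by (intro sum.Sigma finite_cartesian_product finite_NC ballI) (auto intro: f)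
    then show ?thesis by (simp add: case_prod_unfold)
  qed
  also have "\<dots> = (\<Sum>(P1, P2)\<in>NC ?L \<times> NC ?R. \<Sum>A\<in>P1. \<Sum>B\<in>P2. G A B (P1 \<union> P2))"
    by (intro sum.cong refl) (auto simp: sum.cartesian_product)
  also have "\<dots> = (\<Sum>\<alpha>\<in>geo {1..p+q} (annular_gamma p q). \<Sum>A\<in>perm_cycles ?L \<alpha>. \<Sum>B\<in>perm_cycles ?R \<alpha>.
       G A B (perm_cycles ?L \<alpha> \<union> perm_cycles ?R \<alpha>))"
    by (rule sum_NC_pair[OF assms, of "\<lambda>P1 _ P2 _. \<Sum>A\<in>P1. \<Sum>B\<in>P2. G A B (P1 \<union> P2)"])
  finally show ?thesis unfolding perm_cycles_LR .
qed

lemma entries_mono_replicate: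
  assumes "set is \<subseteq> {1..n}"
  shows "free_cumulant \<phi> (entries (replicate n c) is) = kappa \<phi> c (length is)"
  using assms by (subst entries_replicate) (auto simp: kappa_def)

text \<open>All arguments are equal, so only the sizes of the cycles enter, whatever the order in
  which a cycle is listed.\<close>

lemma second_order_moment_replicate:
  assumes "n \<ge> 1" "m \<ge> 1"
  shows "\<phi>2 (prod_list (replicate n c)) (prod_list (replicate m c)) =
    (\<Sum>\<pi>\<in>ann {1..n+m} (annular_gamma n m). wt (kappa \<phi> c) (perm_cycles {1..n+m} \<pi>)) +
    (\<Sum>\<sigma>\<in>geo {1..n+m} (annular_gamma n m). pair_wt (kappa \<phi> c) (kappa2 \<phi> \<phi>2 c) {1..n+m} {1..n} {n+1..n+m} \<sigma>)"
proof -
  let ?xs = "replicate n c" and ?ys = "replicate m c"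
  let ?X = "{1..n+m}" and ?L = "{1..n}" and ?R = "{n+1..n+m}"
  interpret two_cycles ?L ?R ?X "annular_gamma n m"
    using assms by (rule two_cycles_annular)
  have xy: "?xs @ ?ys = replicate (n + m) c" by (rule replicate_add[symmetric])
  have block: "finite V \<and> V \<subseteq> ?X" if "\<alpha> permutes ?X" "V \<in> perm_cycles ?X \<alpha>" for V \<alpha>
    using perm_cycles_subset[OF permutes_imp_bij[OF that(1)] that(2)] finite_subset by blast
  have mono: "free_cumulant \<phi> (entries (?xs @ ?ys) (sorted_list_of_set V)) = kappa \<phi> c (card V)"
    if "finite V \<and> V \<subseteq> ?X" for V
    unfolding xy using that by (subst entries_mono_replicate) auto
  have first: "(\<Prod>V\<in>perm_cycles ?X \<pi>. free_cumulant \<phi> (entries (?xs @ ?ys) (support \<pi> (Min V)))) =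
      wt (kappa \<phi> c) (perm_cycles ?X \<pi>)" if "\<pi> \<in> ann ?X (annular_gamma n m)" for \<pi>
    unfolding wt_def
  proof (rule prod.cong[OF refl])
    fix V assume V: "V \<in> perm_cycles ?X \<pi>"
    have \<pi>: "\<pi> permutes ?X" using that by (simp add: ann_def)
    have "Min V \<in> V" using block[OF \<pi> V] perm_cycles_nonempty[OF V] by (intro Min_in) auto
    note s = support_cycle[OF finite_X \<pi> V this]
    show "free_cumulant \<phi> (entries (?xs @ ?ys) (support \<pi> (Min V))) = kappa \<phi> c (card V)"
      unfolding xy using s block[OF \<pi> V] distinct_card[OF s(2)]
      by (subst entries_mono_replicate) auto
  qed
  have fc2: "free_cumulant2 \<phi> \<phi>2 (entries (?xs @ ?ys) (sorted_list_of_set A)) (entries (?xs @ ?ys) (sorted_list_of_set B)) =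
      kappa2 \<phi> \<phi>2 c (card A) (card B)" if "finite A" "A \<subseteq> ?X" "finite B" "B \<subseteq> ?X" for A B
  proof -
    have "entries (?xs @ ?ys) (sorted_list_of_set A) = replicate (card A) c"
      "entries (?xs @ ?ys) (sorted_list_of_set B) = replicate (card B) c"
      unfolding xy using that by (subst entries_replicate; auto)+
    then show ?thesis by (simp add: kappa2_def)
  qed
  have second: "(\<Sum>A\<in>perm_cycles ?L \<alpha>. \<Sum>B\<in>perm_cycles ?R \<alpha>.
      free_cumulant2 \<phi> \<phi>2 (entries (?xs @ ?ys) (sorted_list_of_set A)) (entries (?xs @ ?ys) (sorted_list_of_set B))
      * (\<Prod>V\<in>perm_cycles ?X \<alpha> - {A, B}. free_cumulant \<phi> (entries (?xs @ ?ys) (sorted_list_of_set V)))) =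
      pair_wt (kappa \<phi> c) (kappa2 \<phi> \<phi>2 c) ?X ?L ?R \<alpha>" if "\<alpha> \<in> geo ?X (annular_gamma n m)" for \<alpha>
    unfolding pair_wt_def
  proof (intro sum.cong refl)
    fix A B assume AB: "A \<in> perm_cycles ?L \<alpha>" "B \<in> perm_cycles ?R \<alpha>"
    have \<alpha>: "\<alpha> permutes ?X" using that by (simp add: geo_def)
    have "A \<in> perm_cycles ?X \<alpha>" "B \<in> perm_cycles ?X \<alpha>" unfolding perm_cycles_LR using AB by auto
    then have "finite A \<and> A \<subseteq> ?X" "finite B \<and> B \<subseteq> ?X" using block[OF \<alpha>] by auto
    moreover have "(\<Prod>V\<in>perm_cycles ?X \<alpha> - {A, B}. free_cumulant \<phi> (entries (?xs @ ?ys) (sorted_list_of_set V))) =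
        wt (kappa \<phi> c) (perm_cycles ?X \<alpha> - {A, B})"
      unfolding wt_def by (intro prod.cong refl mono block[OF \<alpha>]) simp
    ultimately show "free_cumulant2 \<phi> \<phi>2 (entries (?xs @ ?ys) (sorted_list_of_set A)) (entries (?xs @ ?ys) (sorted_list_of_set B))
      * (\<Prod>V\<in>perm_cycles ?X \<alpha> - {A, B}. free_cumulant \<phi> (entries (?xs @ ?ys) (sorted_list_of_set V))) =
      kappa2 \<phi> \<phi>2 c (card A) (card B) * wt (kappa \<phi> c) (perm_cycles ?X \<alpha> - {A, B})"
      using fc2 by simp
  qed
  have "?xs \<noteq> []" "?ys \<noteq> []" using assms by auto
  from second_order_moment_cumulant[OF this, of \<phi>2 \<phi>]
  have "\<phi>2 (prod_list ?xs) (prod_list ?ys) =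
     (\<Sum>\<pi>\<in>S_NC n m. \<Prod>V\<in>perm_cycles ?X \<pi>. free_cumulant \<phi> (entries (?xs @ ?ys) (support \<pi> (Min V)))) +
     (\<Sum>(\<U>, P)\<in>S_NC' n m. let A = \<Union>(P - \<U>) \<inter> ?L; B = \<Union>(P - \<U>) \<inter> ?R in
          free_cumulant2 \<phi> \<phi>2 (entries (?xs @ ?ys) (sorted_list_of_set A)) (entries (?xs @ ?ys) (sorted_list_of_set B))
          * (\<Prod>V\<in>P - {A, B}. free_cumulant \<phi> (entries (?xs @ ?ys) (sorted_list_of_set V))))"
    unfolding length_replicate .
  then show ?thesis
    unfolding S_NC_eq_ann[OF assms] sum_S_NC'[OF assms] using first second by simp
qed

section \<open>Alternating words on two circles\<close>

context doubling
begin

text \<open>An invariant set of positions has traces \<open>S\<close> and \<open>S'\<close> on the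
  two letters. Following \<open>\<gamma>2\<close> shows that \<open>S\<close> is contained in
  \<open>S'\<close> and that \<open>\<gamma>\<close> maps \<open>S'\<close> into \<open>S\<close>.
  By finiteness the traces agree, and they are invariant under all three permutations.\<close>

lemma conn_dbl:
  assumes p: "\<alpha> permutes X" "\<beta> permutes X"
  shows "conn X2 {dbl X u v \<alpha> \<beta>, \<gamma>2} \<longleftrightarrow> conn X {\<alpha>, \<beta>, \<gamma>}"
proof
  let ?d = "dbl X u v \<alpha> \<beta>"
  assume c: "conn X2 {?d, \<gamma>2}"
  show "conn X {\<alpha>, \<beta>, \<gamma>}"
  proof (rule connI)
    fix S assume S: "S \<subseteq> X" "\<And>f. f \<in> {\<alpha>, \<beta>, \<gamma>} \<Longrightarrow> f ` S \<subseteq> S"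
    have inv: "\<alpha> x \<in> S" "\<beta> x \<in> S" "\<gamma> x \<in> S" if "x \<in> S" for x using S(2) that by blast+
    let ?T = "u ` S \<union> v ` S"
    have "?d ` ?T \<subseteq> ?T"
    proof
      fix y assume "y \<in> ?d ` ?T"
      then obtain x where x: "x \<in> S" "y = ?d (u x) \<or> y = ?d (v x)" by auto
      then show "y \<in> ?T" using dbl_apply(1,2)[OF p, of x] S(1) inv by auto
    qed
    moreover have "\<gamma>2 ` ?T \<subseteq> ?T"
    proof
      fix y assume "y \<in> \<gamma>2 ` ?T"
      then obtain x where x: "x \<in> S" "y = \<gamma>2 (u x) \<or> y = \<gamma>2 (v x)" by auto
      then show "y \<in> ?T" using \<gamma>2_u[of x] \<gamma>2_v[of x] S(1) inv by auto
    qed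
    moreover have "?T \<subseteq> X2" using S(1) by auto
    ultimately have T: "?T = {} \<or> ?T = X2" by (intro conn2D[OF c])
    show "S = {} \<or> S = X"
    proof (cases "S = {}")
      case False
      then have T: "?T = X2" using T by auto
      have "x \<in> S" if x: "x \<in> X" for x
      proof -
        have "u x \<in> ?T" unfolding T using x by blast
        then have "u x \<in> u ` S" using u_neq_v[OF x] S(1) by auto
        then show ?thesis using inj_on_image_mem_iff[OF inj_u x S(1)] by simp
      qed
      then show ?thesis using S(1) by auto
    qed simp
  qed
next
  let ?d = "dbl X u v \<alpha> \<beta>"
  assume c: "conn X {\<alpha>, \<beta>, \<gamma>}"
  show "conn X2 {?d, \<gamma>2}"
  proof (rule connI)
    fix T assume T: "T \<subseteq> X2" "\<And>f. f \<in> {?d, \<gamma>2} \<Longrightarrow> f ` T \<subseteq> T"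
    have inv: "?d y \<in> T" "\<gamma>2 y \<in> T" if "y \<in> T" for y using T(2) that by blast+
    define S where "S = {x\<in>X. u x \<in> T}"
    define S' where "S' = {x\<in>X. v x \<in> T}"
    have \<gamma>X: "\<gamma> x \<in> X" if "x \<in> X" for x using that bij_\<gamma> by (auto simp: bij_betw_def)
    have SS': "S \<subseteq> S'" using inv(2) \<gamma>2_u by (force simp: S_def S'_def)
    have \<gamma>S': "\<gamma> ` S' \<subseteq> S" using inv(2) \<gamma>2_v \<gamma>X by (force simp: S_def S'_def)
    have "bij_betw \<gamma> S' S'"
      using \<gamma>S' SS' finite_X by (intro bij_betw_invariant[OF _ _ bij_\<gamma>]) (auto simp: S'_def)
    then have "S' \<subseteq> S" using \<gamma>S' by (simp add: bij_betw_def)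
    then have eq: "S' = S" using SS' by simp
    have "\<alpha> ` S \<subseteq> S"
    proof
      fix y assume "y \<in> \<alpha> ` S"
      then obtain x where x: "x \<in> X" "u x \<in> T" "y = \<alpha> x" by (auto simp: S_def)
      then show "y \<in> S" using inv(1)[OF x(2)] dbl_apply(1)[OF p x(1)] permutes_in_image[OF p(1)] by (simp add: S_def)
    qed
    moreover have "\<beta> ` S' \<subseteq> S'"
    proof
      fix y assume "y \<in> \<beta> ` S'"
      then obtain x where x: "x \<in> X" "v x \<in> T" "y = \<beta> x" by (auto simp: S'_def)
      then show "y \<in> S'" using inv(1)[OF x(2)] dbl_apply(2)[OF p x(1)] permutes_in_image[OF p(2)] by (simp add: S'_def)
    qed
    ultimately have S: "S = {} \<or> S = X" using \<gamma>S' eq by (intro connD[OF c]) (auto simp: S_def)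
    have T_eq: "T = u ` S \<union> v ` S'" using T(1) by (auto simp: S_def S'_def)
    show "T = {} \<or> T = X2" using S unfolding T_eq eq by auto
  qed
qed

lemma dbl_ann_iff:
  assumes "\<alpha> permutes X" "\<beta> permutes X"
  shows "dbl X u v \<alpha> \<beta> \<in> ann X2 \<gamma>2 \<longleftrightarrow> (\<alpha>, \<beta>) \<in> tri2 X \<gamma>"
  using assms dbl_permutes[OF assms] by (simp add: ann_def tri2_def nc_dbl nc_inv_dbl conn_dbl card_X2)

lemma sum_ann_letter_wt:
  "(\<Sum>\<pi>\<in>ann X2 \<gamma>2. \<Prod>V\<in>perm_cycles X2 \<pi>. letter_wt f g V)
    = (\<Sum>(\<alpha>, \<beta>)\<in>tri2 X \<gamma>. wt f (perm_cycles X \<alpha>) * wt g (perm_cycles X \<beta>))"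
proof -
  have g: "ann X2 \<gamma>2 = {\<pi>. \<pi> permutes X2 \<and> \<pi> \<in> ann X2 \<gamma>2}" by (auto simp: ann_def)
  have t: "{(\<alpha>, \<beta>). \<alpha> permutes X \<and> \<beta> permutes X \<and> dbl X u v \<alpha> \<beta> \<in> ann X2 \<gamma>2} = tri2 X \<gamma>"
    using dbl_ann_iff by (auto simp: tri2_def)
  have "(\<Sum>\<pi>\<in>ann X2 \<gamma>2. \<Prod>V\<in>perm_cycles X2 \<pi>. letter_wt f g V) =
      (\<Sum>(\<alpha>, \<beta>)\<in>tri2 X \<gamma>. \<Prod>V\<in>perm_cycles X2 (dbl X u v \<alpha> \<beta>). letter_wt f g V)"
    by (subst g, subst sum_dbl[OF prod_letter_wt_zero]) (simp_all add: t)
  also have "\<dots> = (\<Sum>(\<alpha>, \<beta>)\<in>tri2 X \<gamma>. wt f (perm_cycles X \<alpha>) * wt g (perm_cycles X \<beta>))"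
    by (intro sum.cong refl) (auto simp: tri2_def prod_letter_wt_dbl)
  finally show ?thesis .
qed

text \<open>A pair is also mixed if each cycle carries a single letter but the letters differ; for
  nonempty cycles neither branch applies then and the value is 0.\<close>

definition letter_wt2 :: "(nat \<Rightarrow> nat \<Rightarrow> complex) \<Rightarrow> (nat \<Rightarrow> nat \<Rightarrow> complex) \<Rightarrow> 'y set \<Rightarrow> 'y set \<Rightarrow> complex" where
  "letter_wt2 f2 g2 A B = (if A \<subseteq> u ` X \<and> B \<subseteq> u ` X then f2 (card A) (card B)
     else if A \<subseteq> v ` X \<and> B \<subseteq> v ` X then g2 (card A) (card B) else 0)"

definition letter_pair_wt where
  "letter_pair_wt f f2 g g2 L2 R2 \<pi> = (\<Sum>A\<in>perm_cycles L2 \<pi>. \<Sum>B\<in>perm_cycles R2 \<pi>.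
     letter_wt2 f2 g2 A B * (\<Prod>V\<in>perm_cycles X2 \<pi> - {A, B}. letter_wt f g V))"

lemma letter_pair_wt_zero:
  assumes "\<pi> permutes X2" "\<not> bij_betw \<pi> (u ` X) (u ` X)"
  shows "letter_pair_wt f f2 g g2 L2 R2 \<pi> = 0"
  unfolding letter_pair_wt_def
proof (intro sum.neutral ballI)
  obtain V where V: "V \<in> perm_cycles X2 \<pi>" "\<not> V \<subseteq> u ` X" "\<not> V \<subseteq> v ` X"
    using cycles_mono[OF assms(1)] assms(2) by blast
  fix A B
  show "letter_wt2 f2 g2 A B * (\<Prod>V\<in>perm_cycles X2 \<pi> - {A, B}. letter_wt f g V) = 0"
  proof (cases "V \<in> {A, B}")
    case True
    then have "letter_wt2 f2 g2 A B = 0" using V(2,3) by (auto simp: letter_wt2_def)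
    then show ?thesis by simp
  next
    case False
    have "(\<Prod>V\<in>perm_cycles X2 \<pi> - {A, B}. letter_wt f g V) = 0"
    proof (rule prod_zero)
      show "finite (perm_cycles X2 \<pi> - {A, B})" using finite_X2 by simp
      have "letter_wt f g V = 0" using V(2,3) by (simp add: letter_wt_def)
      then show "\<exists>V\<in>perm_cycles X2 \<pi> - {A, B}. letter_wt f g V = 0" using V(1) False by blast
    qed
    then show ?thesis by simp
  qed
qed

lemma sum_cycles_dbl:
  assumes p: "\<alpha> permutes X" "\<beta> permutes X" and S: "S \<subseteq> X" "bij_betw \<alpha> S S" "bij_betw \<beta> S S"
  shows "(\<Sum>A\<in>perm_cycles (u ` S \<union> v ` S) (dbl X u v \<alpha> \<beta>). F A) =
    (\<Sum>U\<in>perm_cycles S \<alpha>. F (u ` U)) + (\<Sum>U\<in>perm_cycles S \<beta>. F (v ` U))"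
proof -
  have sub: "C \<subseteq> X" "C \<noteq> {}" if "C \<in> perm_cycles S \<alpha> \<or> C \<in> perm_cycles S \<beta>" for C
    using that perm_cycles_subset[OF S(2)] perm_cycles_subset[OF S(3)] perm_cycles_nonempty S(1) by blast+
  have cyc: "perm_cycles (u ` S) (dbl X u v \<alpha> \<beta>) = (`) u ` perm_cycles S \<alpha>"
    "perm_cycles (v ` S) (dbl X u v \<alpha> \<beta>) = (`) v ` perm_cycles S \<beta>"
    using cycles_dbl[OF p S(1)] S(2,3) by (auto simp: bij_betw_def)
  have inj: "inj_on ((`) u) (perm_cycles S \<alpha>)" "inj_on ((`) v) (perm_cycles S \<beta>)"
    using S inj_u inj_v by (auto intro!: inj_on_image_cycles intro: inj_on_subset)
  have "(`) u ` perm_cycles S \<alpha> \<inter> (`) v ` perm_cycles S \<beta> = {}"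
    by (rule images_disjoint) (use sub in auto)
  moreover have "finite S" using S(1) finite_X finite_subset by blast
  ultimately show ?thesis
    by (simp add: perm_cycles_Un cyc sum.union_disjoint sum.reindex[OF inj(1)] sum.reindex[OF inj(2)])
qed

text \<open>The two merged cycles must carry the same letter, since \<open>letter_wt2\<close>
  vanishes otherwise. Two \<open>a\<close>-cycles are a merged pair of \<open>\<alpha>\<close>, two
  \<open>b\<close>-cycles a merged pair of \<open>\<beta>\<close>.\<close>

lemma letter_pair_wt_dbl:
  assumes tc: "two_cycles L R X \<gamma>" and t: "(\<alpha>, \<beta>) \<in> tri X \<gamma>"
  shows "letter_pair_wt f f2 g g2 (u ` L \<union> v ` L) (u ` R \<union> v ` R) (dbl X u v \<alpha> \<beta>) =
    pair_wt f f2 X L R \<alpha> * wt g (perm_cycles X \<beta>) + wt f (perm_cycles X \<alpha>) * pair_wt g g2 X L R \<beta>"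
proof -
  interpret two_cycles L R X \<gamma> by fact
  note b = tri_invariant_LR[OF t]
  let ?d = "dbl X u v \<alpha> \<beta>"
  let ?F = "\<lambda>A B. letter_wt2 f2 g2 A B * (\<Prod>V\<in>perm_cycles X2 ?d - {A, B}. letter_wt f g V)"
  have LRX: "L \<subseteq> X" "R \<subseteq> X" using X by auto
  have X': "bij_betw \<alpha> X X" "bij_betw \<beta> X X" using b permutes_imp_bij by auto
  have cX2: "perm_cycles X2 ?d = (`) u ` perm_cycles X \<alpha> \<union> (`) v ` perm_cycles X \<beta>"
    by (simp add: perm_cycles_Un cycles_dbl_X[OF b(6,7)])
  have subX: "C \<subseteq> X" "C \<noteq> {}" if "C \<in> perm_cycles X \<alpha> \<or> C \<in> perm_cycles X \<beta>" for C
    using that perm_cycles_subset[OF X'(1)] perm_cycles_subset[OF X'(2)] perm_cycles_nonempty by blast+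
  have neq: "\<not> v ` C \<subseteq> u ` X" "\<not> u ` C \<subseteq> v ` X" if C: "C \<subseteq> X" "C \<noteq> {}" for C
  proof -
    obtain x where x: "x \<in> C" "x \<in> X" using C by blast
    have "u x \<notin> v ` X" "v x \<notin> u ` X" using u_neq_v x(2) by (metis imageE)+
    then show "\<not> v ` C \<subseteq> u ` X" "\<not> u ` C \<subseteq> v ` X" using x(1) by blast+
  qed
  have inj: "inj_on ((`) u) (perm_cycles X \<alpha>)" "inj_on ((`) v) (perm_cycles X \<beta>)"
    using X' inj_u inj_v by (auto intro!: inj_on_image_cycles)
  have disjuv: "(`) u ` \<C> \<inter> (`) v ` \<D> = {}" if "\<C> \<subseteq> perm_cycles X \<alpha>" "\<D> \<subseteq> perm_cycles X \<beta>" for \<C> \<D>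
    using that subX by (intro images_disjoint) blast+
  have cardu: "card (u ` C) = card C" "card (v ` C) = card C" if "C \<subseteq> X" for C
    using that inj_u inj_v by (meson card_image inj_on_subset)+
  have uu: "?F (u ` U) (u ` V) = f2 (card U) (card V) * wt f (perm_cycles X \<alpha> - {U, V}) * wt g (perm_cycles X \<beta>)"
    if "U \<in> perm_cycles X \<alpha>" "V \<in> perm_cycles X \<alpha>" for U V
  proof -
    have "perm_cycles X2 ?d - {u ` U, u ` V} = ((`) u ` perm_cycles X \<alpha> - (`) u ` {U, V}) \<union> (`) v ` perm_cycles X \<beta>"
      unfolding cX2 using disjuv[OF subset_refl subset_refl] that by auto
    also have "(`) u ` perm_cycles X \<alpha> - (`) u ` {U, V} = (`) u ` (perm_cycles X \<alpha> - {U, V})"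
      by (rule inj_on_image_set_diff[OF inj(1), symmetric]) (use that in auto)
    finally have e: "perm_cycles X2 ?d - {u ` U, u ` V} = (`) u ` (perm_cycles X \<alpha> - {U, V}) \<union> (`) v ` perm_cycles X \<beta>" .
    have "(\<Prod>V\<in>perm_cycles X2 ?d - {u ` U, u ` V}. letter_wt f g V) =
        (\<Prod>V\<in>(`) u ` (perm_cycles X \<alpha> - {U, V}). letter_wt f g V) * (\<Prod>V\<in>(`) v ` perm_cycles X \<beta>. letter_wt f g V)"
      unfolding e using finite_X by (intro prod.union_disjoint disjuv) auto
    also have "\<dots> = wt f (perm_cycles X \<alpha> - {U, V}) * wt g (perm_cycles X \<beta>)"
      using subX by (subst prod_letter_wt_u, blast, subst prod_letter_wt_v) auto
    finally show ?thesis using that subX cardu by (simp add: letter_wt2_def image_mono mult.assoc)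
  qed
  have vv: "?F (v ` U) (v ` V) = wt f (perm_cycles X \<alpha>) * (g2 (card U) (card V) * wt g (perm_cycles X \<beta> - {U, V}))"
    if "U \<in> perm_cycles X \<beta>" "V \<in> perm_cycles X \<beta>" for U V
  proof -
    have "perm_cycles X2 ?d - {v ` U, v ` V} = (`) u ` perm_cycles X \<alpha> \<union> ((`) v ` perm_cycles X \<beta> - (`) v ` {U, V})"
      unfolding cX2 using disjuv[OF subset_refl subset_refl] that by auto
    also have "(`) v ` perm_cycles X \<beta> - (`) v ` {U, V} = (`) v ` (perm_cycles X \<beta> - {U, V})"
      by (rule inj_on_image_set_diff[OF inj(2), symmetric]) (use that in auto)
    finally have e: "perm_cycles X2 ?d - {v ` U, v ` V} = (`) u ` perm_cycles X \<alpha> \<union> (`) v ` (perm_cycles X \<beta> - {U, V})" .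
    have "(\<Prod>V\<in>perm_cycles X2 ?d - {v ` U, v ` V}. letter_wt f g V) =
        (\<Prod>V\<in>(`) u ` perm_cycles X \<alpha>. letter_wt f g V) * (\<Prod>V\<in>(`) v ` (perm_cycles X \<beta> - {U, V}). letter_wt f g V)"
      unfolding e using finite_X by (intro prod.union_disjoint disjuv) auto
    also have "\<dots> = wt f (perm_cycles X \<alpha>) * wt g (perm_cycles X \<beta> - {U, V})"
      using subX by (subst prod_letter_wt_u, blast, subst prod_letter_wt_v) auto
    finally show ?thesis using that subX cardu neq(1)[of U] by (simp add: letter_wt2_def image_mono)
  qed
  have uv: "?F (u ` U) (v ` V) = 0" "?F (v ` V) (u ` U) = 0"
    if "U \<in> perm_cycles X \<alpha>" "V \<in> perm_cycles X \<beta>" for U V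
    using that neq(1)[of V] neq(2)[of U] subX[of U] subX[of V] by (simp_all add: letter_wt2_def)
  have sub: "perm_cycles L \<alpha> \<subseteq> perm_cycles X \<alpha>" "perm_cycles R \<alpha> \<subseteq> perm_cycles X \<alpha>"
    "perm_cycles L \<beta> \<subseteq> perm_cycles X \<beta>" "perm_cycles R \<beta> \<subseteq> perm_cycles X \<beta>"
    by (auto simp: perm_cycles_LR)
  have z: "(\<Sum>U\<in>perm_cycles L \<alpha>. \<Sum>V\<in>perm_cycles R \<beta>. ?F (u ` U) (v ` V)) = 0"
    "(\<Sum>U\<in>perm_cycles L \<beta>. \<Sum>V\<in>perm_cycles R \<alpha>. ?F (v ` U) (u ` V)) = 0"
    using uv sub by (intro sum.neutral ballI; blast)+
  have "letter_pair_wt f f2 g g2 (u ` L \<union> v ` L) (u ` R \<union> v ` R) ?d =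
      (\<Sum>U\<in>perm_cycles L \<alpha>. \<Sum>V\<in>perm_cycles R \<alpha>. ?F (u ` U) (u ` V)) + (\<Sum>U\<in>perm_cycles L \<beta>. \<Sum>V\<in>perm_cycles R \<beta>. ?F (v ` U) (v ` V))"
    unfolding letter_pair_wt_def sum_cycles_dbl[OF b(6,7) LRX(1) b(2,4)] sum_cycles_dbl[OF b(6,7) LRX(2) b(3,5)] sum.distrib z
    by simp
  also have "(\<Sum>U\<in>perm_cycles L \<alpha>. \<Sum>V\<in>perm_cycles R \<alpha>. ?F (u ` U) (u ` V)) = pair_wt f f2 X L R \<alpha> * wt g (perm_cycles X \<beta>)"
    unfolding pair_wt_def sum_distrib_right using uu sub by (intro sum.cong refl) blast
  also have "(\<Sum>U\<in>perm_cycles L \<beta>. \<Sum>V\<in>perm_cycles R \<beta>. ?F (v ` U) (v ` V)) = wt f (perm_cycles X \<alpha>) * pair_wt g g2 X L R \<beta>"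
    unfolding pair_wt_def sum_distrib_left using vv sub by (intro sum.cong refl) blast
  finally show ?thesis .
qed

lemma sum_geo_letter_pair_wt:
  assumes "two_cycles L R X \<gamma>"
  shows "(\<Sum>\<pi>\<in>geo X2 \<gamma>2. letter_pair_wt f f2 g g2 (u ` L \<union> v ` L) (u ` R \<union> v ` R) \<pi>) =
    (\<Sum>(\<alpha>, \<beta>)\<in>tri X \<gamma>. pair_wt f f2 X L R \<alpha> * wt g (perm_cycles X \<beta>) + wt f (perm_cycles X \<alpha>) * pair_wt g g2 X L R \<beta>)"
proof -
  have g: "geo X2 \<gamma>2 = {\<pi>. \<pi> permutes X2 \<and> \<pi> \<in> geo X2 \<gamma>2}" by (auto simp: geo_def)
  have t: "{(\<alpha>, \<beta>). \<alpha> permutes X \<and> \<beta> permutes X \<and> dbl X u v \<alpha> \<beta> \<in> geo X2 \<gamma>2} = tri X \<gamma>"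
    using dbl_geo_iff by (auto simp: tri_def)
  have "(\<Sum>\<pi>\<in>geo X2 \<gamma>2. letter_pair_wt f f2 g g2 (u ` L \<union> v ` L) (u ` R \<union> v ` R) \<pi>) =
      (\<Sum>(\<alpha>, \<beta>)\<in>tri X \<gamma>. letter_pair_wt f f2 g g2 (u ` L \<union> v ` L) (u ` R \<union> v ` R) (dbl X u v \<alpha> \<beta>))"
    by (subst g, subst sum_dbl[OF letter_pair_wt_zero]) (simp_all add: t)
  also have "\<dots> = (\<Sum>(\<alpha>, \<beta>)\<in>tri X \<gamma>. pair_wt f f2 X L R \<alpha> * wt g (perm_cycles X \<beta>) + wt f (perm_cycles X \<alpha>) * pair_wt g g2 X L R \<beta>)"
    using letter_pair_wt_dbl[OF assms] by (intro sum.cong refl) auto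
  finally show ?thesis .
qed

end

text \<open>The successor equations hold on each circle separately, by \<open>doubling_gamma\<close>
  with shifts 0 and \<open>n\<close>.\<close>

lemma doubling_annular:
  assumes "n \<ge> 1" "m \<ge> 1"
  shows "doubling {1..n+m} odd_pos even_pos (annular_gamma n m) (annular_gamma (2*n) (2*m))"
proof
  interpret two_cycles "{1..n}" "{n+1..n+m}" "{1..n+m}" "annular_gamma n m"
    using assms by (rule two_cycles_annular)
  interpret L: doubling "{1..n}" odd_pos even_pos "gamma {1..n}" "gamma {1..2*n}"
    using doubling_gamma[of 0 n] by simp
  interpret R: doubling "{n+1..n+m}" odd_pos even_pos "gamma {n+1..n+m}" "gamma {2*n+1..2*n+2*m}"
    by (rule doubling_gamma)
  show "bij_betw (annular_gamma n m) {1..n+m} {1..n+m}" by (rule bij_X)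
  show "inj_on odd_pos {1..n+m}" "inj_on even_pos {1..n+m}" by (auto simp: inj_on_def)
  show "odd_pos ` {1..n+m} \<inter> even_pos ` {1..n+m} = {}" by (auto, presburger)
  fix x assume "x \<in> {1..n+m}"
  then consider "x \<in> {1..n}" | "x \<in> {n+1..n+m}" by force
  then have "annular_gamma (2*n) (2*m) (odd_pos x) = even_pos x \<and>
    annular_gamma (2*n) (2*m) (even_pos x) = odd_pos (annular_gamma n m x)"
  proof cases
    case 1
    then have "odd_pos x \<in> {1..2*n}" "even_pos x \<in> {1..2*n}" by auto
    then show ?thesis
      using L.\<gamma>2_u[OF 1] L.\<gamma>2_v[OF 1] annular_gamma_eq(1)[OF 1] annular_gamma_eq(1)[of _ "2*n" "2*m"] by simp
  next
    case 2
    then have "odd_pos x \<in> {2*n+1..2*n+2*m}" "even_pos x \<in> {2*n+1..2*n+2*m}" by auto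
    then show ?thesis
      using R.\<gamma>2_u[OF 2] R.\<gamma>2_v[OF 2] annular_gamma_eq(2)[OF 2] annular_gamma_eq(2)[of _ "2*n" "2*m"] by simp
  qed
  then show "annular_gamma (2*n) (2*m) (odd_pos x) = even_pos x"
    "annular_gamma (2*n) (2*m) (even_pos x) = odd_pos (annular_gamma n m x)" by auto
qed simp

lemma cumulant2_letter_wt2:
  assumes free: "\<And>ls ms. ls \<noteq> [] \<Longrightarrow> ms \<noteq> [] \<Longrightarrow> set ls \<union> set ms = {True, False} \<Longrightarrow>
      free_cumulant2 \<phi> \<phi>2 (map (\<lambda>l. if l then a else b) ls) (map (\<lambda>l. if l then a else b) ms) = 0"
    and "doubling X odd_pos even_pos \<gamma> \<gamma>2" "0 \<notin> X"
    and sub: "set is \<subseteq> odd_pos ` X \<union> even_pos ` X" "set js \<subseteq> odd_pos ` X \<union> even_pos ` X"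
    and ne: "is \<noteq> []" "js \<noteq> []" and dist: "distinct is" "distinct js"
    and letters: "\<And>i. i \<in> set is \<union> set js \<Longrightarrow> xs ! (i - 1) = (if odd i then a else b)"
  shows "free_cumulant2 \<phi> \<phi>2 (entries xs is) (entries xs js) =
    doubling.letter_wt2 X odd_pos even_pos (kappa2 \<phi> \<phi>2 a) (kappa2 \<phi> \<phi>2 b) (set is) (set js)"
proof -
  interpret doubling X odd_pos even_pos \<gamma> \<gamma>2 by fact
  have c: "card (set is) = length is" "card (set js) = length js" using dist by (auto intro: distinct_card)
  have e: "entries xs is = map (\<lambda>l. if l then a else b) (map odd is)"
    "entries xs js = map (\<lambda>l. if l then a else b) (map odd js)"
    by (rule entries_alternating, rule letters, simp)+
  note oe = odd_even_subset[OF sub(1) assms(3)] odd_even_subset[OF sub(2) assms(3)]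
  consider "\<forall>i\<in>set is \<union> set js. odd i" | "\<forall>i\<in>set is \<union> set js. even i"
    | "\<exists>i\<in>set is \<union> set js. odd i" "\<exists>i\<in>set is \<union> set js. even i"
    by blast
  then show ?thesis
  proof cases
    case 1
    have "entries xs is = map (\<lambda>_. a) is" by (rule trans[OF e(1)]) (use 1 in auto)
    moreover have "entries xs js = map (\<lambda>_. a) js" by (rule trans[OF e(2)]) (use 1 in auto)
    ultimately have "entries xs is = replicate (length is) a" "entries xs js = replicate (length js) a"
      by (simp_all add: map_replicate_const)
    then show ?thesis using 1 oe c unfolding letter_wt2_def kappa2_def by simp
  next
    case 2
    have "entries xs is = map (\<lambda>_. b) is" by (rule trans[OF e(1)]) (use 2 in auto)
    moreover have "entries xs js = map (\<lambda>_. b) js" by (rule trans[OF e(2)]) (use 2 in auto)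
    ultimately have r: "entries xs is = replicate (length is) b" "entries xs js = replicate (length js) b"
      by (simp_all add: map_replicate_const)
    have "\<exists>i\<in>set is. even i" using 2 ne by (metis UnI1 last_in_set)
    then have "\<not> set is \<subseteq> odd_pos ` X" using oe by blast
    then show ?thesis using 2 oe c r unfolding letter_wt2_def kappa2_def by simp
  next
    case 3
    have "set (map odd is) \<union> set (map odd js) = {True, False}" using 3 by (auto simp: image_iff)
    then have "free_cumulant2 \<phi> \<phi>2 (entries xs is) (entries xs js) = 0"
      unfolding e using ne by (intro free) auto
    moreover have "\<not> (set is \<subseteq> odd_pos ` X \<and> set js \<subseteq> odd_pos ` X)" "\<not> (set is \<subseteq> even_pos ` X \<and> set js \<subseteq> even_pos ` X)"
      using 3 oe by auto
    ultimately show ?thesis unfolding letter_wt2_def by auto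
  qed
qed

lemma second_order_moment_alternating:
  assumes free: "second_order_free \<phi> \<phi>2 a b" and nm: "n \<ge> 1" "m \<ge> 1"
  defines "X \<equiv> {1..n+m}" and "\<gamma> \<equiv> annular_gamma n m"
  shows "\<phi>2 (prod_list (replicate n (a * b))) (prod_list (replicate m (a * b))) =
    (\<Sum>(\<alpha>, \<beta>)\<in>tri2 X \<gamma>. wt (kappa \<phi> a) (perm_cycles X \<alpha>) * wt (kappa \<phi> b) (perm_cycles X \<beta>)) +
    (\<Sum>(\<alpha>, \<beta>)\<in>tri X \<gamma>. pair_wt (kappa \<phi> a) (kappa2 \<phi> \<phi>2 a) X {1..n} {n+1..n+m} \<alpha> * wt (kappa \<phi> b) (perm_cycles X \<beta>)
       + wt (kappa \<phi> a) (perm_cycles X \<alpha>) * pair_wt (kappa \<phi> b) (kappa2 \<phi> \<phi>2 b) X {1..n} {n+1..n+m} \<beta>)"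
proof -
  let ?xs = "alt a b n" and ?ys = "alt a b m"
  let ?L = "{1..n}" and ?R = "{n+1..n+m}"
  let ?X2 = "{1..2*n+2*m}" and ?L2 = "{1..2*n}" and ?R2 = "{2*n+1..2*n+2*m}" and ?\<gamma>2 = "annular_gamma (2*n) (2*m)"
  have free1: "\<And>ls. set ls = {True, False} \<Longrightarrow> free_cumulant \<phi> (map (\<lambda>l. if l then a else b) ls) = 0"
    and free2: "\<And>ls ms. ls \<noteq> [] \<Longrightarrow> ms \<noteq> [] \<Longrightarrow> set ls \<union> set ms = {True, False} \<Longrightarrow>
      free_cumulant2 \<phi> \<phi>2 (map (\<lambda>l. if l then a else b) ls) (map (\<lambda>l. if l then a else b) ms) = 0"
    using free by (auto simp: second_order_free_def)
  interpret D: doubling X odd_pos even_pos \<gamma> ?\<gamma>2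
    unfolding X_def \<gamma>_def using nm by (rule doubling_annular)
  have tc: "two_cycles ?L ?R X \<gamma>" unfolding X_def \<gamma>_def using nm by (rule two_cycles_annular)
  have nm2: "2 * n \<ge> 1" "2 * m \<ge> 1" using nm by auto
  interpret T2: two_cycles ?L2 ?R2 ?X2 ?\<gamma>2 using nm2 by (rule two_cycles_annular)
  have X2: "odd_pos ` X \<union> even_pos ` X = ?X2" using odd_even_pos_Icc[of 0 "n + m"] by (simp add: X_def distrib_left)
  have L2: "odd_pos ` ?L \<union> even_pos ` ?L = ?L2" using odd_even_pos_Icc[of 0 n] by simp
  have R2: "odd_pos ` ?R \<union> even_pos ` ?R = ?R2" by (rule odd_even_pos_Icc)
  have X0: "0 \<notin> X" by (simp add: X_def)
  have letters: "(?xs @ ?ys) ! (i - 1) = (if odd i then a else b)" if "i \<in> ?X2" for i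
  proof -
    have i: "1 \<le> i" "i - 1 < 2 * n + 2 * m" using that by auto
    show ?thesis
    proof (cases "i - 1 < 2 * n")
      case True
      then show ?thesis using i by (simp add: nth_append alt_nth)
    next
      case False
      then have "i - 1 - 2 * n < 2 * m" "even (i - 1 - 2 * n) \<longleftrightarrow> odd i" using i by auto
      then show ?thesis using False by (simp add: nth_append alt_nth)
    qed
  qed
  have block: "finite V \<and> V \<subseteq> ?X2 \<and> V \<noteq> {}" if "\<pi> permutes ?X2" "V \<in> perm_cycles ?X2 \<pi>" for V \<pi>
    using perm_cycles_subset[OF permutes_imp_bij[OF that(1)] that(2)] finite_subset perm_cycles_nonempty[OF that(2)] by blast
  \<comment> \<open>Stated for lists, since the arguments of an annular cycle are read along the
    cycle and those of a non-crossing block in increasing order.\<close>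
  have fc: "free_cumulant \<phi> (entries (?xs @ ?ys) is) = D.letter_wt (kappa \<phi> a) (kappa \<phi> b) (set is)"
    if "set is \<subseteq> ?X2" "is \<noteq> []" "distinct is" for "is"
    by (rule cumulant_letter_wt[OF free1 D.doubling_axioms X0 that(1)[folded X2] that(2,3) letters]) (use that(1) in auto)
  have fc2: "free_cumulant2 \<phi> \<phi>2 (entries (?xs @ ?ys) (sorted_list_of_set A)) (entries (?xs @ ?ys) (sorted_list_of_set B)) =
      D.letter_wt2 (kappa2 \<phi> \<phi>2 a) (kappa2 \<phi> \<phi>2 b) A B"
    if "finite A \<and> A \<subseteq> ?X2 \<and> A \<noteq> {}" "finite B \<and> B \<subseteq> ?X2 \<and> B \<noteq> {}" for A B
  proof -
    let ?is = "sorted_list_of_set A" and ?js = "sorted_list_of_set B"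
    have s: "set ?is = A" "set ?js = B" using that by simp_all
    have sub: "set ?is \<subseteq> odd_pos ` X \<union> even_pos ` X" "set ?js \<subseteq> odd_pos ` X \<union> even_pos ` X"
      unfolding X2 s using that by simp_all
    have ne: "?is \<noteq> []" "?js \<noteq> []" using that s by (metis list.set(1))+
    have "(?xs @ ?ys) ! (i - 1) = (if odd i then a else b)" if "i \<in> set ?is \<union> set ?js" for i
    proof (rule letters)
      show "i \<in> ?X2" using that sub unfolding X2 by (meson UnE subsetD)
    qed
    from cumulant2_letter_wt2[OF free2 D.doubling_axioms X0 sub ne
        distinct_sorted_list_of_set distinct_sorted_list_of_set this]
    show ?thesis unfolding s .
  qed
  have first: "(\<Prod>V\<in>perm_cycles ?X2 \<pi>. free_cumulant \<phi> (entries (?xs @ ?ys) (support \<pi> (Min V)))) =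
      (\<Prod>V\<in>perm_cycles ?X2 \<pi>. D.letter_wt (kappa \<phi> a) (kappa \<phi> b) V)" if "\<pi> \<in> ann ?X2 ?\<gamma>2" for \<pi>
  proof (rule prod.cong[OF refl])
    fix V assume V: "V \<in> perm_cycles ?X2 \<pi>"
    have \<pi>: "\<pi> permutes ?X2" using that by (simp add: ann_def)
    have "Min V \<in> V" using block[OF \<pi> V] by (intro Min_in) auto
    note s = support_cycle[OF T2.finite_X \<pi> V this]
    have "support \<pi> (Min V) \<noteq> []" using s(1) block[OF \<pi> V] by (metis list.set(1))
    then show "free_cumulant \<phi> (entries (?xs @ ?ys) (support \<pi> (Min V))) = D.letter_wt (kappa \<phi> a) (kappa \<phi> b) V"
      using fc[of "support \<pi> (Min V)"] s block[OF \<pi> V] by metis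
  qed
  have second: "(\<Sum>A\<in>perm_cycles ?L2 \<pi>. \<Sum>B\<in>perm_cycles ?R2 \<pi>.
      free_cumulant2 \<phi> \<phi>2 (entries (?xs @ ?ys) (sorted_list_of_set A)) (entries (?xs @ ?ys) (sorted_list_of_set B))
      * (\<Prod>V\<in>perm_cycles ?X2 \<pi> - {A, B}. free_cumulant \<phi> (entries (?xs @ ?ys) (sorted_list_of_set V)))) =
      D.letter_pair_wt (kappa \<phi> a) (kappa2 \<phi> \<phi>2 a) (kappa \<phi> b) (kappa2 \<phi> \<phi>2 b) ?L2 ?R2 \<pi>" if "\<pi> \<in> geo ?X2 ?\<gamma>2" for \<pi>
    unfolding D.letter_pair_wt_def X2
  proof (intro sum.cong refl)
    fix A B assume AB: "A \<in> perm_cycles ?L2 \<pi>" "B \<in> perm_cycles ?R2 \<pi>"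
    have \<pi>: "\<pi> permutes ?X2" using that by (simp add: geo_def)
    have "A \<in> perm_cycles ?X2 \<pi>" "B \<in> perm_cycles ?X2 \<pi>" unfolding T2.perm_cycles_LR using AB by auto
    then have "free_cumulant2 \<phi> \<phi>2 (entries (?xs @ ?ys) (sorted_list_of_set A)) (entries (?xs @ ?ys) (sorted_list_of_set B)) =
        D.letter_wt2 (kappa2 \<phi> \<phi>2 a) (kappa2 \<phi> \<phi>2 b) A B" using block[OF \<pi>] by (intro fc2) auto
    moreover have "(\<Prod>V\<in>perm_cycles ?X2 \<pi> - {A, B}. free_cumulant \<phi> (entries (?xs @ ?ys) (sorted_list_of_set V))) =
        (\<Prod>V\<in>perm_cycles ?X2 \<pi> - {A, B}. D.letter_wt (kappa \<phi> a) (kappa \<phi> b) V)"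
    proof (rule prod.cong[OF refl])
      fix V assume "V \<in> perm_cycles ?X2 \<pi> - {A, B}"
      then have "finite V \<and> V \<subseteq> ?X2 \<and> V \<noteq> {}" using block[OF \<pi>] by blast
      then show "free_cumulant \<phi> (entries (?xs @ ?ys) (sorted_list_of_set V)) = D.letter_wt (kappa \<phi> a) (kappa \<phi> b) V"
        using fc[of "sorted_list_of_set V"] by auto
    qed
    ultimately show "free_cumulant2 \<phi> \<phi>2 (entries (?xs @ ?ys) (sorted_list_of_set A)) (entries (?xs @ ?ys) (sorted_list_of_set B))
      * (\<Prod>V\<in>perm_cycles ?X2 \<pi> - {A, B}. free_cumulant \<phi> (entries (?xs @ ?ys) (sorted_list_of_set V))) =
      D.letter_wt2 (kappa2 \<phi> \<phi>2 a) (kappa2 \<phi> \<phi>2 b) A B * (\<Prod>V\<in>perm_cycles ?X2 \<pi> - {A, B}. D.letter_wt (kappa \<phi> a) (kappa \<phi> b) V)"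
      by simp
  qed
  have "?xs \<noteq> []" "?ys \<noteq> []" using nm by (auto simp: alt_def)
  from second_order_moment_cumulant[OF this, of \<phi>2 \<phi>]
  have "\<phi>2 (prod_list ?xs) (prod_list ?ys) =
     (\<Sum>\<pi>\<in>S_NC (2*n) (2*m). \<Prod>V\<in>perm_cycles ?X2 \<pi>. free_cumulant \<phi> (entries (?xs @ ?ys) (support \<pi> (Min V)))) +
     (\<Sum>(\<U>, P)\<in>S_NC' (2*n) (2*m). let A = \<Union>(P - \<U>) \<inter> ?L2; B = \<Union>(P - \<U>) \<inter> ?R2 in
          free_cumulant2 \<phi> \<phi>2 (entries (?xs @ ?ys) (sorted_list_of_set A)) (entries (?xs @ ?ys) (sorted_list_of_set B))
          * (\<Prod>V\<in>P - {A, B}. free_cumulant \<phi> (entries (?xs @ ?ys) (sorted_list_of_set V))))"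
    unfolding length_alt .
  also have "\<dots> = (\<Sum>\<pi>\<in>ann ?X2 ?\<gamma>2. \<Prod>V\<in>perm_cycles ?X2 \<pi>. D.letter_wt (kappa \<phi> a) (kappa \<phi> b) V) +
      (\<Sum>\<pi>\<in>geo ?X2 ?\<gamma>2. D.letter_pair_wt (kappa \<phi> a) (kappa2 \<phi> \<phi>2 a) (kappa \<phi> b) (kappa2 \<phi> \<phi>2 b) ?L2 ?R2 \<pi>)"
    unfolding S_NC_eq_ann[OF nm2] sum_S_NC'[OF nm2]
    by (intro arg_cong2[of _ _ _ _ "(+)"] sum.cong[OF refl] first second)
  also have "\<dots> = (\<Sum>(\<alpha>, \<beta>)\<in>tri2 X \<gamma>. wt (kappa \<phi> a) (perm_cycles X \<alpha>) * wt (kappa \<phi> b) (perm_cycles X \<beta>)) +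
    (\<Sum>(\<alpha>, \<beta>)\<in>tri X \<gamma>. pair_wt (kappa \<phi> a) (kappa2 \<phi> \<phi>2 a) X ?L ?R \<alpha> * wt (kappa \<phi> b) (perm_cycles X \<beta>)
       + wt (kappa \<phi> a) (perm_cycles X \<alpha>) * pair_wt (kappa \<phi> b) (kappa2 \<phi> \<phi>2 b) X ?L ?R \<beta>)"
    using D.sum_ann_letter_wt D.sum_geo_letter_pair_wt[OF tc] unfolding X2 L2 R2 by metis
  finally show ?thesis by (simp add: prod_list_alt)
qed

section \<open>Second order cumulants of a product\<close>

text \<open>With as many cycles as points, distinct points have distinct orbits, but
  \<open>x\<close> and \<open>f x\<close> share theirs.\<close>

lemma fixed_of_nc_eq_card:
  assumes "finite X" "bij_betw f X X" "nc X f = card X" "x \<in> X"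
  shows "f x = x"
proof -
  have "inj_on (orbit f) X" using assms(1,3) by (intro eq_card_imp_inj_on) (simp_all add: perm_cycles_def)
  moreover have fx: "f x \<in> X" using assms(2,4) by (auto simp: bij_betw_def)
  moreover have "orbit f (f x) = orbit f x"
  proof -
    have "(x, f x) \<in> eqcl (moves X {f})" using assms(4) by (auto simp: moves_def intro!: eqcl_base)
    then show ?thesis
      using orbit_eq_class[OF assms(1,2,4)] orbit_eq_class[OF assms(1,2) fx] eqcl_class_eq by metis
  qed
  ultimately show ?thesis using assms(4) by (auto dest: inj_onD)
qed

context two_cycles
begin

text \<open>A single cycle on each circle leaves \<open>card X\<close> cycles for
  \<open>inv \<sigma> \<circ> \<gamma>\<close>, which is therefore the identity.\<close>

lemma geo_top:
  assumes "\<sigma> \<in> geo X \<gamma>" "L \<in> perm_cycles L \<sigma>" "R \<in> perm_cycles R \<sigma>" "\<gamma> permutes X"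
  shows "\<sigma> = \<gamma>"
proof -
  note b = geo_invariant_LR[OF assms(1)]
  have "perm_cycles L \<sigma> = {L}" "perm_cycles R \<sigma> = {R}"
    using cycle_perm_cycles(2)[OF fin(1) b(1) assms(2)] cycle_perm_cycles(2)[OF fin(2) b(2) assms(3)] .
  then have "nc X \<sigma> = 2" using nc_Un[OF fin b(1,2) LR] X by simp
  then have n: "nc X (inv \<sigma> \<circ> \<gamma>) = card X" using assms(1) nc_\<gamma> by (simp add: geo_def)
  have q: "inv \<sigma> \<circ> \<gamma> permutes X" using b(4) assms(4) by (simp add: permutes_compose permutes_inv)
  have "(inv \<sigma> \<circ> \<gamma>) x = x" for x
    using fixed_of_nc_eq_card[OF finite_X permutes_imp_bij[OF q] n] permutes_not_in[OF q] by (cases "x \<in> X") auto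
  then have "inv \<sigma> \<circ> \<gamma> = id" by (simp add: fun_eq_iff)
  then show ?thesis using comp_inv_comp[OF b(4), of \<gamma>] by simp
qed

text \<open>The only term that involves \<open>k2 (card L) (card R)\<close> is that of \<open>\<gamma>\<close> itself.\<close>

lemma sum_pair_wt_determines:
  assumes \<gamma>: "\<gamma> permutes X"
    and k: "\<And>i. i \<ge> 1 \<Longrightarrow> k i = k' i"
    and less: "\<And>i j. i \<ge> 1 \<Longrightarrow> j \<ge> 1 \<Longrightarrow> i + j < card L + card R \<Longrightarrow> k2 i j = k2' i j"
    and eq: "(\<Sum>\<sigma>\<in>geo X \<gamma>. pair_wt k k2 X L R \<sigma>) = (\<Sum>\<sigma>\<in>geo X \<gamma>. pair_wt k' k2' X L R \<sigma>)"
  shows "k2 (card L) (card R) = k2' (card L) (card R)"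
proof -
  have top: "\<gamma> \<in> geo X \<gamma>" using \<gamma> by (simp add: geo_def permutes_inv_o nc_id)
  have cyc: "perm_cycles X \<gamma> - {L, R} = {}" using cycle_L cycle_R by (auto simp: X perm_cycles_Un)
  have top_wt: "pair_wt h h2 X L R \<gamma> = h2 (card L) (card R)" for h h2
    by (simp add: pair_wt_def cycle_L cycle_R cyc wt_def)
  have "pair_wt k k2 X L R \<sigma> = pair_wt k' k2' X L R \<sigma>" if \<sigma>: "\<sigma> \<in> geo X \<gamma> - {\<gamma>}" for \<sigma>
    unfolding pair_wt_def
  proof (intro sum.cong refl arg_cong2[of _ _ _ _ "(*)"])
    have \<sigma>': "\<sigma> \<in> geo X \<gamma>" "\<sigma> \<noteq> \<gamma>" using \<sigma> by auto
    note b = geo_invariant_LR[OF \<sigma>'(1)]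
    have pos: "card C \<ge> 1" if "C \<in> perm_cycles X \<sigma>" for C
      using that perm_cycles_nonempty[OF that] perm_cycles_subset[OF b(3) that] finite_X
      by (metis One_nat_def Suc_leI card_gt_0_iff finite_subset)
    fix A B assume AB: "A \<in> perm_cycles L \<sigma>" "B \<in> perm_cycles R \<sigma>"
    then have sub: "A \<subseteq> L" "B \<subseteq> R" using perm_cycles_subset b by auto
    then have le: "card A \<le> card L" "card B \<le> card R" using fin by (auto intro: card_mono)
    \<comment> \<open>With equal sizes \<open>A\<close> and \<open>B\<close> would be the full
      circles, which by \<open>geo_top\<close> happens only for \<open>\<gamma>\<close>.\<close>
    have "\<not> (card A = card L \<and> card B = card R)"
    proof
      assume "card A = card L \<and> card B = card R"
      then have "A = L" "B = R" using card_subset_eq[OF fin(1) sub(1)] card_subset_eq[OF fin(2) sub(2)] by auto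
      then show False using geo_top[OF \<sigma>'(1)] AB \<gamma> \<sigma>'(2) by simp
    qed
    then have "card A + card B < card L + card R" using le by linarith
    then show "k2 (card A) (card B) = k2' (card A) (card B)"
      using AB pos by (intro less) (auto simp: X perm_cycles_Un)
    show "wt k (perm_cycles X \<sigma> - {A, B}) = wt k' (perm_cycles X \<sigma> - {A, B})"
      unfolding wt_def using pos by (intro prod.cong refl k) auto
  qed
  then have "(\<Sum>\<sigma>\<in>geo X \<gamma> - {\<gamma>}. pair_wt k k2 X L R \<sigma>) = (\<Sum>\<sigma>\<in>geo X \<gamma> - {\<gamma>}. pair_wt k' k2' X L R \<sigma>)"
    by (rule sum.cong[OF refl])
  then show ?thesis
    using eq top_wt sum.remove[OF finite_geo[OF finite_X] top, of "pair_wt k k2 X L R"]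
      sum.remove[OF finite_geo[OF finite_X] top, of "pair_wt k' k2' X L R"] by simp
qed

end

lemma annular_gamma_permutes: "annular_gamma p q permutes {1..p+q}"
  unfolding annular_gamma_def
  by (intro permutes_compose permutes_subset[OF gamma_permutes]) auto

text \<open>By \<open>sum_assoc\<close> the candidate satisfies the second order moment-cumulant
  formula of \<open>a * b\<close>. The annular terms agree because the first order cumulants are
  already identified, and \<open>sum_pair_wt_determines\<close> isolates the top term in an
  induction on \<open>n + m\<close>.\<close>

lemma kappa2_prod_eq:
  assumes free: "second_order_free \<phi> \<phi>2 a b" and "n \<ge> 1" "m \<ge> 1"
  shows "kappa2 \<phi> \<phi>2 (a * b) n m =
    prod_kappa2 (kappa \<phi> a) (kappa2 \<phi> \<phi>2 a) (kappa \<phi> b) (kappa2 \<phi> \<phi>2 b) n m"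
  using assms(2,3)
proof (induction "n + m" arbitrary: n m rule: less_induct)
  case (less n m)
  let ?X = "{1..n+m}" and ?L = "{1..n}" and ?R = "{n+1..n+m}" and ?\<gamma> = "annular_gamma n m"
  let ?k = "prod_kappa (kappa \<phi> a) (kappa \<phi> b)"
    and ?k2 = "prod_kappa2 (kappa \<phi> a) (kappa2 \<phi> \<phi>2 a) (kappa \<phi> b) (kappa2 \<phi> \<phi>2 b)"
  interpret two_cycles ?L ?R ?X ?\<gamma> using less.prems by (rule two_cycles_annular)
  have k: "kappa \<phi> (a * b) i = ?k i" if "i \<ge> 1" for i
    using free that by (intro kappa_prod_eq) (auto simp: second_order_free_def)
  have "wt (kappa \<phi> (a * b)) (perm_cycles ?X \<pi>) = wt ?k (perm_cycles ?X \<pi>)" if "\<pi> \<in> ann ?X ?\<gamma>" for \<pi>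
    unfolding wt_def
  proof (intro prod.cong refl k)
    fix C assume C: "C \<in> perm_cycles ?X \<pi>"
    have "bij_betw \<pi> ?X ?X" using that by (simp add: ann_def permutes_imp_bij)
    then show "card C \<ge> 1"
      using perm_cycles_nonempty[OF C] perm_cycles_subset[OF _ C] finite_X
      by (metis One_nat_def Suc_leI card_gt_0_iff finite_subset)
  qed
  then have "(\<Sum>\<pi>\<in>ann ?X ?\<gamma>. wt (kappa \<phi> (a * b)) (perm_cycles ?X \<pi>)) = (\<Sum>\<pi>\<in>ann ?X ?\<gamma>. wt ?k (perm_cycles ?X \<pi>))"
    by (rule sum.cong[OF refl])
  then have eq: "(\<Sum>\<sigma>\<in>geo ?X ?\<gamma>. pair_wt (kappa \<phi> (a * b)) (kappa2 \<phi> \<phi>2 (a * b)) ?X ?L ?R \<sigma>) =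
      (\<Sum>\<sigma>\<in>geo ?X ?\<gamma>. pair_wt ?k ?k2 ?X ?L ?R \<sigma>)"
    using second_order_moment_replicate[OF less.prems, of \<phi>2 "a * b" \<phi>]
      second_order_moment_alternating[OF free less.prems]
      sum_assoc[of "kappa \<phi> a" "kappa \<phi> b" "kappa2 \<phi> \<phi>2 a" "kappa2 \<phi> \<phi>2 b"] by simp
  have "kappa2 \<phi> \<phi>2 (a * b) (card ?L) (card ?R) = ?k2 (card ?L) (card ?R)"
    by (rule sum_pair_wt_determines[OF annular_gamma_permutes k _ eq]) (use less.hyps in auto)
  then show ?case by simp
qed

lemma kappa_prod_eq_wt: "kappa_prod \<phi> x P = wt (kappa \<phi> x) P"
  by (simp add: kappa_prod_def wt_def)

text \<open>The partitions of the second circle are taken on \<open>{n+1..n+m}\<close> instead of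
  \<open>{1..m}\<close>, an order-preserving shift under which block sizes, the only data that
  enter, are unchanged.\<close>

theorem theorem1p7:
  fixes scale :: "complex \<Rightarrow> 'a::ring_1 \<Rightarrow> 'a"
    and \<phi> :: "'a \<Rightarrow> complex" and \<phi>2 :: "'a \<Rightarrow> 'a \<Rightarrow> complex"
    and a b :: 'a and n m :: nat
  assumes "second_order_prob_space scale \<phi> \<phi>2"
    and "second_order_free \<phi> \<phi>2 a b"
    and "n \<ge> 1" and "m \<ge> 1"
  shows "kappa2 \<phi> \<phi>2 (a * b) n m =
      (\<Sum>\<pi>\<in>S_NC n m.
          kappa_prod \<phi> a (perm_cycles {1..n+m} \<pi>) * kappa_prod \<phi> b (annular_kreweras n m \<pi>))
    + (\<Sum>(\<pi>1, \<pi>2) \<in> NC {1..n} \<times> NC {n+1..n+m}. \<Sum>U\<in>\<pi>1. \<Sum>V\<in>\<pi>2.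
          kappa2 \<phi> \<phi>2 a (card U) (card V)
          * kappa_prod \<phi> a (\<pi>1 \<union> \<pi>2 - {U, V})
          * kappa_prod \<phi> b (kreweras {1..n} \<pi>1 \<union> kreweras {n+1..n+m} \<pi>2))
    + (\<Sum>(\<pi>1, \<pi>2) \<in> NC {1..n} \<times> NC {n+1..n+m}.
        \<Sum>U\<in>kreweras {1..n} \<pi>1. \<Sum>V\<in>kreweras {n+1..n+m} \<pi>2.
          kappa2 \<phi> \<phi>2 b (card U) (card V)
          * kappa_prod \<phi> a (\<pi>1 \<union> \<pi>2)
          * kappa_prod \<phi> b (kreweras {1..n} \<pi>1 \<union> kreweras {n+1..n+m} \<pi>2 - {U, V}))"
proof -
  let ?X = "{1..n+m}" and ?L = "{1..n}" and ?R = "{n+1..n+m}" and ?\<gamma> = "annular_gamma n m"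
  interpret two_cycles ?L ?R ?X ?\<gamma> using assms(3,4) by (rule two_cycles_annular)
  \<comment> \<open>The three parts of \<open>conv2\<close> at \<open>annular_gamma n m\<close> are
    now translated one by one; planar permutations turn into pairs of non-crossing partitions by
    \<open>sum_NC_pair\<close>.\<close>
  have first: "conv_ann (kappa \<phi> a) (kappa \<phi> b) ?X ?\<gamma> = (\<Sum>\<pi>\<in>S_NC n m.
      kappa_prod \<phi> a (perm_cycles ?X \<pi>) * kappa_prod \<phi> b (annular_kreweras n m \<pi>))"
    by (simp add: conv_ann_def S_NC_eq_ann[OF assms(3,4)] kappa_prod_eq_wt annular_kreweras_def)
  have second: "conv_left (kappa \<phi> a) (kappa2 \<phi> \<phi>2 a) (kappa \<phi> b) ?X ?L ?R ?\<gamma> =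
      (\<Sum>(\<pi>1, \<pi>2) \<in> NC ?L \<times> NC ?R. \<Sum>U\<in>\<pi>1. \<Sum>V\<in>\<pi>2.
          kappa2 \<phi> \<phi>2 a (card U) (card V)
          * kappa_prod \<phi> a (\<pi>1 \<union> \<pi>2 - {U, V})
          * kappa_prod \<phi> b (kreweras ?L \<pi>1 \<union> kreweras ?R \<pi>2))"
    unfolding sum_NC_pair[OF assms(3,4), of "\<lambda>\<pi>1 \<kappa>1 \<pi>2 \<kappa>2. \<Sum>U\<in>\<pi>1. \<Sum>V\<in>\<pi>2.
          kappa2 \<phi> \<phi>2 a (card U) (card V) * kappa_prod \<phi> a (\<pi>1 \<union> \<pi>2 - {U, V}) * kappa_prod \<phi> b (\<kappa>1 \<union> \<kappa>2)"]
    by (simp only: conv_left_def pair_wt_def sum_distrib_right kappa_prod_eq_wt perm_cycles_LR)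
  have third: "conv_right (kappa \<phi> a) (kappa \<phi> b) (kappa2 \<phi> \<phi>2 b) ?X ?L ?R ?\<gamma> =
      (\<Sum>(\<pi>1, \<pi>2) \<in> NC ?L \<times> NC ?R. \<Sum>U\<in>kreweras ?L \<pi>1. \<Sum>V\<in>kreweras ?R \<pi>2.
          kappa2 \<phi> \<phi>2 b (card U) (card V)
          * kappa_prod \<phi> a (\<pi>1 \<union> \<pi>2)
          * kappa_prod \<phi> b (kreweras ?L \<pi>1 \<union> kreweras ?R \<pi>2 - {U, V}))"
    unfolding sum_NC_pair[OF assms(3,4), of "\<lambda>\<pi>1 \<kappa>1 \<pi>2 \<kappa>2. \<Sum>U\<in>\<kappa>1. \<Sum>V\<in>\<kappa>2.
          kappa2 \<phi> \<phi>2 b (card U) (card V) * kappa_prod \<phi> a (\<pi>1 \<union> \<pi>2) * kappa_prod \<phi> b (\<kappa>1 \<union> \<kappa>2 - {U, V})"]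
    by (simp only: conv_right_def pair_wt_def sum_distrib_left kappa_prod_eq_wt perm_cycles_LR mult_ac)
  show ?thesis
    unfolding kappa2_prod_eq[OF assms(2-4)] prod_kappa2_def conv2_def first second third ..
qed

end
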